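(* Let $(\Sigma,w)$ be a weighted fan in $\mathfrak{t}$ and let $\mathcal{L}$ be a $\mathbb{T}$-linearized orbi-line bundle on $\mathcal{X}_{\Sigma,w}$ corresponding to the collection $\{m_\sigma\in\widetilde{\mathfrak{t}}^\ast_{\sigma,\mathbb{Z}}\}_{\sigma\in\Sigma(n)}$, where $m_{\sigma_1}-m_{\sigma_2}\in(\sigma_1\cap\sigma_2)^\perp$ for all $\sigma_1,\sigma_2\in\Sigma(n)$. Let $$P_{\{m_\sigma\}_{\sigma\in\Sigma(n)}}=\bigcap_{\sigma\in\Sigma(n)}(m_\sigma+\sigma^\vee)\subset\mathfrak{t}^\ast$$ be the associated (possibly degenerate or empty) Newton polytope. Then the dimension of the space of global sections is $$h^0(\mathcal{X}_{\Sigma,w},\mathcal{L})=\#\left(\mathfrak{t}^\ast_{\mathbb{Z}}\cap P_{\{m_\sigma\}_{\sigma\in\Sigma(n)}}\right);$$ more precisely, each character in the intersection on the right-hand side appears with multiplicity one in the character decomposition of the representation of $\mathbb{T}$ on $H^0(\mathcal{X}_{\Sigma,w},\mathcal{L})$.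
   Context: $\mathbb{T}\cong\mathbb{R}^n/\mathbb{Z}^n$ is a fixed torus with Lie algebra $\mathfrak{t}$, lattice $\mathfrak{t}_{\mathbb{Z}}=\pi_1(\mathbb{T})\subset\mathfrak{t}$, and character lattice $\mathfrak{t}^\ast_{\mathbb{Z}}\subset\mathfrak{t}^\ast$; $\chi_m$ is the character given by $m$. A weighted fan $(\Sigma,w)$ is a complete simplicial rational fan $\Sigma$ of convex cones in $\mathfrak{t}$ with a function $w:\Sigma(1)\to\mathbb{N}_+$, where $\Sigma(k)$ is the set of $k$-dimensional cones. For $\rho\in\Sigma(1)$, $\nu_\rho$ generates $\rho\cap\mathfrak{t}_{\mathbb{Z}}$. For a cone $\tau$, $\tau^\vee=\{x\in\mathfrak{t}^\ast:\langle x,\tau\rangle\ge0\}$ is the dual cone and $\tau^\perp$ the annihilator. $X_\Sigma$ is the complete toric variety over $\mathbb{C}$ of $\Sigma$ with affine toric open subsets $U_\tau$. For $\sigma\in\Sigma(n)$ let $\widetilde{\mathfrak{t}}_{\sigma,\mathbb{Z}}=\langle w_\rho\nu_\rho:\rho\in\Sigma(1),\rho\subset\sigma\rangle\subset\mathfrak{t}_{\mathbb{Z}}$, and for $\tau\in\Sigma$ let $\widetilde{\mathfrak{t}}_{\tau,\mathbb{Z}}=\bigcap_{\sigma\in\Sigma(n),\sigma\supset\tau}\widetilde{\mathfrak{t}}_{\sigma,\mathbb{Z}}$. Let $\widetilde{\mathbb{T}}_\tau\to\mathbb{T}$ be the cover with $\pi_1\widetilde{\mathbb{T}}_\tau=\widetilde{\mathfrak{t}}_{\tau,\mathbb{Z}}$,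 $\widetilde\Gamma_\tau$ its (finite) kernel, and $\widetilde{\mathfrak{t}}^\ast_{\tau,\mathbb{Z}}\subset\mathfrak{t}^\ast$ the dual lattice of $\widetilde{\mathfrak{t}}_{\tau,\mathbb{Z}}$. Let $\widetilde U_\tau$ be the (nonsingular) affine toric variety of $\tau$ with respect to the lattice $\widetilde{\mathfrak{t}}_{\tau,\mathbb{Z}}$, so $\widetilde U_\tau/\widetilde\Gamma_\tau=U_\tau$. The toric orbifold $\mathcal{X}_{\Sigma,w}\to X_\Sigma$ has uniformizing charts $\widetilde\Gamma_\tau\circlearrowright\widetilde U_\tau\to U_\tau$, glued for $\tau'\subset\tau$ by the natural toric maps $\psi^{\tau'}_\tau:\widetilde U_{\tau'}\to\widetilde U_\tau$. A $\mathbb{T}$-linearized orbi-line bundle is a collection of $\widetilde{\mathbb{T}}_\tau$-equivariant (analytic/algebraic) line bundles $L_\tau\to\widetilde U_\tau$ with $\widetilde{\mathbb{T}}_{\tau'}$-equivariant isomorphisms $(\psi^{\tau'}_\tau)^\ast L_\tau\to L_{\tau'}$ for $\tau'\subset\tau$, whose induced transition functions satisfy the cocycle condition. Such bundles correspond to compatible collections $\{m_\sigma\}$ as in the claim: $L_\sigma\cong\widetilde U_\sigma\times\mathbb{C}$ equivariantly with action on $\mathbb{C}$ given by the character $m_\sigma$ of $\widetilde{\mathbb{T}}_\sigma$, i.e. the trivializing section has weight $m_\sigma$. Sections over $U_\sigma$ are the $\widetilde\Gamma_\sigma$-invariant holomorphic sections of $L_\sigma$ over $\widetilde U_\sigma$;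 global sections are collections of such local sections agreeing on overlaps. They carry a natural $\mathbb{T}$-action, obtained by lifting $t\in\mathbb{T}$ to $\widetilde{\mathbb{T}}_\sigma$. Convention on weights: the monomial function $\chi_m$ on $\widetilde U_\sigma$ has weight $m$, so that $\chi_m$ times the trivializing section of $L_\sigma$ has weight $m_\sigma+m$. *)

theory Defs
  imports "HOL-Analysis.Analysis" "HOL-Library.Function_Algebras"
begin

section \<open>Lattices and cones\<close>

text \<open>
  The Lie algebra of the torus is \<open>real ^ 'n\<close> with lattice \<open>std_lattice\<close>, so the torus itself is
  \<open>real ^ 'n\<close> modulo \<open>std_lattice\<close>. The dual space is identified with \<open>real ^ 'n\<close> through the
  inner product, which serves as the pairing.
\<close>

definition std_lattice :: "(real ^ 'n::finite) set" where
  "std_lattice = {v. \<forall>i. v $ i \<in> \<int>}"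

definition dual_lattice :: "(real ^ 'n::finite) set \<Rightarrow> (real ^ 'n) set" where
  "dual_lattice N = {m. \<forall>v\<in>N. m \<bullet> v \<in> \<int>}"

definition dual_cone :: "(real ^ 'n::finite) set \<Rightarrow> (real ^ 'n) set" where
  "dual_cone \<tau> = {m. \<forall>v\<in>\<tau>. 0 \<le> m \<bullet> v}"

text \<open>For a vector \<open>\<xi>\<close> representing an element of the torus, \<open>char_val m \<xi>\<close> is the value at it of the
  character with differential \<open>m\<close>.\<close>

definition char_val :: "real ^ 'n::finite \<Rightarrow> real ^ 'n \<Rightarrow> complex" where
  "char_val m \<xi> = cis (2 * pi * (m \<bullet> \<xi>))"


section \<open>Weighted fans\<close>

definition rational_simplicial_cone :: "(real ^ 'n::finite) set \<Rightarrow> bool" where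
  "rational_simplicial_cone \<sigma> \<longleftrightarrow>
     (\<exists>B. B \<subseteq> std_lattice \<and> independent B \<and> \<sigma> = convex_cone hull B)"

text \<open>The library relation \<open>face_of\<close> also admits the empty set as a face, which is not a cone.\<close>

definition complete_simplicial_fan :: "(real ^ 'n::finite) set set \<Rightarrow> bool" where
  "complete_simplicial_fan \<Sigma> \<longleftrightarrow>
     finite \<Sigma> \<and>
     (\<forall>\<sigma>\<in>\<Sigma>. rational_simplicial_cone \<sigma>) \<and>
     (\<forall>\<sigma>\<in>\<Sigma>. \<forall>\<tau>. \<tau> face_of \<sigma> \<and> \<tau> \<noteq> {} \<longrightarrow> \<tau> \<in> \<Sigma>) \<and>
     (\<forall>\<sigma>\<in>\<Sigma>. \<forall>\<sigma>'\<in>\<Sigma>. (\<sigma> \<inter> \<sigma>') face_of \<sigma> \<and> (\<sigma> \<inter> \<sigma>') face_of \<sigma>') \<and>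
     \<Union>\<Sigma> = UNIV"

definition cones_of_dim :: "(real ^ 'n::finite) set set \<Rightarrow> nat \<Rightarrow> (real ^ 'n) set set" where
  "cones_of_dim \<Sigma> k = {\<sigma> \<in> \<Sigma>. dim \<sigma> = k}"

abbreviation rays :: "(real ^ 'n::finite) set set \<Rightarrow> (real ^ 'n) set set" where
  "rays \<Sigma> \<equiv> cones_of_dim \<Sigma> 1"

abbreviation max_cones :: "(real ^ 'n::finite) set set \<Rightarrow> (real ^ 'n) set set" where
  "max_cones \<Sigma> \<equiv> cones_of_dim \<Sigma> CARD('n)"

definition weighted_fan ::
    "(real ^ 'n::finite) set set \<Rightarrow> ((real ^ 'n) set \<Rightarrow> nat) \<Rightarrow> bool" where
  "weighted_fan \<Sigma> w \<longleftrightarrow> complete_simplicial_fan \<Sigma> \<and> (\<forall>\<rho>\<in>rays \<Sigma>. 0 < w \<rho>)"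

text \<open>The generator of the monoid of lattice points on a ray.\<close>

definition ray_gen :: "(real ^ 'n::finite) set \<Rightarrow> real ^ 'n" where
  "ray_gen \<rho> = (THE v. \<rho> \<inter> std_lattice = range (\<lambda>k::nat. real k *\<^sub>R v))"

definition max_cone_lattice ::
    "(real ^ 'n::finite) set set \<Rightarrow> ((real ^ 'n) set \<Rightarrow> nat) \<Rightarrow> (real ^ 'n) set \<Rightarrow> (real ^ 'n) set" where
  "max_cone_lattice \<Sigma> w \<sigma> =
     range (\<lambda>c :: (real ^ 'n) set \<Rightarrow> int.
       \<Sum>\<rho> | \<rho> \<in> rays \<Sigma> \<and> \<rho> \<subseteq> \<sigma>. of_int (c \<rho>) *\<^sub>R (real (w \<rho>) *\<^sub>R ray_gen \<rho>))"

definition cone_lattice ::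
    "(real ^ 'n::finite) set set \<Rightarrow> ((real ^ 'n) set \<Rightarrow> nat) \<Rightarrow> (real ^ 'n) set \<Rightarrow> (real ^ 'n) set" where
  "cone_lattice \<Sigma> w \<tau> = (\<Inter>\<sigma> \<in> {\<sigma> \<in> max_cones \<Sigma>. \<tau> \<subseteq> \<sigma>}. max_cone_lattice \<Sigma> w \<sigma>)"

definition newton_polytope ::
    "(real ^ 'n::finite) set set \<Rightarrow> ((real ^ 'n) set \<Rightarrow> real ^ 'n) \<Rightarrow> (real ^ 'n) set" where
  "newton_polytope \<Sigma> m = (\<Inter>\<sigma>\<in>max_cones \<Sigma>. (\<lambda>x. m \<sigma> + x) ` dual_cone \<sigma>)"


section \<open>Affine toric varieties\<close>

text \<open>
  Below, \<open>N\<close> is a lattice in \<open>real ^ 'n\<close> and \<open>\<tau>\<close> a cone. The points of the affine toric variety of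
  \<open>\<tau>\<close> with respect to \<open>N\<close> are the monoid homomorphisms from \<open>toric_monoid N \<tau>\<close> to the multiplicative
  monoid of the complex numbers; the monomial function with exponent \<open>m\<close> is \<open>\<lambda>x. x m\<close>. The topology is
  that of pointwise convergence.
\<close>

type_synonym 'n point = "real ^ 'n \<Rightarrow> complex"

definition toric_monoid :: "(real ^ 'n::finite) set \<Rightarrow> (real ^ 'n) set \<Rightarrow> (real ^ 'n) set" where
  "toric_monoid N \<tau> = dual_lattice N \<inter> dual_cone \<tau>"

definition affine_toric :: "(real ^ 'n::finite) set \<Rightarrow> (real ^ 'n) set \<Rightarrow> 'n point set" where
  "affine_toric N \<tau> =
     {x \<in> extensional (toric_monoid N \<tau>).
        x 0 = 1 \<and> (\<forall>a\<in>toric_monoid N \<tau>. \<forall>b\<in>toric_monoid N \<tau>. x (a + b) = x a * x b)}"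

text \<open>
  If \<open>N' \<subseteq> N\<close> and \<open>\<tau>' \<subseteq> \<tau>\<close>, the natural toric map from the variety of \<open>(N', \<tau>')\<close> to that of \<open>(N, \<tau>)\<close>
  restricts homomorphisms to the smaller monoid \<open>toric_monoid N \<tau>\<close>.
\<close>

definition toric_map :: "(real ^ 'n::finite) set \<Rightarrow> (real ^ 'n) set \<Rightarrow> 'n point \<Rightarrow> 'n point" where
  "toric_map N \<tau> x = restrict x (toric_monoid N \<tau>)"

text \<open>
  The action of the torus \<open>real ^ 'n\<close> modulo \<open>N\<close>, as an action of \<open>real ^ 'n\<close> on which \<open>N\<close> acts trivially.
  The sign is the one for which, under the usual action \<open>f \<mapsto> f \<circ> \<xi>\<inverse>\<close> on functions, the monomial with
  exponent \<open>m\<close> has weight \<open>m\<close> (and not \<open>-m\<close>).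
\<close>

definition torus_act ::
    "(real ^ 'n::finite) set \<Rightarrow> (real ^ 'n) set \<Rightarrow> real ^ 'n \<Rightarrow> 'n point \<Rightarrow> 'n point" where
  "torus_act N \<tau> \<xi> x = restrict (\<lambda>m. char_val m (- \<xi>) * x m) (toric_monoid N \<tau>)"

text \<open>Holomorphic functions of several complex variables: complex differentiability.\<close>

definition holomorphic_fun :: "(complex ^ 'n::finite \<Rightarrow> complex) \<Rightarrow> (complex ^ 'n) set \<Rightarrow> bool" where
  "holomorphic_fun F W \<longleftrightarrow>
     (\<forall>z\<in>W. \<exists>D. (F has_derivative D) (at z) \<and> (\<forall>c v. D (c *s v) = c * D v))"

text \<open>
  Holomorphic functions on an open subset of an affine toric variety: locally, a holomorphic function of
  finitely many monomials. All varieties below are smooth of dimension \<open>CARD('n)\<close>, and monomials in a basis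
  of \<open>dual_lattice N\<close> adapted to \<open>\<tau>\<close> form a chart, so that \<open>CARD('n)\<close> monomials suffice.
\<close>

definition toric_holomorphic ::
    "(real ^ 'n::finite) set \<Rightarrow> (real ^ 'n) set \<Rightarrow> 'n point set \<Rightarrow> ('n point \<Rightarrow> complex) \<Rightarrow> bool" where
  "toric_holomorphic N \<tau> V f \<longleftrightarrow>
     (\<forall>x\<in>V. \<exists>V' (b :: 'n \<Rightarrow> real ^ 'n) W F.
        openin (top_of_set (affine_toric N \<tau>)) V' \<and> x \<in> V' \<and> V' \<subseteq> V \<and>
        (\<forall>i. b i \<in> toric_monoid N \<tau>) \<and>
        open W \<and> holomorphic_fun F W \<and>
        (\<forall>y\<in>V'. (\<chi> i. y (b i)) \<in> W \<and> f y = F (\<chi> i. y (b i))))"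


section \<open>Equivariant holomorphic line bundles\<close>

text \<open>
  The fibres of a line bundle are one-dimensional subspaces of an ambient complex vector space \<open>'v\<close> with
  scalar multiplication \<open>sc\<close>. The ambient space is only a container (for example, the direct sum of all
  fibres) and carries no topology: the holomorphic structure is given by a set of pairs \<open>(V, e)\<close>, where
  \<open>e\<close> is a nowhere vanishing section over the open set \<open>V\<close>, with holomorphic transition functions. The
  component \<open>act\<close> is the action of the torus \<open>real ^ 'n\<close> modulo \<open>N\<close>: \<open>act E \<xi> x\<close> maps the fibre at
  \<open>x\<close> to the fibre at \<open>\<xi> \<cdot> x\<close>.
\<close>

record ('n, 'v) torus_bundle =
  fibre :: "'n point \<Rightarrow> 'v set"
  frames :: "('n point set \<times> ('n point \<Rightarrow> 'v)) set"
  act :: "real ^ 'n \<Rightarrow> 'n point \<Rightarrow> 'v \<Rightarrow> 'v"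

definition linear_iso_on ::
    "(complex \<Rightarrow> 'v \<Rightarrow> 'v::ab_group_add) \<Rightarrow> 'v set \<Rightarrow>
     (complex \<Rightarrow> 'u \<Rightarrow> 'u::ab_group_add) \<Rightarrow> 'u set \<Rightarrow> ('v \<Rightarrow> 'u) \<Rightarrow> bool" where
  "linear_iso_on sc A sc' B f \<longleftrightarrow>
     bij_betw f A B \<and>
     (\<forall>v\<in>A. \<forall>v'\<in>A. f (v + v') = f v + f v') \<and> (\<forall>c. \<forall>v\<in>A. f (sc c v) = sc' c (f v))"

definition line_bundle ::
    "(real ^ 'n::finite) set \<Rightarrow> (real ^ 'n) set \<Rightarrow> (complex \<Rightarrow> 'v \<Rightarrow> 'v::ab_group_add) \<Rightarrow>
     ('n, 'v) torus_bundle \<Rightarrow> bool" where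
  "line_bundle N \<tau> sc E \<longleftrightarrow>
     (\<forall>x\<in>affine_toric N \<tau>. module.subspace sc (fibre E x) \<and> vector_space.dim sc (fibre E x) = 1) \<and>
     (\<Union>(V, e)\<in>frames E. V) = affine_toric N \<tau> \<and>
     (\<forall>(V, e)\<in>frames E. openin (top_of_set (affine_toric N \<tau>)) V \<and> (\<forall>x\<in>V. e x \<in> fibre E x \<and> e x \<noteq> 0)) \<and>
     (\<forall>(V, e)\<in>frames E. \<forall>(V', e')\<in>frames E.
        \<exists>g. toric_holomorphic N \<tau> (V \<inter> V') g \<and> (\<forall>x\<in>V \<inter> V'. e x = sc (g x) (e' x)))"

definition equivariant_line_bundle ::
    "(real ^ 'n::finite) set \<Rightarrow> (real ^ 'n) set \<Rightarrow> (complex \<Rightarrow> 'v \<Rightarrow> 'v::ab_group_add) \<Rightarrow>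
     ('n, 'v) torus_bundle \<Rightarrow> bool" where
  "equivariant_line_bundle N \<tau> sc E \<longleftrightarrow>
     line_bundle N \<tau> sc E \<and>
     (\<forall>\<xi>. \<forall>x\<in>affine_toric N \<tau>.
        linear_iso_on sc (fibre E x) sc (fibre E (torus_act N \<tau> \<xi> x)) (act E \<xi> x)) \<and>
     (\<forall>\<xi> \<eta>. \<forall>x\<in>affine_toric N \<tau>. \<forall>v\<in>fibre E x.
        act E (\<xi> + \<eta>) x v = act E \<xi> (torus_act N \<tau> \<eta> x) (act E \<eta> x v)) \<and>
     (\<forall>\<xi>\<in>N. \<forall>x\<in>affine_toric N \<tau>. \<forall>v\<in>fibre E x. act E \<xi> x v = v) \<and>
     (\<forall>(V, e)\<in>frames E. \<forall>(V', e')\<in>frames E.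
        \<exists>g. continuous_on {(\<xi>, x). x \<in> V \<and> torus_act N \<tau> \<xi> x \<in> V'} (\<lambda>(\<xi>, x). g \<xi> x) \<and>
            (\<forall>\<xi>. toric_holomorphic N \<tau> {x \<in> V. torus_act N \<tau> \<xi> x \<in> V'} (g \<xi>)) \<and>
            (\<forall>\<xi>. \<forall>x\<in>V. torus_act N \<tau> \<xi> x \<in> V' \<longrightarrow>
               act E \<xi> x (e x) = sc (g \<xi> x) (e' (torus_act N \<tau> \<xi> x))))"

definition equivariant_iso ::
    "(real ^ 'n::finite) set \<Rightarrow> (real ^ 'n) set \<Rightarrow>
     (complex \<Rightarrow> 'v \<Rightarrow> 'v::ab_group_add) \<Rightarrow> ('n, 'v) torus_bundle \<Rightarrow>
     (complex \<Rightarrow> 'u \<Rightarrow> 'u::ab_group_add) \<Rightarrow> ('n, 'u) torus_bundle \<Rightarrow>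
     ('n point \<Rightarrow> 'v \<Rightarrow> 'u) \<Rightarrow> bool" where
  "equivariant_iso N \<tau> sc E sc' E' \<phi> \<longleftrightarrow>
     (\<forall>x\<in>affine_toric N \<tau>. linear_iso_on sc (fibre E x) sc' (fibre E' x) (\<phi> x)) \<and>
     (\<forall>(V, e)\<in>frames E. \<forall>(V', e')\<in>frames E'.
        \<exists>g. toric_holomorphic N \<tau> (V \<inter> V') g \<and> (\<forall>x\<in>V \<inter> V'. \<phi> x (e x) = sc' (g x) (e' x))) \<and>
     (\<forall>\<xi>. \<forall>x\<in>affine_toric N \<tau>. \<forall>v\<in>fibre E x.
        \<phi> (torus_act N \<tau> \<xi> x) (act E \<xi> x v) = act E' \<xi> x (\<phi> x v))"

text \<open>Pullback, along the natural toric map from the variety of \<open>(N', \<tau>')\<close> to that of \<open>(N, \<tau>)\<close>, of a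
  bundle on the latter.\<close>

definition pullback_bundle ::
    "(real ^ 'n::finite) set \<Rightarrow> (real ^ 'n) set \<Rightarrow> (real ^ 'n) set \<Rightarrow> (real ^ 'n) set \<Rightarrow>
     ('n, 'v) torus_bundle \<Rightarrow> ('n, 'v) torus_bundle" where
  "pullback_bundle N' \<tau>' N \<tau> E =
     \<lparr>fibre = (\<lambda>x. fibre E (toric_map N \<tau> x)),
      frames = (\<lambda>(V, e). ({x \<in> affine_toric N' \<tau>'. toric_map N \<tau> x \<in> V}, \<lambda>x. e (toric_map N \<tau> x))) ` frames E,
      act = (\<lambda>\<xi> x. act E \<xi> (toric_map N \<tau> x))\<rparr>"

text \<open>The trivial line bundle on which the torus acts through the character \<open>m\<close>.\<close>

definition character_bundle ::
    "(real ^ 'n::finite) set \<Rightarrow> (real ^ 'n) set \<Rightarrow> real ^ 'n \<Rightarrow> ('n, complex) torus_bundle" where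
  "character_bundle N \<tau> m =
     \<lparr>fibre = (\<lambda>x. UNIV), frames = {(affine_toric N \<tau>, \<lambda>x. 1)}, act = (\<lambda>\<xi> x z. char_val m \<xi> * z)\<rparr>"


section \<open>Linearized orbi-line bundles and their sections\<close>

text \<open>
  \<open>L \<tau>\<close> is the bundle over the chart of \<open>\<tau>\<close>, and \<open>\<phi> \<tau>' \<tau>\<close> the isomorphism from the pullback of
  \<open>L \<tau>\<close> to \<open>L \<tau>'\<close>. For the transition functions induced on overlaps of charts, the cocycle condition
  amounts to functoriality of \<open>\<phi>\<close>. For cones of a fan, \<open>\<tau>' \<subseteq> \<tau>\<close> means that \<open>\<tau>'\<close> is a face of \<open>\<tau>\<close>.
\<close>

definition orbi_line_bundle ::
    "(real ^ 'n::finite) set set \<Rightarrow> ((real ^ 'n) set \<Rightarrow> nat) \<Rightarrow> (complex \<Rightarrow> 'v \<Rightarrow> 'v::ab_group_add) \<Rightarrow>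
     ((real ^ 'n) set \<Rightarrow> ('n, 'v) torus_bundle) \<Rightarrow>
     ((real ^ 'n) set \<Rightarrow> (real ^ 'n) set \<Rightarrow> 'n point \<Rightarrow> 'v \<Rightarrow> 'v) \<Rightarrow> bool" where
  "orbi_line_bundle \<Sigma> w sc L \<phi> \<longleftrightarrow>
     (\<forall>\<tau>\<in>\<Sigma>. equivariant_line_bundle (cone_lattice \<Sigma> w \<tau>) \<tau> sc (L \<tau>)) \<and>
     (\<forall>\<tau>\<in>\<Sigma>. \<forall>\<tau>'\<in>\<Sigma>. \<tau>' \<subseteq> \<tau> \<longrightarrow>
        equivariant_iso (cone_lattice \<Sigma> w \<tau>') \<tau>'
          sc (pullback_bundle (cone_lattice \<Sigma> w \<tau>') \<tau>' (cone_lattice \<Sigma> w \<tau>) \<tau> (L \<tau>)) sc (L \<tau>') (\<phi> \<tau>' \<tau>)) \<and>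
     (\<forall>\<tau>\<in>\<Sigma>. \<forall>\<tau>'\<in>\<Sigma>. \<forall>\<tau>''\<in>\<Sigma>. \<tau>'' \<subseteq> \<tau>' \<and> \<tau>' \<subseteq> \<tau> \<longrightarrow>
        (\<forall>x\<in>affine_toric (cone_lattice \<Sigma> w \<tau>'') \<tau>''.
         \<forall>v\<in>fibre (L \<tau>) (toric_map (cone_lattice \<Sigma> w \<tau>) \<tau> x).
           \<phi> \<tau>'' \<tau>' x (\<phi> \<tau>' \<tau> (toric_map (cone_lattice \<Sigma> w \<tau>') \<tau>' x) v) = \<phi> \<tau>'' \<tau> x v))"

definition corresponds_to_characters ::
    "(real ^ 'n::finite) set set \<Rightarrow> ((real ^ 'n) set \<Rightarrow> nat) \<Rightarrow> (complex \<Rightarrow> 'v \<Rightarrow> 'v::ab_group_add) \<Rightarrow>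
     ((real ^ 'n) set \<Rightarrow> ('n, 'v) torus_bundle) \<Rightarrow> ((real ^ 'n) set \<Rightarrow> real ^ 'n) \<Rightarrow> bool" where
  "corresponds_to_characters \<Sigma> w sc L m \<longleftrightarrow>
     (\<forall>\<sigma>\<in>max_cones \<Sigma>. \<exists>\<theta>.
        equivariant_iso (cone_lattice \<Sigma> w \<sigma>) \<sigma>
          sc (L \<sigma>) (*) (character_bundle (cone_lattice \<Sigma> w \<sigma>) \<sigma> (m \<sigma>)) \<theta>)"

text \<open>
  Holomorphic sections over the chart that are invariant under the finite group \<open>std_lattice\<close> modulo \<open>N\<close>,
  the kernel of the covering of tori. Sections are extended by zero outside the chart.
\<close>

definition local_sections ::
    "(real ^ 'n::finite) set \<Rightarrow> (real ^ 'n) set \<Rightarrow> (complex \<Rightarrow> 'v \<Rightarrow> 'v::ab_group_add) \<Rightarrow>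
     ('n, 'v) torus_bundle \<Rightarrow> ('n point \<Rightarrow> 'v) set" where
  "local_sections N \<tau> sc E =
     {s. (\<forall>x\<in>affine_toric N \<tau>. s x \<in> fibre E x) \<and> (\<forall>x. x \<notin> affine_toric N \<tau> \<longrightarrow> s x = 0) \<and>
         (\<forall>(V, e)\<in>frames E. \<exists>g. toric_holomorphic N \<tau> V g \<and> (\<forall>x\<in>V. s x = sc (g x) (e x))) \<and>
         (\<forall>\<gamma>\<in>std_lattice. \<forall>x\<in>affine_toric N \<tau>. act E \<gamma> x (s x) = s (torus_act N \<tau> \<gamma> x))}"

definition global_sections ::
    "(real ^ 'n::finite) set set \<Rightarrow> ((real ^ 'n) set \<Rightarrow> nat) \<Rightarrow> (complex \<Rightarrow> 'v \<Rightarrow> 'v::ab_group_add) \<Rightarrow>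
     ((real ^ 'n) set \<Rightarrow> ('n, 'v) torus_bundle) \<Rightarrow>
     ((real ^ 'n) set \<Rightarrow> (real ^ 'n) set \<Rightarrow> 'n point \<Rightarrow> 'v \<Rightarrow> 'v) \<Rightarrow>
     ((real ^ 'n) set \<Rightarrow> 'n point \<Rightarrow> 'v) set" where
  "global_sections \<Sigma> w sc L \<phi> =
     {s. (\<forall>\<sigma>\<in>max_cones \<Sigma>. s \<sigma> \<in> local_sections (cone_lattice \<Sigma> w \<sigma>) \<sigma> sc (L \<sigma>)) \<and>
         (\<forall>\<sigma>. \<sigma> \<notin> max_cones \<Sigma> \<longrightarrow> s \<sigma> = 0) \<and>
         (\<forall>\<sigma>\<in>max_cones \<Sigma>. \<forall>\<sigma>'\<in>max_cones \<Sigma>.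
            \<forall>x\<in>affine_toric (cone_lattice \<Sigma> w (\<sigma> \<inter> \<sigma>')) (\<sigma> \<inter> \<sigma>').
              \<phi> (\<sigma> \<inter> \<sigma>') \<sigma> x (s \<sigma> (toric_map (cone_lattice \<Sigma> w \<sigma>) \<sigma> x)) =
              \<phi> (\<sigma> \<inter> \<sigma>') \<sigma>' x (s \<sigma>' (toric_map (cone_lattice \<Sigma> w \<sigma>') \<sigma>' x)))}"

text \<open>The sections form a vector space with pointwise operations; this is its scalar multiplication.\<close>

definition section_scale ::
    "(complex \<Rightarrow> 'v \<Rightarrow> 'v) \<Rightarrow> complex \<Rightarrow> ((real ^ 'n::finite) set \<Rightarrow> 'n point \<Rightarrow> 'v) \<Rightarrow>
     ((real ^ 'n) set \<Rightarrow> 'n point \<Rightarrow> 'v)" where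
  "section_scale sc c s = (\<lambda>\<sigma> x. sc c (s \<sigma> x))"

text \<open>
  The action of the torus on global sections: a vector \<open>\<xi>\<close> represents both an element of the torus and a lift
  of it to the covering tori. By the invariance of sections the action only depends on \<open>\<xi>\<close> modulo
  \<open>std_lattice\<close>.
\<close>

definition section_act ::
    "(real ^ 'n::finite) set set \<Rightarrow> ((real ^ 'n) set \<Rightarrow> nat) \<Rightarrow> ((real ^ 'n) set \<Rightarrow> ('n, 'v::ab_group_add) torus_bundle) \<Rightarrow>
     real ^ 'n \<Rightarrow> ((real ^ 'n) set \<Rightarrow> 'n point \<Rightarrow> 'v) \<Rightarrow> ((real ^ 'n) set \<Rightarrow> 'n point \<Rightarrow> 'v)" where
  "section_act \<Sigma> w L \<xi> s =
     (\<lambda>\<sigma> x. if \<sigma> \<in> max_cones \<Sigma> \<and> x \<in> affine_toric (cone_lattice \<Sigma> w \<sigma>) \<sigma>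
            then let y = torus_act (cone_lattice \<Sigma> w \<sigma>) \<sigma> (- \<xi>) x in act (L \<sigma>) \<xi> y (s \<sigma> y)
            else 0)"

definition weight_space ::
    "(real ^ 'n::finite) set set \<Rightarrow> ((real ^ 'n) set \<Rightarrow> nat) \<Rightarrow> (complex \<Rightarrow> 'v \<Rightarrow> 'v::ab_group_add) \<Rightarrow>
     ((real ^ 'n) set \<Rightarrow> ('n, 'v) torus_bundle) \<Rightarrow>
     ((real ^ 'n) set \<Rightarrow> (real ^ 'n) set \<Rightarrow> 'n point \<Rightarrow> 'v \<Rightarrow> 'v) \<Rightarrow> real ^ 'n \<Rightarrow>
     ((real ^ 'n) set \<Rightarrow> 'n point \<Rightarrow> 'v) set" where
  "weight_space \<Sigma> w sc L \<phi> a =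
     {s \<in> global_sections \<Sigma> w sc L \<phi>. \<forall>\<xi>. section_act \<Sigma> w L \<xi> s = section_scale sc (char_val a \<xi>) s}"

end

(* The chart of a maximal cone is an affine space with coordinates the monomials dual to the vectors
   w_rho nu_rho, and the trivializing sections of weights m_sigma compare on a common chart by a
   nowhere vanishing holomorphic function that is equivariant under the real torus. By the identity
   theorem it is equivariant under the complex torus as well; since a one-parameter group contracts the
   chart to its closed orbit, it is a constant multiple of the monomial of exponent m_sigma - m_sigma'.
   The constants form a coboundary, as one sees on the chart of the cone {0}. So a global section is a
   single function on the complex torus which in the chart of sigma is the monomial m_sigma times an
   entire function. On the cone sigma of the imaginary directions the latter lives on the closed polydisc
   and is bounded; as the fan is complete, every entire function in question has polynomial growth, hence
   is a polynomial. Comparing coefficients between the charts, and using invariance under the lattice,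
   leaves exactly the characters in the Newton polytope. *)

theory Submission
  imports Defs "HOL-Complex_Analysis.Conformal_Mappings"
begin

section \<open>Dual bases and maximal cones\<close>

text \<open>Only maximal cones come with coordinates. The lattice of a smaller cone \<tau> is an
  intersection of several lattices, and no basis of it adapted to \<tau> is constructed. What is
  needed on the chart of \<tau> is just that invariant functions are constant. Hence holomorphy
  there is used only along complex one-parameter orbits, the torus element relating two limit points
  is found from the divisibility of the nonzero complex numbers, and the lattice enters through its
  full rank, which a determinant supplies.

  On a maximal chart the same weak notion gives holomorphy in each coordinate separately. A degree
  bound that does not depend on the other coordinates then allows interpolation in one coordinate
  after another, so no power series in several variables occur.

  The weights \<open>m \<sigma>\<close> are integral only on the lattice of \<sigma>. Functions on
  the complex torus are therefore written on its Lie algebra, with logarithm \<xi> + \<i>\<eta>.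
  Coefficients are compared at \<eta> = 0, where they are detected by the linear independence of
  characters of a real vector group.\<close>

definition dual_families :: "('n::finite \<Rightarrow> real ^ 'n) \<Rightarrow> ('n \<Rightarrow> real ^ 'n) \<Rightarrow> bool" where
  "dual_families u d \<longleftrightarrow> (\<forall>i j. u i \<bullet> d j = (if i = j then 1 else 0))"

lemma dual_families_sym: "dual_families u d \<Longrightarrow> dual_families d u"
  by (auto simp: dual_families_def inner_commute)

text \<open>Both families have as many members as the dimension. Duality says that one square matrix
  is a right inverse of another, hence also a left inverse, and the left inverse identity read
  entrywise is the expansion.\<close>

lemma dual_families_expand:
  assumes "dual_families u d"
  shows "v = (\<Sum>i\<in>UNIV. (d i \<bullet> v) *\<^sub>R u i)"
proof -
  define U D where "U = (\<chi> i. u i)" and "D = (\<chi> i. d i)"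
  have "U ** transpose D = mat 1"
    using assms by (simp add: dual_families_def U_def D_def matrix_matrix_mult_def transpose_def
        mat_def inner_vec_def vec_eq_iff)
  then have "transpose D ** U = mat 1"
    by (simp add: matrix_left_right_inverse)
  then have *: "(\<Sum>i\<in>UNIV. d i $ k * u i $ l) = (if k = l then 1 else 0)" for k l
    by (simp add: matrix_matrix_mult_def transpose_def mat_def U_def D_def vec_eq_iff)
  have "(\<Sum>i\<in>UNIV. (d i \<bullet> v) *\<^sub>R u i) $ l = v $ l" for l
  proof -
    have "(\<Sum>i\<in>UNIV. (d i \<bullet> v) *\<^sub>R u i) $ l = (\<Sum>i\<in>UNIV. \<Sum>k\<in>UNIV. v $ k * (d i $ k * u i $ l))"
      by (simp add: inner_vec_def sum_distrib_right sum_distrib_left mult_ac)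
    also have "\<dots> = (\<Sum>k\<in>UNIV. v $ k * (\<Sum>i\<in>UNIV. d i $ k * u i $ l))"
      by (subst sum.swap) (simp add: sum_distrib_left)
    also have "\<dots> = v $ l"
      by (simp add: * if_distrib cong: if_cong)
    finally show ?thesis .
  qed
  then show ?thesis by (simp add: vec_eq_iff)
qed

lemma dual_families_inner:
  assumes "dual_families u d"
  shows "a \<bullet> v = (\<Sum>i\<in>UNIV. (a \<bullet> u i) * (d i \<bullet> v))"
  by (subst dual_families_expand[OF assms, of v]) (simp add: inner_sum_right mult.commute)

lemma dual_families_inner_sum:
  assumes "dual_families u d"
  shows "d j \<bullet> (\<Sum>i\<in>UNIV. c i *\<^sub>R u i) = c j"
proof -
  have "d j \<bullet> u i = (if i = j then 1 else 0)" for i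
    using assms by (simp add: dual_families_def inner_commute)
  then have "d j \<bullet> (\<Sum>i\<in>UNIV. c i *\<^sub>R u i) = (\<Sum>i\<in>UNIV. if i = j then c i else 0)"
    unfolding inner_sum_right by (intro sum.cong) auto
  then show ?thesis by simp
qed

text \<open>The linear map sending \<open>u i\<close> to the i-th axis vector has an adjoint, and
  the adjoint sends the axis vectors to the dual family.\<close>

lemma ex_dual_family:
  assumes "independent (range u)" "inj u"
  shows "\<exists>d. dual_families u d"
proof -
  obtain f :: "real ^ 'a \<Rightarrow> real ^ 'a" where f: "linear f" "\<And>x. x \<in> range u \<Longrightarrow> f x = axis (inv u x) 1"
    using linear_independent_extend[OF assms(1), of "\<lambda>x. axis (inv u x) 1"] by auto
  have "u i \<bullet> adjoint f (axis j 1) = (if i = j then 1 else 0)" for i j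
    using f assms(2) by (simp add: adjoint_works inner_axis_axis)
  then show ?thesis unfolding dual_families_def by (intro exI[of _ "\<lambda>j. adjoint f (axis j 1)"]) simp
qed

lemma std_lattice_diff: "a \<in> std_lattice \<Longrightarrow> b \<in> std_lattice \<Longrightarrow> a - b \<in> std_lattice"
  and std_lattice_scale: "a \<in> std_lattice \<Longrightarrow> t \<in> \<int> \<Longrightarrow> t *\<^sub>R a \<in> std_lattice"
  by (auto simp: std_lattice_def)

lemma std_lattice_sum: "(\<And>i. i \<in> I \<Longrightarrow> f i \<in> std_lattice) \<Longrightarrow> sum f I \<in> std_lattice"
  by (auto simp: std_lattice_def)

section \<open>Rays, their lattice generators, and the faces of a simplicial cone\<close>

definition half_line :: "'a::real_vector \<Rightarrow> 'a set" where
  "half_line b = {t *\<^sub>R b |t. 0 \<le> t}"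

text \<open>Since \<open>ray_gen\<close> is a definite description, a generator must exist and be
  unique. A nonzero coordinate \<open>b $ j\<close> turns the lattice points of the ray into natural
  numbers \<open>t * \<bar>b $ j\<bar>\<close>, so there is a shortest one; division with remainder
  shows that it generates. Two generators are natural multiples of each other, with factors whose
  product is 1.\<close>

lemma ray_gen_half_line:
  fixes b :: "real ^ 'n::finite"
  assumes b: "b \<in> std_lattice" "b \<noteq> 0"
  shows "\<exists>c>0. ray_gen (half_line b) = c *\<^sub>R b \<and> c *\<^sub>R b \<in> std_lattice"
proof -
  define T where "T = {t. 0 < t \<and> t *\<^sub>R b \<in> std_lattice}"
  obtain j where j: "b $ j \<noteq> 0" using b(2) by (auto simp: vec_eq_iff)
  define \<mu> where "\<mu> = (\<lambda>t. nat \<lfloor>t * \<bar>b $ j\<bar>\<rfloor>)"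
  have \<mu>: "real (\<mu> t) = t * \<bar>b $ j\<bar>" if "t \<in> T" for t
  proof -
    have "t * b $ j \<in> \<int>" using that by (auto simp: T_def std_lattice_def)
    then have "t * \<bar>b $ j\<bar> \<in> \<int>" by (cases "b $ j \<ge> 0") auto
    moreover have "0 \<le> t * \<bar>b $ j\<bar>" using that by (auto simp: T_def)
    ultimately show ?thesis by (auto simp: \<mu>_def elim!: Ints_cases)
  qed
  have "1 \<in> T" using b by (simp add: T_def)
  then obtain c where c: "c \<in> T" "\<And>t. t \<in> T \<Longrightarrow> \<mu> c \<le> \<mu> t"
    using ex_has_least_nat[of "\<lambda>t. t \<in> T" 1 \<mu>] by blast
  have cpos: "c > 0" using c by (simp add: T_def)
  have mult: "\<exists>k::nat. t = real k * c" if "0 \<le> t" "t *\<^sub>R b \<in> std_lattice" for t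
  proof -
    define k where "k = \<lfloor>t / c\<rfloor>"
    define r where "r = t - of_int k * c"
    have r: "0 \<le> r" "r < c"
      using floor_divide_lower[OF cpos, of t] floor_divide_upper[OF cpos, of t]
      by (simp_all add: r_def k_def algebra_simps)
    have "r *\<^sub>R b = t *\<^sub>R b - of_int k *\<^sub>R (c *\<^sub>R b)"
      by (simp add: r_def algebra_simps)
    then have rb: "r *\<^sub>R b \<in> std_lattice"
      using that(2) c(1) by (metis (mono_tags) Ints_of_int T_def mem_Collect_eq std_lattice_diff std_lattice_scale)
    have "\<not> 0 < r"
    proof
      assume "0 < r"
      then have "r \<in> T" using rb by (simp add: T_def)
      then have "real (\<mu> c) \<le> real (\<mu> r)" using c(2) by simp
      then show False using r(2) j \<mu> c(1) \<open>r \<in> T\<close> by simp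
    qed
    then have "t = of_int k * c" using r by (simp add: r_def)
    moreover have "k \<ge> 0" using that(1) cpos by (simp add: k_def)
    ultimately show ?thesis by (intro exI[of _ "nat k"]) simp
  qed
  have eq: "half_line b \<inter> std_lattice = range (\<lambda>k::nat. real k *\<^sub>R (c *\<^sub>R b))"
  proof (intro set_eqI iffI)
    fix v assume "v \<in> half_line b \<inter> std_lattice"
    then obtain t where "0 \<le> t" "t *\<^sub>R b \<in> std_lattice" "v = t *\<^sub>R b" by (auto simp: half_line_def)
    with mult show "v \<in> range (\<lambda>k::nat. real k *\<^sub>R (c *\<^sub>R b))" by fastforce
  next
    fix v assume "v \<in> range (\<lambda>k::nat. real k *\<^sub>R (c *\<^sub>R b))"
    then obtain k :: nat where "v = real k *\<^sub>R (c *\<^sub>R b)" by auto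
    moreover have "v \<in> std_lattice"
      unfolding \<open>v = _\<close> using c(1) by (auto simp: T_def simp del: scaleR_scaleR intro: std_lattice_scale[OF _ Ints_of_nat])
    moreover have "v = (real k * c) *\<^sub>R b" "real k * c \<ge> 0" using \<open>v = _\<close> cpos by simp_all
    then have "v \<in> half_line b" unfolding half_line_def by blast
    ultimately show "v \<in> half_line b \<inter> std_lattice" by blast
  qed
  have "v = c *\<^sub>R b" if v: "half_line b \<inter> std_lattice = range (\<lambda>k::nat. real k *\<^sub>R v)" for v
  proof -
    have R: "range (\<lambda>k::nat. real k *\<^sub>R v) = range (\<lambda>k::nat. real k *\<^sub>R (c *\<^sub>R b))"
      using v eq by simp
    have "v \<in> range (\<lambda>k::nat. real k *\<^sub>R v)" "c *\<^sub>R b \<in> range (\<lambda>k::nat. real k *\<^sub>R (c *\<^sub>R b))"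
      by (auto intro!: image_eqI[of _ _ "Suc 0"])
    then have "v \<in> range (\<lambda>k::nat. real k *\<^sub>R (c *\<^sub>R b))" "c *\<^sub>R b \<in> range (\<lambda>k::nat. real k *\<^sub>R v)"
      using R by auto
    then obtain k l :: nat where kl: "v = real k *\<^sub>R (c *\<^sub>R b)" "c *\<^sub>R b = real l *\<^sub>R v" by blast
    then have "c *\<^sub>R b = real (l * k) *\<^sub>R (c *\<^sub>R b)" by (metis of_nat_mult scaleR_scaleR)
    then have "(real (l * k) - 1) *\<^sub>R (c *\<^sub>R b) = 0" by (metis diff_self scaleR_left_diff_distrib scaleR_one)
    then have "l * k = 1" using cpos b(2)
      by (metis eq_iff_diff_eq_0 less_numeral_extra(3) of_nat_eq_1_iff scaleR_eq_0_iff)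
    then show ?thesis using kl by simp
  qed
  then have "ray_gen (half_line b) = c *\<^sub>R b"
    unfolding ray_gen_def using eq by (intro the_equality) auto
  then show ?thesis using cpos c(1) by (auto simp: T_def)
qed

lemma convex_cone_hull_finite:
  fixes B :: "'a::real_vector set"
  assumes "finite B"
  shows "convex_cone hull B = {\<Sum>b\<in>B. c b *\<^sub>R b |c. \<forall>b\<in>B. 0 \<le> (c b :: real)}" (is "_ = ?R")
proof (intro subset_antisym hull_minimal subsetI)
  fix b assume "b \<in> B"
  then have "b = (\<Sum>x\<in>B. (if x = b then 1 else 0) *\<^sub>R x)" using assms
    by (simp add: if_distrib[where f = "\<lambda>c. c *\<^sub>R _"] cong: if_cong)
  then show "b \<in> ?R"
    by (intro CollectI exI[of _ "\<lambda>x. if x = b then 1 else 0"]) auto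
next
  show "convex_cone ?R"
    unfolding convex_cone_iff
  proof (intro conjI ballI allI impI)
    show "0 \<in> ?R" by (auto intro!: exI[of _ "\<lambda>x. 0"])
    fix x y assume "x \<in> ?R" "y \<in> ?R"
    then obtain c e where "\<forall>b\<in>B. 0 \<le> (c b :: real)" "\<forall>b\<in>B. 0 \<le> (e b :: real)"
      "x = (\<Sum>b\<in>B. c b *\<^sub>R b)" "y = (\<Sum>b\<in>B. e b *\<^sub>R b)" by auto
    then show "x + y \<in> ?R"
      by (auto simp: sum.distrib scaleR_left_distrib intro!: exI[of _ "\<lambda>b. c b + e b"])
  next
    fix x and r :: real assume "x \<in> ?R" "0 \<le> r"
    then obtain c where "\<forall>b\<in>B. 0 \<le> (c b :: real)" "x = (\<Sum>b\<in>B. c b *\<^sub>R b)" by auto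
    with \<open>0 \<le> r\<close> show "r *\<^sub>R x \<in> ?R"
      by (auto simp: scaleR_sum_right intro!: exI[of _ "\<lambda>b. r * c b"])
  qed
next
  fix x assume "x \<in> ?R"
  then obtain c where c: "\<forall>b\<in>B. 0 \<le> (c b :: real)" "x = (\<Sum>b\<in>B. c b *\<^sub>R b)" by auto
  have "(\<Sum>b\<in>C. c b *\<^sub>R b) \<in> convex_cone hull B" if "C \<subseteq> B" for C
    using finite_subset[OF that assms] that
  proof (induction C rule: finite_induct)
    case empty then show ?case by (simp add: convex_cone_hull_contains_0)
  next
    case (insert b C)
    then have "c b *\<^sub>R b \<in> convex_cone hull B"
      using c by (intro convex_cone_hull_mul) (auto intro: hull_inc)
    with insert show ?case by (simp add: convex_cone_hull_add)
  qed
  then show "x \<in> convex_cone hull B" using c by blast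
qed

lemma dim_convex_cone_hull:
  fixes B :: "'a::euclidean_space set"
  assumes "independent B"
  shows "dim (convex_cone hull B) = card B"
proof -
  have "convex_cone hull B \<subseteq> span B"
    by (intro hull_minimal) (auto simp: span_base convex_cone_iff span_add span_scale span_zero)
  then have "dim (convex_cone hull B) = dim B"
    by (metis dim_span dim_subset hull_subset order_antisym)
  then show ?thesis using assms by (simp add: dim_eq_card_independent)
qed

lemma half_line_eq_hull: "half_line b = convex_cone hull {b}"
proof -
  have "t *\<^sub>R b \<in> {\<Sum>x\<in>{b}. c x *\<^sub>R x |c. \<forall>x\<in>{b}. 0 \<le> (c x :: real)}" if "0 \<le> t" for t
    using that by (auto intro!: exI[of _ "\<lambda>_. t"])
  then show ?thesis
    by (subst convex_cone_hull_finite) (auto simp: half_line_def)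
qed

text \<open>The ray is cut out of the cone by the vanishing of the functionals \<open>d j\<close>
  with \<open>j \<noteq> i\<close>. These are nonnegative on the cone, so if they vanish at an
  interior point of a segment they vanish at both ends.\<close>

lemma face_of_simplicial_cone_ray:
  assumes "dual_families u d"
  shows "half_line (u i) face_of {v. \<forall>j. 0 \<le> d j \<bullet> v}"
proof -
  have du: "d j \<bullet> u k = (if j = k then 1 else 0)" for j k
    using dual_families_sym[OF assms] by (simp add: dual_families_def)
  have hl: "half_line (u i) = {v. 0 \<le> d i \<bullet> v \<and> (\<forall>j. j \<noteq> i \<longrightarrow> d j \<bullet> v = 0)}"
  proof (intro set_eqI iffI)
    fix v assume v: "v \<in> {v. 0 \<le> d i \<bullet> v \<and> (\<forall>j. j \<noteq> i \<longrightarrow> d j \<bullet> v = 0)}"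
    have "v = (\<Sum>j\<in>UNIV. (d j \<bullet> v) *\<^sub>R u j)" by (rule dual_families_expand[OF assms])
    also have "\<dots> = (\<Sum>j\<in>UNIV. if j = i then (d i \<bullet> v) *\<^sub>R u i else 0)"
      using v by (intro sum.cong) auto
    also have "\<dots> = (d i \<bullet> v) *\<^sub>R u i" by simp
    finally have "v = (d i \<bullet> v) *\<^sub>R u i" .
    then show "v \<in> half_line (u i)" using v by (auto simp: half_line_def)
  qed (auto simp: half_line_def du)
  show ?thesis
    unfolding face_of_def
  proof (intro conjI ballI impI)
    show "half_line (u i) \<subseteq> {v. \<forall>j. 0 \<le> d j \<bullet> v}"
      unfolding hl by force
    show "convex (half_line (u i))"
      unfolding hl by (auto simp: convex_def inner_add_right)
    fix a b x assume a: "a \<in> {v. \<forall>j. 0 \<le> d j \<bullet> v}" and b: "b \<in> {v. \<forall>j. 0 \<le> d j \<bullet> v}"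
      and x: "x \<in> half_line (u i)" "x \<in> open_segment a b"
    then obtain t where t: "0 < t" "t < 1" "x = (1 - t) *\<^sub>R a + t *\<^sub>R b"
      by (auto simp: in_segment)
    have "d j \<bullet> a = 0 \<and> d j \<bullet> b = 0" if "j \<noteq> i" for j
    proof -
      have "(1 - t) * (d j \<bullet> a) + t * (d j \<bullet> b) = 0"
        using x(1) that t(3) unfolding hl by (simp add: inner_add_right)
      moreover have "0 \<le> (1 - t) * (d j \<bullet> a)" "0 \<le> t * (d j \<bullet> b)" using a b t by auto
      ultimately have "(1 - t) * (d j \<bullet> a) = 0" "t * (d j \<bullet> b) = 0" by linarith+
      then show ?thesis using t by auto
    qed
    then show "a \<in> half_line (u i)" "b \<in> half_line (u i)" using a b unfolding hl by auto
  qed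
qed

text \<open>If \<open>b\<close> spans the face and has a positive coordinate in direction
  \<open>u i\<close>, then \<open>b\<close> is the midpoint of a segment in the cone with one end on
  the ray of \<open>u i\<close>. The face property puts this end on the ray of \<open>b\<close>, so
  the two rays coincide.\<close>

lemma half_line_face_of_simplicial_cone:
  assumes "dual_families u d" "b \<noteq> 0" "half_line b face_of {v. \<forall>j. 0 \<le> d j \<bullet> v}"
  shows "\<exists>i. half_line b = half_line (u i)"
proof -
  have du: "d j \<bullet> u k = (if j = k then 1 else 0)" for j k
    using dual_families_sym[OF assms(1)] by (simp add: dual_families_def)
  have hb: "b \<in> half_line b" by (auto simp: half_line_def intro!: exI[of _ 1])
  then have b: "0 \<le> d j \<bullet> b" for j using assms(3) face_of_imp_subset by fastforce
  obtain i where i: "d i \<bullet> b \<noteq> 0"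
    using assms(2) dual_families_expand[OF assms(1), of b] by force
  define c where "c = d i \<bullet> b"
  have c: "c > 0" using i b[of i] by (simp add: c_def)
  \<comment> \<open>With this length of \<open>p\<close> the other end \<open>q\<close> has i-th
    coordinate zero and twice the remaining coordinates of \<open>b\<close>, so it is still in the
    cone.\<close>
  define p q where "p = (2 * c) *\<^sub>R u i" and "q = 2 *\<^sub>R b - p"
  have "p \<in> {v. \<forall>j. 0 \<le> d j \<bullet> v}" "q \<in> {v. \<forall>j. 0 \<le> d j \<bullet> v}"
    using b c by (auto simp: p_def q_def du inner_diff_right c_def)
  moreover have "b = (1 - 1/2) *\<^sub>R p + (1/2) *\<^sub>R q" by (simp add: q_def algebra_simps)
  ultimately have "p \<in> half_line b"
  proof (cases "p = q")
    case True
    then have "2 *\<^sub>R p = 2 *\<^sub>R b" by (simp add: q_def scaleR_2 eq_diff_eq)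
    then have "p = b" by simp
    then show ?thesis using hb by simp
  next
    case False
    then have "b \<in> open_segment p q"
      using \<open>b = _\<close> by (auto simp: in_segment intro!: exI[of _ "1/2"])
    then show ?thesis using assms(3) hb \<open>p \<in> _\<close> \<open>q \<in> _\<close> unfolding face_of_def by blast
  qed
  then obtain t where t: "0 \<le> t" "p = t *\<^sub>R b" by (auto simp: half_line_def)
  have "p \<noteq> 0" using c du[of i i] by (auto simp: p_def)
  then have tp: "t > 0" using t by (cases "t = 0") auto
  have ub: "u i = (t / (2 * c)) *\<^sub>R b"
  proof -
    have "(1 / (2 * c)) *\<^sub>R ((2 * c) *\<^sub>R u i) = (1 / (2 * c)) *\<^sub>R (t *\<^sub>R b)"
      using t(2) by (simp only: p_def)
    then show ?thesis using c by simp
  qed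
  have "half_line b = half_line (u i)"
  proof (intro set_eqI iffI)
    fix v assume "v \<in> half_line b"
    then obtain s where "0 \<le> s" "v = s *\<^sub>R b" by (auto simp: half_line_def)
    then show "v \<in> half_line (u i)" using ub tp c
      by (auto simp: half_line_def intro!: exI[of _ "s * (2 * c) / t"])
  next
    fix v assume "v \<in> half_line (u i)"
    then obtain s where "0 \<le> s" "v = s *\<^sub>R u i" by (auto simp: half_line_def)
    then show "v \<in> half_line b" using ub tp c
      by (auto simp: half_line_def intro!: exI[of _ "s * (t / (2 * c))"])
  qed
  then show ?thesis by blast
qed

text \<open>The family \<open>u\<close> consists of the weighted ray generators w_\<rho>
  \<nu>_\<rho>. In the coordinates \<open>d\<close> dual to it the cone is the nonnegative orthant
  and its lattice the integer lattice. The work lies in identifying the rays of the fan contained in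
  \<sigma> with the rays of the given generators.\<close>

lemma weighted_fan_max_cone:
  fixes \<Sigma> :: "(real ^ 'n::finite) set set"
  assumes fan: "weighted_fan \<Sigma> w" and \<sigma>: "\<sigma> \<in> max_cones \<Sigma>"
  shows "\<exists>u d. dual_families u d \<and> range u \<subseteq> std_lattice \<and> \<sigma> = {v. \<forall>i. 0 \<le> d i \<bullet> v} \<and>
    max_cone_lattice \<Sigma> w \<sigma> = {v. \<forall>i. d i \<bullet> v \<in> \<int>}"
proof -
  have csf: "complete_simplicial_fan \<Sigma>" and wpos: "\<And>\<rho>. \<rho> \<in> rays \<Sigma> \<Longrightarrow> 0 < w \<rho>"
    using fan by (auto simp: weighted_fan_def)
  have \<sigma>\<Sigma>: "\<sigma> \<in> \<Sigma>" and dim\<sigma>: "dim \<sigma> = CARD('n)" using \<sigma> by (auto simp: cones_of_dim_def)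
  obtain B where B: "B \<subseteq> std_lattice" "independent B" "\<sigma> = convex_cone hull B"
    using csf \<sigma>\<Sigma> by (auto simp: complete_simplicial_fan_def rational_simplicial_cone_def)
  have finB: "finite B" using B(2) by (rule independent_imp_finite)
  have "card B = CARD('n)" using B dim\<sigma> dim_convex_cone_hull by fastforce
  then obtain b where b: "bij_betw b (UNIV :: 'n set) B"
    using finB by (metis bij_betw_iff_card finite_class.finite_UNIV)
  then have inj: "inj b" and ran: "range b = B" by (auto simp: bij_betw_def)
  then obtain e where e: "dual_families b e" using ex_dual_family[of b] B by auto
  have \<sigma>eq: "\<sigma> = {v. \<forall>i. 0 \<le> e i \<bullet> v}"
  proof (intro set_eqI iffI)
    fix v assume "v \<in> \<sigma>"
    then obtain c where c: "\<forall>x\<in>B. 0 \<le> (c x :: real)" "v = (\<Sum>x\<in>B. c x *\<^sub>R x)"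
      unfolding B(3) convex_cone_hull_finite[OF finB] by auto
    have "v = (\<Sum>i\<in>UNIV. c (b i) *\<^sub>R b i)"
      unfolding c(2) by (rule sum.reindex_bij_betw[OF b, symmetric])
    then show "v \<in> {v. \<forall>i. 0 \<le> e i \<bullet> v}"
      using c(1) ran dual_families_inner_sum[OF e] by auto
  next
    fix v assume v: "v \<in> {v. \<forall>i. 0 \<le> e i \<bullet> v}"
    have "v = (\<Sum>i\<in>UNIV. (e (inv b (b i)) \<bullet> v) *\<^sub>R b i)"
      using dual_families_expand[OF e, of v] inj by simp
    also have "\<dots> = (\<Sum>x\<in>B. (e (inv b x) \<bullet> v) *\<^sub>R x)"
      by (rule sum.reindex_bij_betw[OF b])
    finally show "v \<in> \<sigma>" unfolding B(3) convex_cone_hull_finite[OF finB] using v by auto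
  qed
  have bL: "b i \<in> std_lattice" and b0: "b i \<noteq> 0" for i
    using B ran by (auto simp: dependent_zero)
  have hl_rays: "half_line (b i) \<in> rays \<Sigma>" "half_line (b i) \<subseteq> \<sigma>" for i
  proof -
    have f: "half_line (b i) face_of \<sigma>" using face_of_simplicial_cone_ray[OF e] \<sigma>eq by simp
    moreover have "half_line (b i) \<noteq> {}" by (auto simp: half_line_def)
    ultimately have "half_line (b i) \<in> \<Sigma>" using csf \<sigma>\<Sigma> by (auto simp: complete_simplicial_fan_def)
    moreover have "half_line (b i) = convex_cone hull {b i}"
      by (rule half_line_eq_hull)
    then have "dim (half_line (b i)) = 1" using b0 by (simp add: dim_convex_cone_hull)
    ultimately show "half_line (b i) \<in> rays \<Sigma>" by (simp add: cones_of_dim_def)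
    show "half_line (b i) \<subseteq> \<sigma>" using f by (rule face_of_imp_subset)
  qed
  have rays: "{\<rho>. \<rho> \<in> rays \<Sigma> \<and> \<rho> \<subseteq> \<sigma>} = range (\<lambda>i. half_line (b i))"
  proof (intro subset_antisym subsetI)
    fix \<rho> assume \<rho>: "\<rho> \<in> {\<rho>. \<rho> \<in> rays \<Sigma> \<and> \<rho> \<subseteq> \<sigma>}"
    then have \<rho>\<Sigma>: "\<rho> \<in> \<Sigma>" and dim\<rho>: "dim \<rho> = 1" by (auto simp: cones_of_dim_def)
    obtain B' where B': "independent B'" "\<rho> = convex_cone hull B'"
      using csf \<rho>\<Sigma> by (auto simp: complete_simplicial_fan_def rational_simplicial_cone_def)
    then have "card B' = 1" using dim\<rho> dim_convex_cone_hull by fastforce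
    then obtain r where r: "B' = {r}" by (auto simp: card_1_singleton_iff)
    then have "r \<noteq> 0" using B' by auto
    have "\<rho> = half_line r"
      unfolding B'(2) r by (rule half_line_eq_hull[symmetric])
    \<comment> \<open>Containment in \<sigma> becomes the face relation because the cones of a fan
      meet in common faces.\<close>
    moreover have "\<rho> \<inter> \<sigma> = \<rho>" using \<rho> by auto
    then have "\<rho> face_of \<sigma>" using csf \<rho>\<Sigma> \<sigma>\<Sigma> unfolding complete_simplicial_fan_def by metis
    ultimately show "\<rho> \<in> range (\<lambda>i. half_line (b i))"
      using half_line_face_of_simplicial_cone[OF e \<open>r \<noteq> 0\<close>] \<sigma>eq by auto
  qed (use hl_rays in auto)
  have eb: "e i \<bullet> b j = (if i = j then 1 else 0)" for i j
    using dual_families_sym[OF e] by (simp add: dual_families_def)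
  have inj_hl: "inj (\<lambda>i. half_line (b i))"
  proof (rule injI, rule ccontr)
    fix i j assume "half_line (b i) = half_line (b j)" "i \<noteq> j"
    moreover have "b i \<in> half_line (b i)" by (auto simp: half_line_def intro!: exI[of _ 1])
    ultimately obtain t where "b i = t *\<^sub>R b j" by (auto simp: half_line_def)
    then have "e i \<bullet> b i = 0" using eb[of i j] \<open>i \<noteq> j\<close> by simp
    then show False using eb by simp
  qed
  obtain c where c: "\<And>i. c i > 0" "\<And>i. ray_gen (half_line (b i)) = c i *\<^sub>R b i"
      "\<And>i. c i *\<^sub>R b i \<in> std_lattice"
    using ray_gen_half_line[OF bL b0] by metis
  \<comment> \<open>The factor taking the chosen generator \<open>b i\<close> to the weighted
    primitive generator of its ray.\<close>
  define s where "s = (\<lambda>i. real (w (half_line (b i))) * c i)"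
  have s: "s i > 0" for i using c wpos hl_rays by (simp add: s_def)
  define u where "u = (\<lambda>i. s i *\<^sub>R b i)"
  define d where "d = (\<lambda>i. (1 / s i) *\<^sub>R e i)"
  have ud: "dual_families u d"
    using e s unfolding dual_families_def u_def d_def by (auto simp: less_imp_neq[symmetric])
  moreover have "range u \<subseteq> std_lattice"
  proof -
    have "u i = real (w (half_line (b i))) *\<^sub>R (c i *\<^sub>R b i)" for i by (simp add: u_def s_def)
    then have "u i \<in> std_lattice" for i using std_lattice_scale[OF c(3) Ints_of_nat] by metis
    then show ?thesis by auto
  qed
  moreover have "\<sigma> = {v. \<forall>i. 0 \<le> d i \<bullet> v}"
    using s by (simp add: \<sigma>eq d_def zero_le_divide_iff less_imp_le not_le[symmetric])
  moreover have "max_cone_lattice \<Sigma> w \<sigma> = {v. \<forall>i. d i \<bullet> v \<in> \<int>}"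
  proof (intro set_eqI iffI)
    have *: "(\<Sum>\<rho> | \<rho> \<in> rays \<Sigma> \<and> \<rho> \<subseteq> \<sigma>. of_int (k \<rho>) *\<^sub>R (real (w \<rho>) *\<^sub>R ray_gen \<rho>)) =
        (\<Sum>i\<in>UNIV. real_of_int (k (half_line (b i))) *\<^sub>R u i)" for k
      unfolding rays by (subst sum.reindex[OF inj_hl]) (simp add: c(2) u_def s_def mult.assoc)
    fix v
    { assume "v \<in> max_cone_lattice \<Sigma> w \<sigma>"
      then obtain k :: "(real ^ 'n) set \<Rightarrow> int" where
        "v = (\<Sum>i\<in>UNIV. real_of_int (k (half_line (b i))) *\<^sub>R u i)"
        unfolding max_cone_lattice_def * by auto
      then show "v \<in> {v. \<forall>i. d i \<bullet> v \<in> \<int>}" using dual_families_inner_sum[OF ud] by simp }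
    { assume v: "v \<in> {v. \<forall>i. d i \<bullet> v \<in> \<int>}"
      \<comment> \<open>The lattice is indexed by rays, the coordinates by \<open>'n\<close>; the
        floor only converts an integral real number to an integer.\<close>
      define k where "k = (\<lambda>\<rho>. \<lfloor>d (inv (\<lambda>i. half_line (b i)) \<rho>) \<bullet> v\<rfloor>)"
      have "real_of_int (k (half_line (b i))) = d i \<bullet> v" for i
        using v by (auto simp: k_def inv_f_f[OF inj_hl] elim!: Ints_cases dest!: spec[of _ i])
      then have "v = (\<Sum>i\<in>UNIV. real_of_int (k (half_line (b i))) *\<^sub>R u i)"
        using dual_families_expand[OF ud, of v] by simp
      then show "v \<in> max_cone_lattice \<Sigma> w \<sigma>"
        unfolding max_cone_lattice_def * by auto }
  qed
  ultimately show ?thesis by blast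
qed

section \<open>Incidence of cones in a complete fan\<close>

lemma max_cone_imp_cone: "\<sigma> \<in> max_cones \<Sigma> \<Longrightarrow> \<sigma> \<in> \<Sigma>"
  by (simp add: cones_of_dim_def)

lemma fan_cone_convex_cone:
  assumes "weighted_fan \<Sigma> w" "\<tau> \<in> \<Sigma>"
  shows "convex_cone \<tau>"
  using assms unfolding weighted_fan_def complete_simplicial_fan_def rational_simplicial_cone_def
  by (metis convex_cone_convex_cone_hull)

lemma fan_cone_zero: "weighted_fan \<Sigma> w \<Longrightarrow> \<tau> \<in> \<Sigma> \<Longrightarrow> 0 \<in> \<tau>"
  using fan_cone_convex_cone convex_cone_contains_0 by blast

lemma fan_Int:
  assumes "weighted_fan \<Sigma> w" "\<sigma> \<in> \<Sigma>" "\<sigma>' \<in> \<Sigma>"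
  shows "\<sigma> \<inter> \<sigma>' \<in> \<Sigma>"
proof -
  have "0 \<in> \<sigma> \<inter> \<sigma>'" using assms fan_cone_zero by blast
  moreover have "\<sigma> \<inter> \<sigma>' face_of \<sigma>"
    using assms by (auto simp: weighted_fan_def complete_simplicial_fan_def)
  ultimately show ?thesis
    using assms unfolding weighted_fan_def complete_simplicial_fan_def by blast
qed

text \<open>Independent generators make a cone pointed: if a convex combination of two of its points
  is 0, all nonnegative coefficients vanish. Thus the apex is a face. Its chart is the torus itself,
  where all trivializations can be compared at one point.\<close>

lemma fan_zero_cone:
  assumes "weighted_fan \<Sigma> w"
  shows "{0} \<in> \<Sigma>"
proof -
  have "0 \<in> \<Union>\<Sigma>" using assms by (auto simp: weighted_fan_def complete_simplicial_fan_def)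
  then obtain \<sigma> where \<sigma>: "\<sigma> \<in> \<Sigma>" by blast
  then obtain B where B: "independent B" "\<sigma> = convex_cone hull B"
    using assms unfolding weighted_fan_def complete_simplicial_fan_def rational_simplicial_cone_def by metis
  have fB: "finite B" using B(1) by (rule independent_imp_finite)
  have "{0} face_of \<sigma>"
    unfolding face_of_singleton extreme_point_of_def
  proof (intro conjI ballI notI)
    show "0 \<in> \<sigma>" using B by (simp add: convex_cone_hull_contains_0)
    fix a b assume a: "a \<in> \<sigma>" and b: "b \<in> \<sigma>" and 0: "0 \<in> open_segment a b"
    obtain c e where ce: "\<forall>x\<in>B. 0 \<le> (c x :: real)" "a = (\<Sum>x\<in>B. c x *\<^sub>R x)"
        "\<forall>x\<in>B. 0 \<le> (e x :: real)" "b = (\<Sum>x\<in>B. e x *\<^sub>R x)"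
      using a b unfolding B(2) convex_cone_hull_finite[OF fB] by blast
    obtain t where t: "0 < t" "t < 1" "0 = (1 - t) *\<^sub>R a + t *\<^sub>R b" "a \<noteq> b"
      using 0 by (auto simp: in_segment)
    have "(\<Sum>x\<in>B. ((1 - t) * c x + t * e x) *\<^sub>R x) = 0"
      using t(3) by (simp add: ce scaleR_sum_right scaleR_left_distrib sum.distrib)
    then have *: "(1 - t) * c x + t * e x = 0" if "x \<in> B" for x
      by (intro independentD[OF B(1) fB subset_refl _ that, of "\<lambda>x. (1 - t) * c x + t * e x"])
    have "c x = 0 \<and> e x = 0" if "x \<in> B" for x
    proof -
      have "0 \<le> (1 - t) * c x" "0 \<le> t * e x" using ce t that by auto
      then have "(1 - t) * c x = 0" "t * e x = 0" using *[OF that] by linarith+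
      then show ?thesis using t by auto
    qed
    then show False using ce t(4) by simp
  qed
  then show ?thesis
    using assms \<sigma> unfolding weighted_fan_def complete_simplicial_fan_def by blast
qed

text \<open>Completeness concerns all cones. The complement of the maximal ones is open, because
  finitely many closed cones are removed, and it is covered by finitely many cones of smaller
  dimension, which are null sets; so it is empty.\<close>

lemma Union_max_cones:
  fixes \<Sigma> :: "(real ^ 'n::finite) set set"
  assumes "weighted_fan \<Sigma> w"
  shows "\<Union>(max_cones \<Sigma>) = UNIV"
proof (rule ccontr)
  have fin: "finite \<Sigma>" and un: "\<Union>\<Sigma> = UNIV"
    using assms by (auto simp: weighted_fan_def complete_simplicial_fan_def)
  have "closed \<sigma>" if \<sigma>: "\<sigma> \<in> max_cones \<Sigma>" for \<sigma>
  proof -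
    obtain B where "independent B" "\<sigma> = convex_cone hull B"
      using assms max_cone_imp_cone[OF \<sigma>]
      unfolding weighted_fan_def complete_simplicial_fan_def rational_simplicial_cone_def by metis
    then show ?thesis by (simp add: closed_convex_cone_hull independent_imp_finite)
  qed
  then have "open (- \<Union>(max_cones \<Sigma>))"
    using fin by (intro open_Compl closed_Union) (auto simp: cones_of_dim_def)
  moreover assume "\<Union>(max_cones \<Sigma>) \<noteq> UNIV"
  ultimately have "\<not> negligible (- \<Union>(max_cones \<Sigma>))"
    by (intro open_not_negligible) auto
  moreover have "negligible (\<Union>(\<Sigma> - max_cones \<Sigma>))"
  proof (intro negligible_Union)
    fix \<tau> assume "\<tau> \<in> \<Sigma> - max_cones \<Sigma>"
    then have "dim \<tau> \<noteq> CARD('n)" by (auto simp: cones_of_dim_def)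
    then have "dim \<tau> < DIM(real ^ 'n)" using dim_subset_UNIV[of \<tau>] by simp
    then show "negligible \<tau>" by (rule negligible_lowdim)
  qed (use fin in auto)
  moreover have "- \<Union>(max_cones \<Sigma>) \<subseteq> \<Union>(\<Sigma> - max_cones \<Sigma>)" using un by auto
  ultimately show False using negligible_subset by blast
qed

text \<open>A maximal cone inside another one would be a proper face of it and have smaller
  dimension. The intersection defining the lattice thus has a single member.\<close>

lemma cone_lattice_max_cone:
  fixes \<Sigma> :: "(real ^ 'n::finite) set set"
  assumes fan: "weighted_fan \<Sigma> w" and \<sigma>: "\<sigma> \<in> max_cones \<Sigma>"
  shows "cone_lattice \<Sigma> w \<sigma> = max_cone_lattice \<Sigma> w \<sigma>"
proof -
  have "\<sigma>' = \<sigma>" if "\<sigma>' \<in> max_cones \<Sigma>" "\<sigma> \<subseteq> \<sigma>'" for \<sigma>'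
  proof (rule ccontr)
    assume "\<sigma>' \<noteq> \<sigma>"
    have "\<sigma> \<inter> \<sigma>' face_of \<sigma>'"
      using fan max_cone_imp_cone[OF \<sigma>] max_cone_imp_cone[OF that(1)]
      unfolding weighted_fan_def complete_simplicial_fan_def by blast
    then have "\<sigma> face_of \<sigma>'" using that(2) by (simp add: inf.absorb1)
    moreover have "convex_cone \<sigma>'" using fan fan_cone_convex_cone max_cone_imp_cone that by blast
    then have "convex \<sigma>'" by (simp add: convex_cone_def)
    ultimately have "aff_dim \<sigma> < aff_dim \<sigma>'" using face_of_aff_dim_lt \<open>\<sigma>' \<noteq> \<sigma>\<close> by blast
    \<comment> \<open>Cones contain the origin, so affine and linear dimension agree.\<close>
    moreover have "aff_dim \<rho> = dim \<rho>" if "\<rho> \<in> max_cones \<Sigma>" for \<rho>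
      using fan_cone_zero[OF fan max_cone_imp_cone[OF that]] by (simp add: aff_dim_zero hull_inc)
    ultimately show False using \<sigma> that by (simp add: cones_of_dim_def)
  qed
  then have "{\<sigma>' \<in> max_cones \<Sigma>. \<sigma> \<subseteq> \<sigma>'} = {\<sigma>}" using \<sigma> by auto
  then show ?thesis by (simp add: cone_lattice_def)
qed

lemma max_cone_charts:
  fixes \<Sigma> :: "(real ^ 'n::finite) set set"
  assumes fan: "weighted_fan \<Sigma> w" and \<sigma>: "\<sigma> \<in> max_cones \<Sigma>"
  shows "\<exists>u d. dual_families u d \<and> range u \<subseteq> std_lattice \<and> \<sigma> = {v. \<forall>i. 0 \<le> d i \<bullet> v} \<and>
    cone_lattice \<Sigma> w \<sigma> = {v. \<forall>i. d i \<bullet> v \<in> \<int>}"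
  using weighted_fan_max_cone[OF fan \<sigma>] cone_lattice_max_cone[OF fan \<sigma>] by simp

lemma cone_lattice_mono: "\<tau>' \<subseteq> \<tau> \<Longrightarrow> cone_lattice \<Sigma> w \<tau>' \<subseteq> cone_lattice \<Sigma> w \<tau>"
  by (auto simp: cone_lattice_def)

section \<open>Commensurability of the lattices, and finiteness of the set of lattice points\<close>

lemma det_in_Ints:
  fixes A :: "real ^ 'n::finite ^ 'n"
  assumes "\<And>i j. A $ i $ j \<in> \<int>"
  shows "det A \<in> \<int>"
  unfolding det_def using assms by (intro Ints_sum Ints_mult Ints_prod) auto

text \<open>Cramer's rule for the integer matrix with columns \<open>u i\<close>: its determinant is
  a common denominator for the coordinates of all lattice vectors.\<close>

lemma lattice_multiple_mem:
  assumes ud: "dual_families u d" and u: "range u \<subseteq> std_lattice"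
  shows "\<exists>D::nat. 0 < D \<and> (\<forall>v\<in>std_lattice. \<forall>i. d i \<bullet> (real D *\<^sub>R v) \<in> \<int>)"
proof -
  define M where "M = (\<chi> k j. u j $ k)"
  define E where "E = (\<chi> i. d i)"
  have MZ: "M $ i $ j \<in> \<int>" for i j using u by (auto simp: M_def std_lattice_def)
  have "E ** M = mat 1"
    using dual_families_sym[OF ud]
    by (simp add: E_def M_def matrix_matrix_mult_def mat_def vec_eq_iff dual_families_def inner_vec_def)
  then have "det E * det M = 1" by (metis det_I det_mul)
  then have det0: "det M \<noteq> 0" by auto
  obtain k where k: "det M = of_int k" using det_in_Ints[OF MZ] by (auto elim: Ints_cases)
  have "det M * (d i \<bullet> v) \<in> \<int>" if v: "v \<in> std_lattice" for v i
  proof -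
    have "M *v (\<chi> i. d i \<bullet> v) = (\<Sum>i\<in>UNIV. (d i \<bullet> v) *\<^sub>R u i)"
      by (simp add: M_def matrix_vector_mult_def vec_eq_iff mult.commute)
    then have "M *v (\<chi> i. d i \<bullet> v) = v" using dual_families_expand[OF ud, of v] by simp
    then have "(\<chi> i. d i \<bullet> v) = (\<chi> k. det (\<chi> i j. if j = k then v $ i else M $ i $ j) / det M)"
      using cramer[OF det0] by blast
    then have "d i \<bullet> v = det (\<chi> l j. if j = i then v $ l else M $ l $ j) / det M"
      by (simp add: vec_eq_iff)
    moreover have "det (\<chi> l j. if j = i then v $ l else M $ l $ j) \<in> \<int>"
      using MZ v by (intro det_in_Ints) (auto simp: std_lattice_def)
    ultimately show ?thesis using det0 by simp
  qed
  moreover have "real (nat \<bar>k\<bar>) = \<bar>det M\<bar>" using k by simp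
  ultimately have "d i \<bullet> (real (nat \<bar>k\<bar>) *\<^sub>R v) \<in> \<int>" if "v \<in> std_lattice" for v i
    using that by (auto simp: abs_if)
  moreover have "nat \<bar>k\<bar> > 0" using det0 k by auto
  ultimately show ?thesis by blast
qed

text \<open>The product of the denominators of all maximal cones works for every intersection of
  their lattices. Consequently each of these lattices has full rank.\<close>

lemma cone_lattice_multiple:
  fixes \<Sigma> :: "(real ^ 'n::finite) set set"
  assumes fan: "weighted_fan \<Sigma> w"
  shows "\<exists>D::nat. 0 < D \<and> (\<forall>\<tau>. \<forall>v\<in>std_lattice. real D *\<^sub>R v \<in> cone_lattice \<Sigma> w \<tau>)"
proof -
  have "\<exists>D::nat. 0 < D \<and> (\<forall>v\<in>std_lattice. real D *\<^sub>R v \<in> max_cone_lattice \<Sigma> w \<sigma>)"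
    if \<sigma>: "\<sigma> \<in> max_cones \<Sigma>" for \<sigma>
  proof -
    obtain u d where ud: "dual_families u d" "range u \<subseteq> std_lattice"
      "max_cone_lattice \<Sigma> w \<sigma> = {v. \<forall>i. d i \<bullet> v \<in> \<int>}"
      using weighted_fan_max_cone[OF fan \<sigma>] by metis
    then show ?thesis using lattice_multiple_mem[OF ud(1,2)] by (simp only: mem_Collect_eq)
  qed
  then obtain D where D: "\<And>\<sigma>. \<sigma> \<in> max_cones \<Sigma> \<Longrightarrow> 0 < (D \<sigma> :: nat)"
    "\<And>\<sigma> v. \<sigma> \<in> max_cones \<Sigma> \<Longrightarrow> v \<in> std_lattice \<Longrightarrow> real (D \<sigma>) *\<^sub>R v \<in> max_cone_lattice \<Sigma> w \<sigma>"
    by metis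
  have fin: "finite (max_cones \<Sigma>)"
    using fan by (auto simp: weighted_fan_def complete_simplicial_fan_def cones_of_dim_def)
  have "real (prod D (max_cones \<Sigma>)) *\<^sub>R v \<in> max_cone_lattice \<Sigma> w \<sigma>"
    if v: "v \<in> std_lattice" and \<sigma>: "\<sigma> \<in> max_cones \<Sigma>" for v \<sigma>
  proof -
    define P where "P = prod D (max_cones \<Sigma> - {\<sigma>})"
    have "prod D (max_cones \<Sigma>) = D \<sigma> * P"
      using fin \<sigma> by (simp add: P_def prod.remove)
    moreover have "real (D \<sigma>) *\<^sub>R (real P *\<^sub>R v) \<in> max_cone_lattice \<Sigma> w \<sigma>"
      using D(2)[OF \<sigma> std_lattice_scale[OF v Ints_of_nat]] .
    ultimately show ?thesis by simp
  qed
  moreover have "0 < prod D (max_cones \<Sigma>)" using D(1) by (intro prod_pos) auto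
  ultimately show ?thesis by (intro exI[of _ "prod D (max_cones \<Sigma>)"]) (auto simp: cone_lattice_def)
qed

text \<open>A vector \<open>v\<close> lies in some maximal cone, and there
  \<open>m \<sigma> \<bullet> v\<close> bounds \<open>a \<bullet> v\<close> from below on the
  polytope. Taking for \<open>v\<close> the axis vectors and their negatives encloses the polytope
  in a box.\<close>

lemma finite_lattice_points_newton_polytope:
  fixes \<Sigma> :: "(real ^ 'n::finite) set set"
  assumes fan: "weighted_fan \<Sigma> w"
  shows "finite (dual_lattice std_lattice \<inter> newton_polytope \<Sigma> m)"
proof -
  have lower: "\<exists>r. \<forall>a\<in>newton_polytope \<Sigma> m. r \<le> a \<bullet> v" for v
  proof -
    obtain \<sigma> where \<sigma>: "\<sigma> \<in> max_cones \<Sigma>" "v \<in> \<sigma>"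
      using Union_max_cones[OF fan] by blast
    have "m \<sigma> \<bullet> v \<le> a \<bullet> v" if "a \<in> newton_polytope \<Sigma> m" for a
      using that \<sigma> by (auto simp: newton_polytope_def dual_cone_def inner_add_left dest!: bspec[OF _ \<sigma>(1)])
    then show ?thesis by blast
  qed
  obtain r where r: "\<And>v a. a \<in> newton_polytope \<Sigma> m \<Longrightarrow> r v \<le> a \<bullet> v"
    using lower by metis
  define s where "s = (\<lambda>i. {x::real. x \<in> \<int> \<and> r (axis i 1) \<le> x \<and> x \<le> - r (- axis i 1)})"
  have "finite (s i)" for i
    using finite_int_segment[of "r (axis i 1)" "- r (- axis i 1)"] by (simp add: s_def)
  then have "finite (vec_lambda ` (PiE UNIV s))" by (intro finite_imageI finite_PiE) auto
  moreover have "dual_lattice std_lattice \<inter> newton_polytope \<Sigma> m \<subseteq> vec_lambda ` (PiE UNIV s)"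
  proof
    fix a assume a: "a \<in> dual_lattice std_lattice \<inter> newton_polytope \<Sigma> m"
    have "a $ i \<in> s i" for i
    proof -
      have "axis i 1 \<in> std_lattice" by (auto simp: std_lattice_def axis_def)
      then have "a \<bullet> axis i 1 \<in> \<int>" using a by (auto simp: dual_lattice_def)
      moreover have "r (axis i 1) \<le> a \<bullet> axis i 1" "r (- axis i 1) \<le> a \<bullet> (- axis i 1)"
        using a r by blast+
      ultimately show ?thesis by (simp add: s_def inner_axis)
    qed
    then have "($) a \<in> PiE UNIV s" by auto
    then show "a \<in> vec_lambda ` (PiE UNIV s)" by (metis image_eqI vec_nth_inverse)
  qed
  ultimately show ?thesis by (rule finite_subset[rotated])
qed

section \<open>Characters\<close>

lemma char_val_add_left: "char_val (a + b) \<xi> = char_val a \<xi> * char_val b \<xi>"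
  by (simp add: char_val_def inner_add_left distrib_left cis_mult)

lemma char_val_add_right: "char_val a (\<xi> + \<eta>) = char_val a \<xi> * char_val a \<eta>"
  by (simp add: char_val_def inner_add_right distrib_left cis_mult)

lemma char_val_zero [simp]: "char_val 0 \<xi> = 1" "char_val a 0 = 1"
  by (simp_all add: char_val_def)

lemma char_val_nonzero [simp]: "char_val a \<xi> \<noteq> 0"
  by (simp add: char_val_def)

lemma char_val_minus: "char_val (- a) \<xi> = inverse (char_val a \<xi>)" "char_val a (- \<xi>) = inverse (char_val a \<xi>)"
  by (simp_all add: char_val_def cis_inverse)

lemma char_val_eq_1_iff: "char_val a \<xi> = 1 \<longleftrightarrow> a \<bullet> \<xi> \<in> \<int>"
proof -
  have "char_val a \<xi> = 1 \<longleftrightarrow> cos (2 * pi * (a \<bullet> \<xi>)) = 1"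
    by (auto simp: char_val_def complex_eq_iff cos_one_sin_zero)
  also have "\<dots> \<longleftrightarrow> (\<exists>k::int. 2 * pi * (a \<bullet> \<xi>) = of_int k * 2 * pi)"
    by (rule cos_one_2pi_int)
  also have "\<dots> \<longleftrightarrow> (\<exists>k::int. a \<bullet> \<xi> = of_int k)" by auto
  also have "\<dots> \<longleftrightarrow> a \<bullet> \<xi> \<in> \<int>" by (auto elim: Ints_cases)
  finally show ?thesis .
qed

lemma char_val_eqD:
  assumes "\<And>\<xi>. char_val a \<xi> = char_val b \<xi>"
  shows "a = b"
proof (rule ccontr)
  assume "a \<noteq> b"
  \<comment> \<open>Scaled so that the character of exponent \<open>a - b\<close> takes the value -1
    at \<xi>.\<close>
  define \<xi> where "\<xi> = (1 / (2 * ((a - b) \<bullet> (a - b)))) *\<^sub>R (a - b)"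
  have "(a - b) \<bullet> \<xi> = 1 / 2" using \<open>a \<noteq> b\<close> by (simp add: \<xi>_def)
  have "char_val (a - b + b) \<xi> = char_val (a - b) \<xi> * char_val b \<xi>" by (rule char_val_add_left)
  then have "char_val (a - b) \<xi> = 1" using assms by simp
  then show False using \<open>(a - b) \<bullet> \<xi> = 1 / 2\<close> by (simp add: char_val_def)
qed

text \<open>Artin's argument: translating a vanishing combination by \<eta> and subtracting
  \<open>char_val b \<eta>\<close> times the original removes the character \<open>b\<close>; the
  other characters keep a nonzero factor for a suitable \<eta>.\<close>

lemma char_val_independent:
  assumes "finite A" "\<And>\<xi>. (\<Sum>a\<in>A. c a * char_val a \<xi>) = 0" "a \<in> A"
  shows "c a = 0"
  using assms
proof (induction A arbitrary: c a rule: finite_induct)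
  case (insert b A)
  have *: "c a = 0" if a: "a \<in> A" for a
  proof -
    have "c a * (char_val a \<eta> - char_val b \<eta>) = 0" for \<eta>
    proof (rule insert.IH[OF _ a])
      fix \<xi>
      have "(\<Sum>a\<in>A. c a * (char_val a \<eta> - char_val b \<eta>) * char_val a \<xi>) =
          (\<Sum>a\<in>insert b A. c a * char_val a (\<xi> + \<eta>)) - char_val b \<eta> * (\<Sum>a\<in>insert b A. c a * char_val a \<xi>)"
        using insert.hyps
        by (simp add: char_val_add_right algebra_simps sum_distrib_left sum_subtractf)
      then show "(\<Sum>a\<in>A. c a * (char_val a \<eta> - char_val b \<eta>) * char_val a \<xi>) = 0"
        unfolding insert.prems(1) by simp
    qed
    moreover obtain \<eta> where "char_val a \<eta> \<noteq> char_val b \<eta>"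
      using char_val_eqD[of a b] a insert.hyps by blast
    ultimately show ?thesis by auto
  qed
  have "(\<Sum>a\<in>insert b A. c a * char_val a 0) = 0" by (rule insert.prems(1))
  then have "c b = 0" using insert.hyps * by simp
  then show ?case using * insert.prems(2) by auto
qed auto

text \<open>The value of the character \<open>a\<close> of the complexified torus at the point with
  logarithm \<xi> + \<i>\<eta>. Its modulus depends on \<eta> alone and is at most 1 if
  \<open>a \<bullet> \<eta>\<close> is nonnegative.\<close>

definition torus_exp :: "real ^ 'n::finite \<Rightarrow> real ^ 'n \<Rightarrow> real ^ 'n \<Rightarrow> complex" where
  "torus_exp \<xi> \<eta> a = exp (2 * pi * \<i> * Complex (a \<bullet> \<xi>) (a \<bullet> \<eta>))"

lemma Complex_add: "Complex a b + Complex c d = Complex (a + c) (b + d)"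
  by (simp add: complex_eq_iff)

lemma torus_exp_add: "torus_exp \<xi> \<eta> (a + b) = torus_exp \<xi> \<eta> a * torus_exp \<xi> \<eta> b"
  by (simp add: torus_exp_def inner_add_left flip: Complex_add exp_add distrib_left)

lemma torus_exp_nonzero [simp]: "torus_exp \<xi> \<eta> a \<noteq> 0"
  by (simp add: torus_exp_def)

lemma torus_exp_0 [simp]: "torus_exp \<xi> \<eta> 0 = 1" "torus_exp 0 0 a = 1"
  by (simp_all add: torus_exp_def flip: zero_complex.code)

lemma torus_exp_real: "torus_exp \<xi> 0 a = char_val a \<xi>"
proof -
  have "2 * pi * \<i> * Complex (a \<bullet> \<xi>) 0 = \<i> * of_real (2 * pi * (a \<bullet> \<xi>))"
    by (simp add: complex_eq_iff)
  then show ?thesis by (simp only: torus_exp_def char_val_def cis_conv_exp inner_zero_right)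
qed

lemma norm_torus_exp: "norm (torus_exp \<xi> \<eta> a) = exp (- (2 * pi * (a \<bullet> \<eta>)))"
  by (simp add: torus_exp_def norm_exp_eq_Re)

lemma subgroup_int_multiple_mem:
  fixes K :: "'a::real_vector set"
  assumes "0 \<in> K" "\<And>a b. a \<in> K \<Longrightarrow> b \<in> K \<Longrightarrow> a - b \<in> K" "g \<in> K"
  shows "of_int k *\<^sub>R g \<in> K"
proof -
  have add: "a + b \<in> K" if "a \<in> K" "b \<in> K" for a b
    using assms(2)[OF that(1) assms(2)[OF assms(1) that(2)]] by simp
  have "of_nat n *\<^sub>R g \<in> K" for n
    by (induction n) (use assms add in \<open>auto simp: scaleR_left_distrib\<close>)
  moreover have "- (of_nat n *\<^sub>R g) \<in> K" for n
    using assms(2)[OF assms(1) calculation[of n]] by simp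
  ultimately show ?thesis by (cases k rule: int_cases2) auto
qed

text \<open>Divisibility of the multiplicative group of the complex numbers replaces the choice of a basis
  of \<open>G\<close>: the coordinates on which \<open>G\<close> does not vanish are treated one at a time.\<close>

lemma ex_torus_exp_eq:
  fixes v :: "'n::finite \<Rightarrow> real ^ 'n"
  assumes G: "0 \<in> G" "\<And>a b. a \<in> G \<Longrightarrow> b \<in> G \<Longrightarrow> a - b \<in> G"
    and int: "\<And>a i. a \<in> G \<Longrightarrow> a \<bullet> v i \<in> \<int>"
    and sep: "\<And>a. (\<And>i. a \<bullet> v i = 0) \<Longrightarrow> a = 0"
    and x: "x 0 = 1" "\<And>a b. a \<in> G \<Longrightarrow> b \<in> G \<Longrightarrow> x (a + b) = x a * x b"
  shows "\<exists>\<xi> \<eta>. \<forall>a\<in>G. x a = torus_exp \<xi> \<eta> a"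
proof -
  have "\<exists>\<xi> \<eta>. \<forall>a\<in>G. x a = torus_exp \<xi> \<eta> a"
    if "finite I" "\<And>a i. a \<in> G \<Longrightarrow> i \<notin> I \<Longrightarrow> a \<bullet> v i = 0" "0 \<in> G"
      "\<And>a b. a \<in> G \<Longrightarrow> b \<in> G \<Longrightarrow> a - b \<in> G" "\<And>a i. a \<in> G \<Longrightarrow> a \<bullet> v i \<in> \<int>"
      "\<And>a b. a \<in> G \<Longrightarrow> b \<in> G \<Longrightarrow> x (a + b) = x a * x b"
    for I G
    using that
  proof (induction I arbitrary: G rule: finite_induct)
    case empty
    then have "G = {0}" using sep by auto
    then show ?case using x(1) by (intro exI[of _ 0]) auto
  next
    case (insert i I)
    note G0 = insert.prems(2) and Gd = insert.prems(3) and Gx = insert.prems(5)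
    define G' where "G' = {a \<in> G. a \<bullet> v i = 0}"
    have "\<exists>\<xi> \<eta>. \<forall>a\<in>G'. x a = torus_exp \<xi> \<eta> a"
    proof (rule insert.IH)
      show "a \<bullet> v j = 0" if "a \<in> G'" "j \<notin> I" for a j
        using that insert.prems(1)[of a j] by (cases "j = i") (auto simp: G'_def)
    qed (use G0 Gd Gx insert.prems(4) in \<open>auto simp: G'_def inner_diff_left\<close>)
    then obtain \<xi> \<eta> where IH: "\<And>a. a \<in> G' \<Longrightarrow> x a = torus_exp \<xi> \<eta> a" by blast
    show ?case
    proof (cases "G' = G")
      case True
      then show ?thesis using IH by blast
    next
      case False
      have neg: "- a \<in> G" if "a \<in> G" for a using Gd[OF G0 that] by simp
      define \<mu> where "\<mu> = (\<lambda>a. nat \<lfloor>a \<bullet> v i\<rfloor>)"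
      have \<mu>: "real (\<mu> a) = a \<bullet> v i" if "a \<in> G" "0 < a \<bullet> v i" for a
        using insert.prems(4)[OF that(1), of i] that(2) by (auto simp: \<mu>_def elim!: Ints_cases)
      obtain g0 where "g0 \<in> G" "g0 \<bullet> v i \<noteq> 0" using False by (auto simp: G'_def)
      then have "0 < g0 \<bullet> v i \<or> 0 < - g0 \<bullet> v i" by auto
      then obtain g1 where "g1 \<in> G \<and> 0 < g1 \<bullet> v i"
        using \<open>g0 \<in> G\<close> neg[OF \<open>g0 \<in> G\<close>] by metis
      \<comment> \<open>With the least positive pairing with \<open>v i\<close>, this
        \<open>g\<close> together with \<open>G'\<close> generates \<open>G\<close>.\<close>
      from ex_has_least_nat[of "\<lambda>g. g \<in> G \<and> 0 < g \<bullet> v i", OF this, of \<mu>]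
      obtain g where g: "g \<in> G" "0 < g \<bullet> v i"
        and gmin: "\<And>a. a \<in> G \<Longrightarrow> 0 < a \<bullet> v i \<Longrightarrow> \<mu> g \<le> \<mu> a"
        by metis
      define e where "e = g \<bullet> v i"
      have e: "e > 0" using g by (simp add: e_def)
      have xg: "x g \<noteq> 0" using Gx[OF g(1) neg[OF g(1)]] x(1) by auto
      \<comment> \<open>A displacement along \<open>v i\<close> leaves the values on
        \<open>G'\<close> unchanged. This complex multiple of \<open>v i\<close> corrects the value
        at \<open>g\<close>; the logarithm exists because \<open>x g\<close> has the inverse
        \<open>x (- g)\<close>.\<close>
      define \<zeta> where "\<zeta> = Ln (x g / torus_exp \<xi> \<eta> g) / (2 * pi * \<i> * e)"
      define \<xi>' where "\<xi>' = \<xi> + Re \<zeta> *\<^sub>R v i"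
      define \<eta>' where "\<eta>' = \<eta> + Im \<zeta> *\<^sub>R v i"
      have split: "torus_exp \<xi>' \<eta>' a = torus_exp \<xi> \<eta> a * exp (2 * pi * \<i> * (\<zeta> * (a \<bullet> v i)))" for a
      proof -
        have "Complex (a \<bullet> \<xi>') (a \<bullet> \<eta>') = Complex (a \<bullet> \<xi>) (a \<bullet> \<eta>) + \<zeta> * (a \<bullet> v i)"
          by (simp add: \<xi>'_def \<eta>'_def inner_add_right complex_eq_iff)
        then show ?thesis by (simp add: torus_exp_def distrib_left exp_add)
      qed
      define K where "K = {a \<in> G. x a = torus_exp \<xi>' \<eta>' a}"
      have "exp (2 * pi * \<i> * (\<zeta> * e)) = x g / torus_exp \<xi> \<eta> g"
        using e xg by (simp add: \<zeta>_def)
      then have gK: "g \<in> K" using split[of g] g(1) by (simp add: K_def e_def)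
      have K0: "0 \<in> K" using G0 x(1) by (simp add: K_def)
      have Kd: "a - b \<in> K" if "a \<in> K" "b \<in> K" for a b
      proof -
        have ab: "a \<in> G" "b \<in> G" "a - b \<in> G" using that Gd by (auto simp: K_def)
        have "x a = x (a - b) * x b" using Gx[OF ab(3,2)] by simp
        moreover have "torus_exp \<xi>' \<eta>' a = torus_exp \<xi>' \<eta>' (a - b) * torus_exp \<xi>' \<eta>' b"
          using torus_exp_add[of \<xi>' \<eta>' "a - b" b] by simp
        ultimately have "x (a - b) = torus_exp \<xi>' \<eta>' (a - b)"
          using that by (simp add: K_def)
        then show ?thesis using ab by (simp add: K_def)
      qed
      have G'K: "a \<in> K" if "a \<in> G'" for a
        using that IH[OF that] split[of a] by (simp add: G'_def K_def)
      have kg: "of_int k *\<^sub>R g \<in> K" for k using subgroup_int_multiple_mem[OF K0 Kd gK] .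
      have "a \<in> K" if a: "a \<in> G" for a
      proof -
        define k where "k = \<lfloor>(a \<bullet> v i) / e\<rfloor>"
        define r where "r = a - of_int k *\<^sub>R g"
        have rG: "r \<in> G" using Gd[OF a] kg by (auto simp: r_def K_def)
        have r: "r \<bullet> v i = a \<bullet> v i - of_int k * e" by (simp add: r_def inner_diff_left e_def)
        then have r': "0 \<le> r \<bullet> v i" "r \<bullet> v i < e"
          using floor_divide_lower[OF e, of "a \<bullet> v i"] floor_divide_upper[OF e, of "a \<bullet> v i"]
          by (simp_all add: k_def algebra_simps)
        have "r \<bullet> v i = 0"
        proof (rule ccontr)
          assume "r \<bullet> v i \<noteq> 0"
          then have "0 < r \<bullet> v i" using r' by simp
          then have "real (\<mu> g) \<le> real (\<mu> r)" using gmin rG by simp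
          then show False using \<mu> g rG \<open>0 < r \<bullet> v i\<close> r' by (simp add: e_def)
        qed
        then have "r \<in> K" using G'K rG by (simp add: G'_def)
        moreover have "a = r - of_int (- k) *\<^sub>R g" by (simp add: r_def)
        ultimately show ?thesis using Kd kg by metis
      qed
      then show ?thesis unfolding K_def by blast
    qed
  qed
  from this[of UNIV G] show ?thesis using G int x by auto
qed

section \<open>Functions with polynomial slices\<close>

text \<open>Slices are considered on the torus only, since the bounds to be used are stated in
  logarithms of the coordinates. The degree bound \<open>D\<close> is common to all slices, which is
  what interpolation requires.\<close>

definition poly_slices :: "nat \<Rightarrow> (('n \<Rightarrow> complex) \<Rightarrow> complex) \<Rightarrow> bool" where
  "poly_slices D f \<longleftrightarrow> (\<forall>z i. (\<forall>j. z j \<noteq> 0) \<longrightarrow> (\<exists>a. \<forall>t. t \<noteq> 0 \<longrightarrow> f (z(i := t)) = (\<Sum>k\<le>D. a k * t ^ k)))"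

inductive_set poly_funs :: "(('n::finite \<Rightarrow> complex) \<Rightarrow> complex) set" where
  monomial: "(\<lambda>z. c * (\<Prod>i\<in>UNIV. z i ^ k i)) \<in> poly_funs"
| add: "f \<in> poly_funs \<Longrightarrow> g \<in> poly_funs \<Longrightarrow> (\<lambda>z. f z + g z) \<in> poly_funs"

lemma poly_funs_monomial_mult:
  assumes "f \<in> poly_funs"
  shows "(\<lambda>z. c * (\<Prod>i\<in>UNIV. z i ^ k i) * f z) \<in> poly_funs"
  using assms
proof induction
  case (monomial c' k')
  have "(\<lambda>z. c * (\<Prod>i\<in>UNIV. z i ^ k i) * (c' * (\<Prod>i\<in>UNIV. z i ^ k' i))) =
      (\<lambda>z. (c * c') * (\<Prod>i\<in>UNIV. z i ^ (k i + k' i)))"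
    by (simp add: power_add prod.distrib mult_ac)
  then show ?case using poly_funs.monomial[of "c * c'" "\<lambda>i. k i + k' i"] by simp
next
  case (add f g)
  then show ?case using poly_funs.add by (fastforce simp: distrib_left)
qed

lemma poly_funs_mult:
  assumes "f \<in> poly_funs" "g \<in> poly_funs"
  shows "(\<lambda>z. f z * g z) \<in> poly_funs"
  using assms
proof induction
  case (monomial c k)
  then show ?case using poly_funs_monomial_mult by blast
next
  case (add f f')
  then show ?case using poly_funs.add by (fastforce simp: distrib_right)
qed

lemma poly_funs_const: "(\<lambda>z. c) \<in> poly_funs"
  using poly_funs.monomial[of c "\<lambda>_. 0"] by simp

lemma poly_funs_sum:
  assumes "\<And>r. r \<in> R \<Longrightarrow> f r \<in> poly_funs"
  shows "(\<lambda>z. \<Sum>r\<in>R. f r z) \<in> poly_funs"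
  using assms
proof (induction R rule: infinite_finite_induct)
  case (insert r R)
  then have "(\<lambda>z. f r z + (\<Sum>r\<in>R. f r z)) \<in> poly_funs" by (intro poly_funs.add) auto
  with insert.hyps show ?case by simp
qed (use poly_funs_const[of 0] in auto)

lemma poly_funs_poly: "(\<lambda>z. poly p (z i)) \<in> poly_funs"
proof -
  have "(\<lambda>z. poly.coeff p k * (\<Prod>j\<in>UNIV. z j ^ (if j = i then k else 0))) \<in> poly_funs" for k
    by (rule poly_funs.monomial)
  moreover have "(\<Prod>j\<in>UNIV. z j ^ (if j = i then k else 0)) = z i ^ k" for z :: "'a \<Rightarrow> complex" and k
    by (simp add: if_distrib cong: if_cong)
  ultimately show ?thesis by (simp add: poly_altdef poly_funs_sum)
qed

lemma poly_funs_finite_sum: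
  assumes "f \<in> poly_funs"
  shows "\<exists>K c. finite K \<and> (\<forall>z. f z = (\<Sum>k\<in>K. c k * (\<Prod>i\<in>UNIV. z i ^ k i)))"
  using assms
proof induction
  case (monomial c k)
  show ?case by (intro exI[of _ "{k}"] exI[of _ "\<lambda>_. c"]) simp
next
  case (add f g)
  obtain K c where f: "finite K" "\<And>z. f z = (\<Sum>k\<in>K. c k * (\<Prod>i\<in>UNIV. z i ^ k i))"
    using add.IH(1) by blast
  obtain K' c' where g: "finite K'" "\<And>z. g z = (\<Sum>k\<in>K'. c' k * (\<Prod>i\<in>UNIV. z i ^ k i))"
    using add.IH(2) by blast
  define e where "e = (\<lambda>k. (if k \<in> K then c k else 0) + (if k \<in> K' then c' k else 0))"
  have "f z + g z = (\<Sum>k\<in>K \<union> K'. e k * (\<Prod>i\<in>UNIV. z i ^ k i))" for z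
  proof -
    have "f z = (\<Sum>k\<in>K \<union> K'. (if k \<in> K then c k else 0) * (\<Prod>i\<in>UNIV. z i ^ k i))"
      unfolding f(2) using f g by (intro sum.mono_neutral_cong_left) auto
    moreover have "g z = (\<Sum>k\<in>K \<union> K'. (if k \<in> K' then c' k else 0) * (\<Prod>i\<in>UNIV. z i ^ k i))"
      unfolding g(2) using f g by (intro sum.mono_neutral_cong_left) auto
    ultimately show ?thesis by (simp add: e_def distrib_right sum.distrib)
  qed
  moreover have "finite (K \<union> K')" using f g by simp
  ultimately show ?case by (intro exI[of _ "K \<union> K'"] exI[of _ e]) simp
qed

text \<open>The interpolation basis is chosen before the polynomial, so that it can serve all slices
  at once. The nodes are 1 to D + 1: the node 0 is avoided because slices are controlled only at
  nonzero arguments.\<close>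

lemma lagrange_interpolation:
  "\<exists>\<l>. \<forall>p. degree p \<le> D \<longrightarrow> (\<forall>t. poly p t = (\<Sum>r\<le>D. poly p (of_nat (Suc r)) * poly (\<l> r) (t::complex)))"
proof -
  define \<l> :: "nat \<Rightarrow> complex poly" where
    "\<l> = (\<lambda>r. \<Prod>s\<in>{..D} - {r}. smult (1 / (of_nat (Suc r) - of_nat (Suc s))) [:- of_nat (Suc s), 1:])"
  have val: "poly (\<l> r) (of_nat (Suc q)) = (if q = r then 1 else 0)" if "q \<le> D" "r \<le> D" for q r
  proof (cases "q = r")
    case True
    moreover have "- of_nat (Suc s) / (of_nat (Suc r) - of_nat (Suc s)) +
        of_nat (Suc r) / (of_nat (Suc r) - of_nat (Suc s)) = (1 :: complex)" if "s \<noteq> r" for s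
    proof -
      have "of_nat (Suc r) - of_nat (Suc s) \<noteq> (0 :: complex)" using that by simp
      then show ?thesis by (simp add: divide_simps del: of_nat_Suc)
    qed
    ultimately show ?thesis unfolding \<l>_def
      by (auto simp: poly_prod simp del: of_nat_Suc intro!: prod.neutral)
  next
    case False
    then show ?thesis unfolding \<l>_def poly_prod using that
      by (auto simp: add_divide_distrib[symmetric] simp del: of_nat_Suc intro!: prod_zero bexI[of _ q])
  qed
  have deg: "degree (\<l> r) \<le> D" if "r \<le> D" for r
  proof -
    have "degree (\<l> r) \<le> sum (degree \<circ> (\<lambda>s. smult (1 / (of_nat (Suc r) - of_nat (Suc s))) [:- of_nat (Suc s), 1::complex:])) ({..D} - {r})"
      unfolding \<l>_def by (rule degree_prod_sum_le) simp
    also have "\<dots> \<le> sum (\<lambda>s. 1) ({..D} - {r})" by (intro sum_mono) simp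
    also have "\<dots> = D" using that by simp
    finally show ?thesis .
  qed
  have "poly p t = (\<Sum>r\<le>D. poly p (of_nat (Suc r)) * poly (\<l> r) t)" if p: "degree p \<le> D" for p t
  proof -
    define q where "q = (\<Sum>r\<le>D. smult (poly p (of_nat (Suc r))) (\<l> r))"
    have card: "card ((\<lambda>r. of_nat (Suc r) :: complex) ` {..D}) = Suc D"
      by (subst card_image) (auto simp: inj_on_def simp del: of_nat_Suc)
    have "p = q"
    proof (rule poly_eqI_degree)
      fix y :: complex assume "y \<in> (\<lambda>r. of_nat (Suc r)) ` {..D}"
      then obtain s where s: "s \<le> D" "y = of_nat (Suc s)" by auto
      have "poly q y = (\<Sum>r\<le>D. if r = s then poly p y else 0)"
        unfolding q_def poly_sum poly_smult s(2)
        using s(1) val by (intro sum.cong) (auto simp del: of_nat_Suc)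
      then show "poly p y = poly q y" using s by simp
    next
      show "degree p < card ((\<lambda>r. of_nat (Suc r) :: complex) ` {..D})" using card p by simp
      have "degree q \<le> D" unfolding q_def
        using deg by (intro degree_sum_le) (auto intro: order_trans[OF degree_smult_le])
      then show "degree q < card ((\<lambda>r. of_nat (Suc r) :: complex) ` {..D})" using card by simp
    qed
    then show ?thesis by (metis (no_types, lifting) poly_smult poly_sum q_def sum.cong)
  qed
  then show ?thesis by blast
qed

text \<open>Induction on the set \<open>I\<close> of coordinates on which \<open>f\<close> depends.
  Interpolation in the coordinate \<open>i\<close> expresses \<open>f\<close> through its
  restrictions to the nodes of that coordinate, and these restrictions no longer depend on
  it.\<close>

lemma poly_slices_imp_poly_funs:
  fixes f :: "('n::finite \<Rightarrow> complex) \<Rightarrow> complex"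
  assumes "poly_slices D f"
  shows "\<exists>g\<in>poly_funs. \<forall>z. (\<forall>j. z j \<noteq> 0) \<longrightarrow> f z = g z"
proof -
  obtain \<l> where \<l>: "\<And>p t. degree p \<le> D \<Longrightarrow> poly p t = (\<Sum>r\<le>D. poly p (of_nat (Suc r)) * poly (\<l> r) (t::complex))"
    using lagrange_interpolation[of D] by blast
  have "\<exists>g\<in>poly_funs. \<forall>z. (\<forall>j. z j \<noteq> 0) \<longrightarrow> f z = g z"
    if "finite I" "poly_slices D f"
      "\<And>z z'. (\<forall>j. z j \<noteq> 0) \<Longrightarrow> (\<forall>j. z' j \<noteq> 0) \<Longrightarrow> (\<forall>i\<in>I. z i = z' i) \<Longrightarrow> f z = f z'"
    for I and f :: "('n \<Rightarrow> complex) \<Rightarrow> complex"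
    using that
  proof (induction I arbitrary: f rule: finite_induct)
    case empty
    have "f z = f (\<lambda>_. 1)" if "\<forall>j. z j \<noteq> 0" for z using empty(2)[of z "\<lambda>_. 1"] that by simp
    then show ?case by (intro bexI[OF _ poly_funs_const[of "f (\<lambda>_. 1)"]]) blast
  next
    case (insert i I)
    define h where "h = (\<lambda>r z. f (z(i := of_nat (Suc r))))"
    have interp: "f z = (\<Sum>r\<le>D. h r z * poly (\<l> r) (z i))" if z: "\<forall>j. z j \<noteq> 0" for z
    proof -
      obtain a where a: "\<And>t. t \<noteq> 0 \<Longrightarrow> f (z(i := t)) = (\<Sum>k\<le>D. a k * t ^ k)"
        using insert.prems(1)[unfolded poly_slices_def, rule_format, of z i] z by auto
      define p where "p = (\<Sum>k\<le>D. monom (a k) k)"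
      have "degree p \<le> D" unfolding p_def
        by (intro degree_sum_le) (auto intro: order_trans[OF degree_monom_le])
      moreover have p: "poly p t = f (z(i := t))" if "t \<noteq> 0" for t
        using a[OF that] by (simp add: p_def poly_sum poly_monom)
      ultimately show ?thesis
        using \<l>[of p "z i"] p[of "z i"] z by (simp add: h_def p del: of_nat_Suc)
    qed
    have "\<exists>g\<in>poly_funs. \<forall>z. (\<forall>j. z j \<noteq> 0) \<longrightarrow> h r z = g z" for r
    proof (rule insert.IH)
      show "poly_slices D (h r)"
        unfolding poly_slices_def
      proof (intro allI impI)
        fix z :: "'n \<Rightarrow> complex" and j assume z: "\<forall>j. z j \<noteq> 0"
        define z' where "z' = z(i := of_nat (Suc r))"
        have z': "\<forall>j. z' j \<noteq> 0" using z by (simp add: z'_def del: of_nat_Suc)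
        show "\<exists>a. \<forall>t. t \<noteq> 0 \<longrightarrow> h r (z(j := t)) = (\<Sum>k\<le>D. a k * t ^ k)"
        proof (cases "j = i")
          case True
          have "(\<Sum>k\<le>D. (if k = 0 then f z' else 0) * t ^ k) = f z'" for t
            by (simp add: if_distribR if_distrib[where f = "\<lambda>x. x * _"] cong: if_cong)
          then show ?thesis using True by (intro exI[of _ "\<lambda>k. if k = 0 then f z' else 0"]) (simp add: h_def z'_def)
        next
          case False
          then have "h r (z(j := t)) = f (z'(j := t))" for t by (simp add: h_def z'_def fun_upd_twist)
          then show ?thesis using insert.prems(1) z' unfolding poly_slices_def by simp
        qed
      qed
      fix z z' :: "'n \<Rightarrow> complex"
      assume "\<forall>j. z j \<noteq> 0" "\<forall>j. z' j \<noteq> 0" "\<forall>j\<in>I. z j = z' j"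
      then show "h r z = h r z'"
        unfolding h_def by (intro insert.prems(2)) (auto simp del: of_nat_Suc)
    qed
    then obtain g where g: "\<And>r. g r \<in> poly_funs" "\<And>r z. (\<forall>j. z j \<noteq> 0) \<Longrightarrow> h r z = g r z" by metis
    have "(\<lambda>z. \<Sum>r\<le>D. g r z * poly (\<l> r) (z i)) \<in> poly_funs"
      by (intro poly_funs_sum poly_funs_mult poly_funs_poly g)
    then show ?case using interp g(2) by (intro bexI) auto
  qed
  from this[of UNIV f] show ?thesis using assms by (metis UNIV_I ext finite_class.finite_UNIV)
qed

section \<open>Torus orbits in affine toric varieties\<close>

lemma toric_monoid_zero [simp]: "0 \<in> toric_monoid N \<tau>"
  by (simp add: toric_monoid_def dual_lattice_def dual_cone_def)

lemma toric_monoid_add: "a \<in> toric_monoid N \<tau> \<Longrightarrow> b \<in> toric_monoid N \<tau> \<Longrightarrow> a + b \<in> toric_monoid N \<tau>"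
  by (auto simp: toric_monoid_def dual_lattice_def dual_cone_def inner_add_left)

lemma toric_monoid_antimono: "N' \<subseteq> N \<Longrightarrow> \<tau>' \<subseteq> \<tau> \<Longrightarrow> toric_monoid N \<tau> \<subseteq> toric_monoid N' \<tau>'"
  by (auto simp: toric_monoid_def dual_lattice_def dual_cone_def)

lemma affine_toric_restrictI:
  assumes "x 0 = 1" "\<And>a b. a \<in> toric_monoid N \<tau> \<Longrightarrow> b \<in> toric_monoid N \<tau> \<Longrightarrow> x (a + b) = x a * x b"
  shows "restrict x (toric_monoid N \<tau>) \<in> affine_toric N \<tau>"
  using assms by (auto simp: affine_toric_def toric_monoid_add)

lemma affine_toric_zero: "x \<in> affine_toric N \<tau> \<Longrightarrow> x 0 = 1"
  by (simp add: affine_toric_def)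

lemma affine_toric_add:
  "x \<in> affine_toric N \<tau> \<Longrightarrow> a \<in> toric_monoid N \<tau> \<Longrightarrow> b \<in> toric_monoid N \<tau> \<Longrightarrow> x (a + b) = x a * x b"
  by (simp add: affine_toric_def)

lemma affine_toric_eqI:
  "x \<in> affine_toric N \<tau> \<Longrightarrow> y \<in> affine_toric N \<tau> \<Longrightarrow> (\<And>a. a \<in> toric_monoid N \<tau> \<Longrightarrow> x a = y a) \<Longrightarrow> x = y"
  by (auto simp: affine_toric_def intro: extensionalityI)

text \<open>The one-parameter group of \<eta> at complex time \<open>t\<close>. Time -1 is the
  action of \<eta> in \<open>torus_act\<close>; time \<i> scales the monomial \<open>a\<close> by
  the positive number \<open>exp (- (2 * pi * (a \<bullet> \<eta>)))\<close>.\<close>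

definition complex_act ::
    "(real ^ 'n::finite) set \<Rightarrow> (real ^ 'n) set \<Rightarrow> complex \<Rightarrow> real ^ 'n \<Rightarrow> 'n point \<Rightarrow> 'n point" where
  "complex_act N \<tau> t \<eta> x = restrict (\<lambda>a. exp (2 * pi * \<i> * (t * of_real (a \<bullet> \<eta>))) * x a) (toric_monoid N \<tau>)"

text \<open>The point of the open orbit with logarithm \<xi> + \<i>\<eta>. At \<xi> = \<eta> = 0 all
  monomials equal 1.\<close>

definition torus_point :: "(real ^ 'n::finite) set \<Rightarrow> (real ^ 'n) set \<Rightarrow> real ^ 'n \<Rightarrow> real ^ 'n \<Rightarrow> 'n point" where
  "torus_point N \<tau> \<xi> \<eta> = restrict (torus_exp \<xi> \<eta>) (toric_monoid N \<tau>)"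

lemma complex_act_mem:
  assumes "x \<in> affine_toric N \<tau>"
  shows "complex_act N \<tau> t \<eta> x \<in> affine_toric N \<tau>"
  unfolding complex_act_def
  using assms
  by (intro affine_toric_restrictI)
     (auto simp: affine_toric_zero affine_toric_add inner_add_left distrib_left exp_add)

lemma torus_act_eq_complex_act: "torus_act N \<tau> \<xi> x = complex_act N \<tau> (-1) \<xi> x"
proof -
  have "char_val a (- \<xi>) = exp (2 * pi * \<i> * (-1 * of_real (a \<bullet> \<xi>)))" for a
    by (simp add: char_val_def cis_conv_exp mult_ac)
  then show ?thesis by (simp add: torus_act_def complex_act_def)
qed

lemma torus_act_mem: "x \<in> affine_toric N \<tau> \<Longrightarrow> torus_act N \<tau> \<xi> x \<in> affine_toric N \<tau>"
  by (simp add: torus_act_eq_complex_act complex_act_mem)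

lemma complex_act_scaleR: "complex_act N \<tau> (of_real r * t) \<eta> x = complex_act N \<tau> t (r *\<^sub>R \<eta>) x"
  by (simp add: complex_act_def mult_ac)

lemma torus_point_mem: "torus_point N \<tau> \<xi> \<eta> \<in> affine_toric N \<tau>"
  unfolding torus_point_def by (intro affine_toric_restrictI) (auto simp: torus_exp_add)

lemma torus_point_apply: "a \<in> toric_monoid N \<tau> \<Longrightarrow> torus_point N \<tau> \<xi> \<eta> a = torus_exp \<xi> \<eta> a"
  by (simp add: torus_point_def)

lemma torus_point_eq_complex_act:
  "torus_point N \<tau> \<xi> \<eta> = complex_act N \<tau> 1 \<xi> (complex_act N \<tau> \<i> \<eta> (torus_point N \<tau> 0 0))"
proof -
  have "torus_exp \<xi> \<eta> a = exp (2 * pi * \<i> * (1 * of_real (a \<bullet> \<xi>))) * exp (2 * pi * \<i> * (\<i> * of_real (a \<bullet> \<eta>)))" for a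
    by (simp add: torus_exp_def Complex_eq distrib_left exp_add)
  then show ?thesis by (auto simp: torus_point_def complex_act_def restrict_def)
qed

lemma toric_map_mem:
  assumes "N' \<subseteq> N" "\<tau>' \<subseteq> \<tau>" "x \<in> affine_toric N' \<tau>'"
  shows "toric_map N \<tau> x \<in> affine_toric N \<tau>"
proof -
  have "a \<in> toric_monoid N' \<tau>'" if "a \<in> toric_monoid N \<tau>" for a
    using toric_monoid_antimono[OF assms(1,2)] that by blast
  then show ?thesis unfolding toric_map_def
    using assms(3) by (intro affine_toric_restrictI) (auto simp: affine_toric_zero affine_toric_add)
qed

lemma toric_map_complex_act:
  assumes "N' \<subseteq> N" "\<tau>' \<subseteq> \<tau>"
  shows "toric_map N \<tau> (complex_act N' \<tau>' t \<eta> x) = complex_act N \<tau> t \<eta> (toric_map N \<tau> x)"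
proof
  fix a
  show "toric_map N \<tau> (complex_act N' \<tau>' t \<eta> x) a = complex_act N \<tau> t \<eta> (toric_map N \<tau> x) a"
    using subsetD[OF toric_monoid_antimono[OF assms], of a]
    by (simp add: toric_map_def complex_act_def restrict_def)
qed

lemma toric_map_torus_act:
  assumes "N' \<subseteq> N" "\<tau>' \<subseteq> \<tau>"
  shows "toric_map N \<tau> (torus_act N' \<tau>' \<xi> x) = torus_act N \<tau> \<xi> (toric_map N \<tau> x)"
  using toric_map_complex_act[OF assms] by (simp add: torus_act_eq_complex_act)

lemma toric_map_torus_point:
  assumes "N' \<subseteq> N" "\<tau>' \<subseteq> \<tau>"
  shows "toric_map N \<tau> (torus_point N' \<tau>' \<xi> \<eta>) = torus_point N \<tau> \<xi> \<eta>"
proof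
  fix a
  show "toric_map N \<tau> (torus_point N' \<tau>' \<xi> \<eta>) a = torus_point N \<tau> \<xi> \<eta> a"
    using subsetD[OF toric_monoid_antimono[OF assms], of a]
    by (simp add: toric_map_def torus_point_def restrict_def)
qed

lemma continuous_on_restrict_point:
  fixes g :: "'a::topological_space \<Rightarrow> 'b \<Rightarrow> complex"
  assumes "\<And>a. a \<in> M \<Longrightarrow> continuous_on S (\<lambda>x. g x a)"
  shows "continuous_on S (\<lambda>x. restrict (g x) M)"
proof (intro continuous_on_coordinatewise_then_product)
  show "continuous_on S (\<lambda>x. restrict (g x) M a)" for a
    using assms by (cases "a \<in> M") auto
qed

lemma continuous_on_point_eval:
  fixes a :: 'b
  shows "continuous_on S (\<lambda>x :: 'b \<Rightarrow> complex. x a)"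
  by (rule continuous_on_subset[OF continuous_on_product_coordinates subset_UNIV])

lemma continuous_on_toric_map: "continuous_on S (toric_map N \<tau>)"
  unfolding toric_map_def by (intro continuous_on_restrict_point continuous_on_point_eval)

lemma continuous_on_complex_act: "continuous_on S (\<lambda>t. complex_act N \<tau> t \<eta> x)"
  unfolding complex_act_def by (intro continuous_on_restrict_point continuous_intros)

lemma tendsto_point:
  fixes g :: "'a \<Rightarrow> 'b \<Rightarrow> complex"
  assumes "\<And>a. ((\<lambda>x. g x a) \<longlongrightarrow> l a) F"
  shows "(g \<longlongrightarrow> l) F"
  using assms limitin_componentwise[of "\<lambda>_. euclidean" UNIV g l F, unfolded euclidean_product_topology]
  by (simp add: extensional_def)

text \<open>The class of functions used for the transition functions below. Unlike \<open>toric_holomorphic\<close>, it is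
  visibly closed under products, since different functions need not be given by the same monomials.\<close>

definition orbit_holomorphic ::
    "(real ^ 'n::finite) set \<Rightarrow> (real ^ 'n) set \<Rightarrow> 'n point set \<Rightarrow> ('n point \<Rightarrow> complex) \<Rightarrow> bool" where
  "orbit_holomorphic N \<tau> V f \<longleftrightarrow> continuous_on V f \<and>
     (\<forall>x\<in>affine_toric N \<tau>. \<forall>\<eta> t. complex_act N \<tau> t \<eta> x \<in> V \<longrightarrow>
        (\<lambda>s. f (complex_act N \<tau> s \<eta> x)) field_differentiable (at t))"

lemma orbit_holomorphic_subset: "orbit_holomorphic N \<tau> V f \<Longrightarrow> V' \<subseteq> V \<Longrightarrow> orbit_holomorphic N \<tau> V' f"
  by (auto simp: orbit_holomorphic_def intro: continuous_on_subset)

lemma orbit_holomorphic_mult: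
  "orbit_holomorphic N \<tau> V f \<Longrightarrow> orbit_holomorphic N \<tau> V g \<Longrightarrow> orbit_holomorphic N \<tau> V (\<lambda>x. f x * g x)"
  unfolding orbit_holomorphic_def by (simp add: continuous_on_mult field_differentiable_mult)

lemma orbit_holomorphic_divide:
  "orbit_holomorphic N \<tau> V f \<Longrightarrow> orbit_holomorphic N \<tau> V g \<Longrightarrow> (\<And>x. x \<in> V \<Longrightarrow> g x \<noteq> 0) \<Longrightarrow>
    orbit_holomorphic N \<tau> V (\<lambda>x. f x / g x)"
  unfolding orbit_holomorphic_def by (simp add: continuous_on_divide field_differentiable_divide)

lemma orbit_holomorphic_monomial:
  assumes "a \<in> toric_monoid N \<tau>"
  shows "orbit_holomorphic N \<tau> V (\<lambda>x. x a)"
proof -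
  have "(\<lambda>s. exp (2 * pi * \<i> * (s * of_real r)) * c) holomorphic_on UNIV" for r and c :: complex
    by (intro holomorphic_intros)
  then have "(\<lambda>s. exp (2 * pi * \<i> * (s * of_real r)) * c) field_differentiable at t" for r t and c :: complex
    using holomorphic_on_imp_differentiable_at by blast
  then show ?thesis
    using assms by (simp add: orbit_holomorphic_def complex_act_def continuous_on_point_eval)
qed

lemma orbit_holomorphic_toric_map:
  assumes "orbit_holomorphic N \<tau> V f" "N' \<subseteq> N" "\<tau>' \<subseteq> \<tau>"
  shows "orbit_holomorphic N' \<tau>' {x. toric_map N \<tau> x \<in> V} (\<lambda>x. f (toric_map N \<tau> x))"
  unfolding orbit_holomorphic_def
proof (intro conjI ballI allI impI)
  show "continuous_on {x. toric_map N \<tau> x \<in> V} (\<lambda>x. f (toric_map N \<tau> x))"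
  proof (rule continuous_on_compose2[OF _ continuous_on_toric_map])
    show "continuous_on V f" using assms(1) unfolding orbit_holomorphic_def by (rule conjunct1)
  qed auto
  fix x \<eta> t assume "x \<in> affine_toric N' \<tau>'" "complex_act N' \<tau>' t \<eta> x \<in> {x. toric_map N \<tau> x \<in> V}"
  then show "(\<lambda>s. f (toric_map N \<tau> (complex_act N' \<tau>' s \<eta> x))) field_differentiable at t"
    using assms toric_map_mem[OF assms(2,3)]
    by (simp add: orbit_holomorphic_def toric_map_complex_act[OF assms(2,3)])
qed

text \<open>Continuity is local on the variety, and differentiability at time \<open>t\<close> is
  local in time, because the time-to-point map pulls open sets back to open sets. Locality is needed
  since sections and frames are holomorphic only piece by piece.\<close>

lemma orbit_holomorphic_local:
  assumes V: "V \<subseteq> affine_toric N \<tau>"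
    and loc: "\<And>x. x \<in> V \<Longrightarrow> \<exists>V' g. openin (top_of_set (affine_toric N \<tau>)) V' \<and> x \<in> V' \<and>
      orbit_holomorphic N \<tau> V' g \<and> (\<forall>y\<in>V'. f y = g y)"
  shows "orbit_holomorphic N \<tau> V f"
  unfolding orbit_holomorphic_def
proof (intro conjI ballI allI impI)
  show "continuous_on V f"
    unfolding continuous_on_def
  proof
    fix x assume x: "x \<in> V"
    then obtain T g where T: "open T" "x \<in> affine_toric N \<tau> \<inter> T"
      and g: "orbit_holomorphic N \<tau> (affine_toric N \<tau> \<inter> T) g" "\<And>y. y \<in> affine_toric N \<tau> \<inter> T \<Longrightarrow> f y = g y"
      using loc[OF x] by (auto simp: openin_open)
    have "continuous_on (affine_toric N \<tau> \<inter> T) f"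
      using g unfolding orbit_holomorphic_def by (metis (mono_tags, lifting) continuous_on_cong)
    then have "continuous_on (V \<inter> T) f" by (rule continuous_on_subset) (use V in auto)
    then have "(f \<longlongrightarrow> f x) (at x within V \<inter> T)"
      using x T by (auto simp: continuous_on_def)
    moreover have "at x within V \<inter> T = at x within V"
      using T by (intro at_within_nhd[of x T]) auto
    ultimately show "(f \<longlongrightarrow> f x) (at x within V)" by simp
  qed
  fix x \<eta> t assume x: "x \<in> affine_toric N \<tau>" and xt: "complex_act N \<tau> t \<eta> x \<in> V"
  obtain T g where T: "open T" "complex_act N \<tau> t \<eta> x \<in> affine_toric N \<tau> \<inter> T"
    and g: "orbit_holomorphic N \<tau> (affine_toric N \<tau> \<inter> T) g" "\<And>y. y \<in> affine_toric N \<tau> \<inter> T \<Longrightarrow> f y = g y"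
    using loc[OF xt] by (auto simp: openin_open)
  define U where "U = (\<lambda>s. complex_act N \<tau> s \<eta> x) -` T"
  have "(\<lambda>s. g (complex_act N \<tau> s \<eta> x)) field_differentiable at t"
    using g(1)[unfolded orbit_holomorphic_def, THEN conjunct2, rule_format, OF x T(2)] .
  then obtain D where D: "((\<lambda>s. g (complex_act N \<tau> s \<eta> x)) has_field_derivative D) (at t)"
    unfolding field_differentiable_def by blast
  have "((\<lambda>s. f (complex_act N \<tau> s \<eta> x)) has_field_derivative D) (at t)"
  proof (rule has_field_derivative_transform_within_open[OF D])
    show "open U" unfolding U_def using T(1) continuous_on_complex_act by (intro open_vimage)
    show "t \<in> U" using T by (simp add: U_def)
    show "g (complex_act N \<tau> s \<eta> x) = f (complex_act N \<tau> s \<eta> x)" if "s \<in> U" for s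
      using that complex_act_mem[OF x] g(2) by (simp add: U_def)
  qed
  then show "(\<lambda>s. f (complex_act N \<tau> s \<eta> x)) field_differentiable at t"
    unfolding field_differentiable_def by blast
qed

lemma has_derivative_vec:
  fixes f :: "'i::finite \<Rightarrow> 'a::real_normed_vector \<Rightarrow> 'b::euclidean_space"
  assumes "\<And>i. (f i has_derivative D i) F"
  shows "((\<lambda>x. \<chi> i. f i x) has_derivative (\<lambda>h. \<chi> i. D i h)) F"
proof -
  have lin: "linear (\<lambda>c. axis i c :: 'b ^ 'i)" for i
    by (rule linearI) (auto simp: axis_def vec_eq_iff)
  have "((\<lambda>x. axis i (f i x)) has_derivative (\<lambda>h. axis i (D i h))) F" for i
    using lin by (intro bounded_linear.has_derivative[OF _ assms]) (simp add: linear_conv_bounded_linear)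
  then have "((\<lambda>x. \<Sum>i\<in>UNIV. axis i (f i x)) has_derivative (\<lambda>h. \<Sum>i\<in>UNIV. axis i (D i h))) F"
    by (intro has_derivative_sum)
  moreover have "(\<Sum>i\<in>UNIV. axis i (g i)) = (\<chi> i. g i)" for g :: "'i \<Rightarrow> 'b"
    by (simp add: vec_eq_iff axis_def)
  ultimately show ?thesis by simp
qed

lemma holomorphic_fun_continuous_on: "holomorphic_fun F W \<Longrightarrow> continuous_on W F"
  unfolding holomorphic_fun_def
  by (meson continuous_at_imp_continuous_on has_derivative_continuous)

lemma orbit_holomorphic_compose_monomials:
  assumes b: "\<And>i. b i \<in> toric_monoid N \<tau>" and F: "holomorphic_fun F W"
    and V: "\<And>y. y \<in> V \<Longrightarrow> (\<chi> i. y (b i)) \<in> W"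
  shows "orbit_holomorphic N \<tau> V (\<lambda>y. F (\<chi> i. y (b i)))"
  unfolding orbit_holomorphic_def
proof (intro conjI ballI allI impI)
  show "continuous_on V (\<lambda>y. F (\<chi> i. y (b i)))"
    using V by (intro continuous_on_compose2[OF holomorphic_fun_continuous_on[OF F]]
        continuous_on_vec_lambda continuous_on_point_eval) auto
  fix x \<eta> t assume x: "x \<in> affine_toric N \<tau>" and xt: "complex_act N \<tau> t \<eta> x \<in> V"
  define p where "p = (\<lambda>s. \<chi> i. exp (2 * pi * \<i> * (s * of_real (b i \<bullet> \<eta>))) * x (b i))"
  have p: "(\<chi> i. complex_act N \<tau> s \<eta> x (b i)) = p s" for s
    using b by (simp add: complex_act_def p_def)
  then have "p t \<in> W" using V[OF xt] by simp
  then obtain D where D: "(F has_derivative D) (at (p t))" "\<And>c v. D (c *s v) = c * D v"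
    using F by (auto simp: holomorphic_fun_def)
  define e where "e = (\<lambda>i. exp (2 * pi * \<i> * (t * of_real (b i \<bullet> \<eta>))) * (2 * pi * \<i> * (b i \<bullet> \<eta>)) * x (b i))"
  have "((\<lambda>s. exp (2 * pi * \<i> * (s * of_real (b i \<bullet> \<eta>))) * x (b i)) has_field_derivative e i) (at t)" for i
    unfolding e_def by (auto intro!: derivative_eq_intros)
  then have "(p has_derivative (\<lambda>h. \<chi> i. e i * h)) (at t)"
    unfolding p_def by (intro has_derivative_vec) (simp add: has_field_derivative_def)
  then have "((\<lambda>s. F (p s)) has_derivative (\<lambda>h. D (\<chi> i. e i * h))) (at t)"
    using D(1) by (rule has_derivative_compose)
  \<comment> \<open>Complex homogeneity of \<open>D\<close> turns the real derivative along the
    orbit into a complex one.\<close>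
  moreover have "(\<chi> i. e i * h) = h *s (\<chi> i. e i)" for h
    by (simp add: vector_scalar_mult_def mult.commute)
  ultimately have "((\<lambda>s. F (p s)) has_field_derivative D (\<chi> i. e i)) (at t)"
    by (simp add: has_field_derivative_def D(2) mult_commute_abs)
  then show "(\<lambda>s. F (\<chi> i. complex_act N \<tau> s \<eta> x (b i))) field_differentiable at t"
    unfolding p field_differentiable_def by blast
qed

lemma toric_holomorphicE:
  fixes \<tau> :: "(real ^ 'n::finite) set"
  assumes "toric_holomorphic N \<tau> V f" "x \<in> V"
  obtains V' W F and b :: "'n \<Rightarrow> real ^ 'n" where "openin (top_of_set (affine_toric N \<tau>)) V'" "x \<in> V'" "V' \<subseteq> V"
    "\<And>i. b i \<in> toric_monoid N \<tau>" "open W" "holomorphic_fun F W"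
    "\<And>y. y \<in> V' \<Longrightarrow> (\<chi> i. y (b i)) \<in> W" "\<And>y. y \<in> V' \<Longrightarrow> f y = F (\<chi> i. y (b i))"
  using bspec[OF assms(1)[unfolded toric_holomorphic_def] assms(2)]
proof (elim exE conjE)
  fix V' W F and b :: "'n \<Rightarrow> real ^ 'n"
  assume *: "openin (top_of_set (affine_toric N \<tau>)) V'" "x \<in> V'" "V' \<subseteq> V"
    "\<forall>i. b i \<in> toric_monoid N \<tau>" "open W" "holomorphic_fun F W"
    "\<forall>y\<in>V'. (\<chi> i. y (b i)) \<in> W \<and> f y = F (\<chi> i. y (b i))"
  then show thesis by (intro that[of V' b W F]) simp_all
qed

lemma toric_holomorphic_imp_orbit_holomorphic:
  fixes \<tau> :: "(real ^ 'n::finite) set"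
  assumes "toric_holomorphic N \<tau> V f"
  shows "orbit_holomorphic N \<tau> V f"
proof (rule orbit_holomorphic_local)
  have *: "\<exists>V'. openin (top_of_set (affine_toric N \<tau>)) V' \<and> x \<in> V' \<and> V' \<subseteq> affine_toric N \<tau> \<and>
      (\<exists>g. orbit_holomorphic N \<tau> V' g \<and> (\<forall>y\<in>V'. f y = g y))" if x: "x \<in> V" for x
  proof (rule toric_holomorphicE[OF assms x])
    fix V' W F and b :: "'n \<Rightarrow> real ^ 'n"
    assume V': "openin (top_of_set (affine_toric N \<tau>)) V'" "x \<in> V'" and F: "holomorphic_fun F W"
      and b: "\<And>i. b i \<in> toric_monoid N \<tau>" and W: "\<And>y. y \<in> V' \<Longrightarrow> (\<chi> i. y (b i)) \<in> W"
      and f: "\<And>y. y \<in> V' \<Longrightarrow> f y = F (\<chi> i. y (b i))"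
    have "orbit_holomorphic N \<tau> V' (\<lambda>y. F (\<chi> i. y (b i)))"
      by (rule orbit_holomorphic_compose_monomials[where b = b and F = F and W = W, OF b F W])
    then have "\<exists>g. orbit_holomorphic N \<tau> V' g \<and> (\<forall>y\<in>V'. f y = g y)"
      using f by (intro exI[of _ "\<lambda>y. F (\<chi> i. y (b i))"]) simp
    then show ?thesis using V' openin_imp_subset by blast
  qed
  then show "V \<subseteq> affine_toric N \<tau>" by blast
  show "\<exists>V' g. openin (top_of_set (affine_toric N \<tau>)) V' \<and> x \<in> V' \<and>
      orbit_holomorphic N \<tau> V' g \<and> (\<forall>y\<in>V'. f y = g y)" if "x \<in> V" for x
    using *[OF that] by blast
qed

section \<open>Functions invariant under the torus\<close>

lemma zero_islimpt_reals: "(0::complex) islimpt \<real>"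
  unfolding islimpt_approachable
proof (intro allI impI)
  fix e :: real assume "e > 0"
  then show "\<exists>x'\<in>\<real>. x' \<noteq> 0 \<and> dist x' (0::complex) < e"
    by (intro bexI[of _ "of_real (e / 2)"]) auto
qed

text \<open>At real times the orbit map is the action of the real torus, so the entire function of
  time measuring the change of \<open>h\<close> vanishes on the real axis and hence
  everywhere.\<close>

lemma orbit_holomorphic_complex_invariant:
  assumes h: "orbit_holomorphic N \<tau> (affine_toric N \<tau>) h"
    and inv: "\<And>x \<xi>. x \<in> affine_toric N \<tau> \<Longrightarrow> h (torus_act N \<tau> \<xi> x) = h x"
    and x: "x \<in> affine_toric N \<tau>"
  shows "h (complex_act N \<tau> t \<eta> x) = h x"
proof -
  have "(\<lambda>s. h (complex_act N \<tau> s \<eta> x) - h x) holomorphic_on UNIV"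
    using h x complex_act_mem[OF x] unfolding orbit_holomorphic_def
    by (intro holomorphic_intros) (auto simp: holomorphic_on_def)
  moreover have "h (complex_act N \<tau> s \<eta> x) - h x = 0" if "s \<in> \<real>" for s
  proof -
    obtain r where "s = of_real r" using \<open>s \<in> \<real>\<close> by (auto elim: Reals_cases)
    then have "complex_act N \<tau> s \<eta> x = torus_act N \<tau> (- r *\<^sub>R \<eta>) x"
      using complex_act_scaleR[of N \<tau> "- r" "-1" \<eta> x] by (simp add: torus_act_eq_complex_act)
    then show ?thesis using inv[OF x] by simp
  qed
  ultimately have "h (complex_act N \<tau> t \<eta> x) - h x = 0"
    using zero_islimpt_reals by (rule_tac analytic_continuation[of _ UNIV \<real> 0]) auto
  then show ?thesis by simp
qed

text \<open>An invariant function is constant: the one-parameter group of a relative interior point \<open>\<kappa>\<close> of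
  \<open>\<tau>\<close> contracts \<open>x\<close> to the closed orbit, on which the complexified torus acts transitively.\<close>

lemma orbit_holomorphic_invariant_const:
  fixes v :: "'n::finite \<Rightarrow> real ^ 'n"
  assumes h: "orbit_holomorphic N \<tau> (affine_toric N \<tau>) h"
    and inv: "\<And>x \<xi>. x \<in> affine_toric N \<tau> \<Longrightarrow> h (torus_act N \<tau> \<xi> x) = h x"
    and \<kappa>: "\<kappa> \<in> \<tau>" "\<And>a. a \<in> dual_cone \<tau> \<Longrightarrow> a \<bullet> \<kappa> = 0 \<Longrightarrow> \<forall>y\<in>\<tau>. a \<bullet> y = 0"
    and v: "\<And>i. v i \<in> N" "\<And>a. (\<And>i. a \<bullet> v i = 0) \<Longrightarrow> a = 0"
    and x: "x \<in> affine_toric N \<tau>"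
  shows "h x = h (torus_point N \<tau> 0 0)"
proof -
  \<comment> \<open>The limit under the flow of \<kappa> as imaginary time goes to infinity:
    monomials pairing positively with \<kappa> decay to 0, the others do not move.\<close>
  define lim where "lim = (\<lambda>x. restrict (\<lambda>a. if a \<bullet> \<kappa> = 0 then x a else 0 :: complex) (toric_monoid N \<tau>))"
  have nonneg: "0 \<le> a \<bullet> \<kappa>" if "a \<in> toric_monoid N \<tau>" for a
    using that \<kappa>(1) by (auto simp: toric_monoid_def dual_cone_def)
  have lim: "h y = h (lim y)" if y: "y \<in> affine_toric N \<tau>" for y
  proof -
    have "lim y \<in> affine_toric N \<tau>" unfolding lim_def
    proof (rule affine_toric_restrictI)
      fix a b assume a: "a \<in> toric_monoid N \<tau>" and b: "b \<in> toric_monoid N \<tau>"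
      then have "(a + b) \<bullet> \<kappa> = 0 \<longleftrightarrow> a \<bullet> \<kappa> = 0 \<and> b \<bullet> \<kappa> = 0"
        using nonneg[OF a] nonneg[OF b] by (auto simp: inner_add_left)
      then show "(if (a + b) \<bullet> \<kappa> = 0 then y (a + b) else 0) =
          (if a \<bullet> \<kappa> = 0 then y a else 0) * (if b \<bullet> \<kappa> = 0 then y b else 0)"
        using affine_toric_add[OF y a b] by auto
    qed (simp add: affine_toric_zero[OF y])
    moreover have "(\<lambda>n::nat. complex_act N \<tau> (\<i> * real n) \<kappa> y) \<longlonglongrightarrow> lim y"
    proof (rule tendsto_point)
      fix a
      consider "a \<notin> toric_monoid N \<tau>" | "a \<in> toric_monoid N \<tau>" "a \<bullet> \<kappa> = 0" | "a \<in> toric_monoid N \<tau>" "a \<bullet> \<kappa> > 0"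
        using nonneg[of a] by force
      then show "(\<lambda>n. complex_act N \<tau> (\<i> * real n) \<kappa> y a) \<longlonglongrightarrow> lim y a"
      proof cases
        case 3
        define r where "r = exp (- (2 * pi * (a \<bullet> \<kappa>)))"
        have "0 \<le> r" "r < 1" using 3 by (auto simp: r_def)
        then have "(\<lambda>n. of_real (r ^ n) * y a) \<longlonglongrightarrow> of_real 0 * y a"
          by (intro tendsto_intros LIMSEQ_realpow_zero)
        moreover have "complex_act N \<tau> (\<i> * real n) \<kappa> y a = of_real (r ^ n) * y a" for n
        proof -
          have "2 * pi * \<i> * ((\<i> * real n) * of_real (a \<bullet> \<kappa>)) = of_real (real n * (- (2 * pi * (a \<bullet> \<kappa>))))"
            by (simp add: complex_eq_iff)
          then show ?thesis using 3(1)
            by (simp only: complex_act_def restrict_apply' exp_of_real r_def exp_of_nat_mult)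
        qed
        ultimately show ?thesis using 3 by (simp add: lim_def)
      qed (auto simp: complex_act_def lim_def)
    qed
    ultimately have "(\<lambda>n::nat. h (complex_act N \<tau> (\<i> * real n) \<kappa> y)) \<longlonglongrightarrow> h (lim y)"
      using h y by (intro continuous_on_tendsto_compose[of "affine_toric N \<tau>" h])
        (auto simp: orbit_holomorphic_def complex_act_mem)
    then have "(\<lambda>n::nat. h y) \<longlonglongrightarrow> h (lim y)"
      using orbit_holomorphic_complex_invariant[OF h inv y] by simp
    then show ?thesis using LIMSEQ_unique tendsto_const by blast
  qed
  \<comment> \<open>By the choice of \<kappa> the monomials that survive in the limit are exactly
    those with exponent in \<open>G\<close>. This is a group, so on it \<open>x\<close> has nonzero
    values and agrees with some torus point; the two limits then coincide.\<close>
  define G where "G = {a \<in> dual_lattice N. \<forall>y\<in>\<tau>. a \<bullet> y = 0}"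
  have GM: "a \<in> toric_monoid N \<tau>" if "a \<in> G" for a
    using that by (auto simp: G_def toric_monoid_def dual_cone_def)
  have "\<exists>\<xi> \<eta>. \<forall>a\<in>G. x a = torus_exp \<xi> \<eta> a"
  proof (rule ex_torus_exp_eq[of G v x])
    show "a \<bullet> v i \<in> \<int>" if "a \<in> G" for a i
      using that v(1) by (auto simp: G_def dual_lattice_def)
    show "x 0 = 1" using affine_toric_zero[OF x] .
    show "x (a + b) = x a * x b" if "a \<in> G" "b \<in> G" for a b
      using affine_toric_add[OF x] GM that by blast
  qed (use v(2) in \<open>auto simp: G_def dual_lattice_def inner_diff_left\<close>)
  then obtain \<xi> \<eta> where xe: "\<And>a. a \<in> G \<Longrightarrow> x a = torus_exp \<xi> \<eta> a" by blast
  have "lim x = lim (torus_point N \<tau> \<xi> \<eta>)"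
    unfolding lim_def
  proof (intro restrict_ext)
    fix a assume a: "a \<in> toric_monoid N \<tau>"
    have "a \<in> G" if "a \<bullet> \<kappa> = 0"
      using a that \<kappa>(2) by (auto simp: G_def toric_monoid_def)
    then show "(if a \<bullet> \<kappa> = 0 then x a else 0) = (if a \<bullet> \<kappa> = 0 then torus_point N \<tau> \<xi> \<eta> a else 0)"
      using xe torus_point_apply[OF a] by simp
  qed
  then have "h x = h (torus_point N \<tau> \<xi> \<eta>)"
    using lim[OF x] lim[OF torus_point_mem] by metis
  also have "\<dots> = h (torus_point N \<tau> 0 0)"
    unfolding torus_point_eq_complex_act[of N \<tau> \<xi> \<eta>]
    by (simp add: orbit_holomorphic_complex_invariant[OF h inv] complex_act_mem torus_point_mem)
  finally show ?thesis .
qed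

text \<open>The sum of the generators works: a functional in the dual cone is nonnegative on each of
  them, and if the sum of these values is zero, so is each of them.\<close>

lemma fan_cone_ex_rel_interior:
  assumes "weighted_fan \<Sigma> w" "\<tau> \<in> \<Sigma>"
  shows "\<exists>\<kappa>\<in>\<tau>. \<forall>a\<in>dual_cone \<tau>. a \<bullet> \<kappa> = 0 \<longrightarrow> (\<forall>y\<in>\<tau>. a \<bullet> y = 0)"
proof -
  obtain B where B: "independent B" "\<tau> = convex_cone hull B"
    using assms unfolding weighted_fan_def complete_simplicial_fan_def rational_simplicial_cone_def by metis
  have fB: "finite B" using B(1) by (rule independent_imp_finite)
  note hull = B(2)[unfolded convex_cone_hull_finite[OF fB]]
  have "\<forall>b\<in>B. 0 \<le> (1::real)" "(\<Sum>b\<in>B. b) = (\<Sum>b\<in>B. 1 *\<^sub>R b)" by auto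
  then have mem: "(\<Sum>b\<in>B. b) \<in> \<tau>" unfolding hull by (intro CollectI exI[of _ "\<lambda>_. 1"]) auto
  moreover have "a \<bullet> y = 0" if a: "a \<in> dual_cone \<tau>" "a \<bullet> (\<Sum>b\<in>B. b) = 0" and y: "y \<in> \<tau>" for a y
  proof -
    have "0 \<le> a \<bullet> b" if "b \<in> B" for b
      using a(1) that B(2) by (auto simp: dual_cone_def intro: hull_inc)
    then have "a \<bullet> b = 0" if "b \<in> B" for b
      using a(2) fB that by (simp add: inner_sum_right sum_nonneg_eq_0_iff)
    then show ?thesis using y unfolding hull by (auto simp: inner_sum_right)
  qed
  ultimately show ?thesis by blast
qed

section \<open>Smooth affine charts\<close>

lemma field_differentiable_compose_local:
  fixes f :: "complex \<Rightarrow> complex"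
  assumes "open U" "t \<in> U" "g field_differentiable (at (k t))" "k field_differentiable (at t)"
    "\<And>s. s \<in> U \<Longrightarrow> f s = g (k s)"
  shows "f field_differentiable (at t)"
proof -
  have "(g \<circ> k) field_differentiable (at t)"
    using assms(3,4) by (intro field_differentiable_compose)
  then obtain D where "((g \<circ> k) has_field_derivative D) (at t)"
    unfolding field_differentiable_def by blast
  then have "(f has_field_derivative D) (at t)"
    by (rule has_field_derivative_transform_within_open[OF _ assms(1,2)]) (simp add: assms(5))
  then show ?thesis unfolding field_differentiable_def by blast
qed

text \<open>In the coordinates \<open>d\<close> the cone is the orthant and the lattice is the
  integer lattice, so the exponents form a free monoid on the \<open>d i\<close> and the variety is
  an affine space with coordinates \<open>x (d i)\<close>.\<close>

locale smooth_chart =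
  fixes N \<sigma> :: "(real ^ 'n::finite) set" and u d :: "'n \<Rightarrow> real ^ 'n"
  assumes ud: "dual_families u d"
    and \<sigma>_eq: "\<sigma> = {v. \<forall>i. 0 \<le> d i \<bullet> v}"
    and N_eq: "N = {v. \<forall>i. d i \<bullet> v \<in> \<int>}"
begin

lemma du: "d i \<bullet> u j = (if i = j then 1 else 0)"
  using dual_families_sym[OF ud] by (simp add: dual_families_def)

lemma toric_monoid_iff: "a \<in> toric_monoid N \<sigma> \<longleftrightarrow> (\<forall>i. a \<bullet> u i \<in> \<nat>)"
proof
  assume a: "a \<in> toric_monoid N \<sigma>"
  have "u i \<in> N" "u i \<in> \<sigma>" for i by (auto simp: N_eq \<sigma>_eq du)
  then have "a \<bullet> u i \<in> \<int>" "0 \<le> a \<bullet> u i" for i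
    using a by (auto simp: toric_monoid_def dual_lattice_def dual_cone_def)
  then show "\<forall>i. a \<bullet> u i \<in> \<nat>" by (auto simp: Nats_altdef2)
next
  assume a: "\<forall>i. a \<bullet> u i \<in> \<nat>"
  have "0 \<le> a \<bullet> u i" "a \<bullet> u i \<in> \<int>" for i using a by (auto simp: Nats_altdef2)
  then show "a \<in> toric_monoid N \<sigma>"
    unfolding toric_monoid_def dual_lattice_def dual_cone_def N_eq \<sigma>_eq
  proof (intro IntI CollectI ballI)
    fix v assume v: "v \<in> {v. \<forall>i. d i \<bullet> v \<in> \<int>}"
    show "a \<bullet> v \<in> \<int>"
      unfolding dual_families_inner[OF ud, of a v]
      using v \<open>\<And>i. a \<bullet> u i \<in> \<int>\<close> by (intro Ints_sum Ints_mult) blast+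
  next
    fix v assume v: "v \<in> {v. \<forall>i. 0 \<le> d i \<bullet> v}"
    show "0 \<le> a \<bullet> v"
      unfolding dual_families_inner[OF ud, of a v]
      using v \<open>\<And>i. 0 \<le> a \<bullet> u i\<close> by (intro sum_nonneg mult_nonneg_nonneg) blast+
  qed
qed

lemma dual_basis_mem: "d i \<in> toric_monoid N \<sigma>"
  by (auto simp: toric_monoid_iff du)

definition expo :: "real ^ 'n \<Rightarrow> 'n \<Rightarrow> nat" where
  "expo a i = nat \<lfloor>a \<bullet> u i\<rfloor>"

lemma real_expo: "a \<in> toric_monoid N \<sigma> \<Longrightarrow> real (expo a i) = a \<bullet> u i"
proof -
  assume "a \<in> toric_monoid N \<sigma>"
  then have "a \<bullet> u i \<in> \<nat>" by (simp add: toric_monoid_iff)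
  then obtain k where "a \<bullet> u i = of_nat k" by (rule Nats_cases)
  then show ?thesis by (simp add: expo_def)
qed

lemma expo_add:
  assumes "a \<in> toric_monoid N \<sigma>" "b \<in> toric_monoid N \<sigma>"
  shows "expo (a + b) i = expo a i + expo b i"
proof -
  have "real (expo (a + b) i) = real (expo a i + expo b i)"
    using assms by (simp add: real_expo toric_monoid_add inner_add_left)
  then show ?thesis by (simp only: of_nat_eq_iff)
qed

text \<open>The inverse of the coordinate map. Because 0 ^ 0 = 1, it is a monoid homomorphism also
  where coordinates vanish.\<close>

definition chart_point :: "complex ^ 'n \<Rightarrow> 'n point" where
  "chart_point z = restrict (\<lambda>a. \<Prod>i\<in>UNIV. z $ i ^ expo a i) (toric_monoid N \<sigma>)"

lemma chart_point_apply: "a \<in> toric_monoid N \<sigma> \<Longrightarrow> chart_point z a = (\<Prod>i\<in>UNIV. z $ i ^ expo a i)"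
  by (simp add: chart_point_def)

lemma chart_point_mem: "chart_point z \<in> affine_toric N \<sigma>"
  unfolding chart_point_def
  by (intro affine_toric_restrictI) (simp_all add: expo_add power_add prod.distrib, simp add: expo_def)

lemma affine_toric_power:
  assumes x: "x \<in> affine_toric N \<sigma>" and a: "a \<in> toric_monoid N \<sigma>"
  shows "x (real k *\<^sub>R a) = x a ^ k \<and> real k *\<^sub>R a \<in> toric_monoid N \<sigma>"
proof (induction k)
  case 0
  then show ?case by (simp add: affine_toric_zero[OF x])
next
  case (Suc k)
  then have "x (real k *\<^sub>R a + a) = x a ^ k * x a" "real k *\<^sub>R a + a \<in> toric_monoid N \<sigma>"
    using affine_toric_add[OF x _ a] toric_monoid_add[OF _ a] by auto
  then show ?case by (simp add: scaleR_left_distrib add.commute mult.commute)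
qed

lemma affine_toric_apply:
  assumes x: "x \<in> affine_toric N \<sigma>" and a: "a \<in> toric_monoid N \<sigma>"
  shows "x a = (\<Prod>i\<in>UNIV. x (d i) ^ expo a i)"
proof -
  have "x (\<Sum>i\<in>I. real (k i) *\<^sub>R d i) = (\<Prod>i\<in>I. x (d i) ^ k i) \<and>
      (\<Sum>i\<in>I. real (k i) *\<^sub>R d i) \<in> toric_monoid N \<sigma>" if "finite I" for I and k :: "'n \<Rightarrow> nat"
    using that
  proof (induction I)
    case empty
    then show ?case by (simp add: affine_toric_zero[OF x])
  next
    case (insert i I)
    then show ?case
      using affine_toric_power[OF x dual_basis_mem, of "k i" i]
      by (simp add: affine_toric_add[OF x] toric_monoid_add)
  qed
  from this[of UNIV "expo a"] show ?thesis
    using dual_families_expand[OF dual_families_sym[OF ud], of a] real_expo[OF a]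
    by (simp add: inner_commute)
qed

lemma chart_point_coordinates:
  assumes x: "x \<in> affine_toric N \<sigma>"
  shows "chart_point (\<chi> i. x (d i)) = x"
  by (rule affine_toric_eqI[OF chart_point_mem x]) (simp add: chart_point_apply affine_toric_apply[OF x])

lemma torus_point_eq_chart_point: "torus_point N \<sigma> \<xi> \<eta> = chart_point (\<chi> i. torus_exp \<xi> \<eta> (d i))"
  using chart_point_coordinates[OF torus_point_mem, of \<xi> \<eta>]
  by (simp add: torus_point_apply dual_basis_mem)

text \<open>Logarithms of the coordinates give \<xi> and \<eta>, with \<eta> determined by the
  absolute values. The norm estimate, in which a factor 1 / (2 pi) has been dropped, later turns
  exponential growth in \<eta> into polynomial growth in the coordinates.\<close>

lemma ex_torus_exp_coordinates:
  assumes z: "\<And>j. z j \<noteq> 0"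
  shows "\<exists>\<xi> \<eta>. (\<forall>j. torus_exp \<xi> \<eta> (d j) = z j) \<and> norm \<eta> \<le> (\<Sum>j\<in>UNIV. \<bar>ln (norm (z j))\<bar> * norm (u j))"
proof -
  define \<zeta> where "\<zeta> = (\<lambda>j. Ln (z j) / (2 * pi * \<i>))"
  define \<xi> where "\<xi> = (\<Sum>j\<in>UNIV. Re (\<zeta> j) *\<^sub>R u j)"
  define \<eta> where "\<eta> = (\<Sum>j\<in>UNIV. Im (\<zeta> j) *\<^sub>R u j)"
  have ze: "torus_exp \<xi> \<eta> (d j) = z j" for j
  proof -
    have "torus_exp \<xi> \<eta> (d j) = exp (2 * pi * \<i> * \<zeta> j)"
      by (simp add: torus_exp_def \<xi>_def \<eta>_def dual_families_inner_sum[OF ud])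
    also have "\<dots> = z j" using z by (simp add: \<zeta>_def)
    finally show ?thesis .
  qed
  have "norm \<eta> \<le> (\<Sum>j\<in>UNIV. \<bar>ln (norm (z j))\<bar> * norm (u j))"
    unfolding \<eta>_def
  proof (rule sum_norm_le)
    fix j
    have "\<i> * \<zeta> j = Ln (z j) / of_real (2 * pi)"
      by (simp add: \<zeta>_def)
    then have "Re (\<i> * \<zeta> j) = Re (Ln (z j)) / (2 * pi)"
      by (simp only: Re_divide_of_real)
    then have "Im (\<zeta> j) = - (ln (norm (z j)) / (2 * pi))"
      using z[of j] by simp
    then have "\<bar>Im (\<zeta> j)\<bar> = \<bar>ln (norm (z j))\<bar> / (2 * pi)"
      by (simp add: abs_divide)
    also have "\<dots> \<le> \<bar>ln (norm (z j))\<bar>"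
      using pi_ge_two by (intro divide_le_eq[THEN iffD2]) (auto simp: mult_le_cancel_left1)
    finally show "norm (Im (\<zeta> j) *\<^sub>R u j) \<le> \<bar>ln (norm (z j))\<bar> * norm (u j)"
      by (simp add: mult_right_mono)
  qed
  then show ?thesis using ze by (intro exI[of _ \<xi>] exI[of _ \<eta>]) simp
qed

lemma continuous_on_chart_point: "continuous_on S chart_point"
  unfolding chart_point_def
  by (intro continuous_on_restrict_point continuous_intros)

text \<open>Since \<open>u i\<close> pairs with \<open>d j\<close> to 0 unless \<open>i = j\<close>,
  its flow moves only the i-th coordinate. This is the link from orbits to coordinate
  slices.\<close>

lemma complex_act_chart_point:
  "complex_act N \<sigma> s (u i) (chart_point z) =
    chart_point (\<chi> j. if j = i then exp (2 * pi * \<i> * s) * z $ j else z $ j)"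
proof (rule affine_toric_eqI)
  fix a assume a: "a \<in> toric_monoid N \<sigma>"
  have "(\<Prod>j\<in>UNIV. (if j = i then exp (2 * pi * \<i> * s) * z $ j else z $ j) ^ expo a j) =
      (\<Prod>j\<in>UNIV. (if j = i then exp (2 * pi * \<i> * s) ^ expo a i else 1) * z $ j ^ expo a j)"
    by (intro prod.cong) (auto simp: power_mult_distrib)
  also have "\<dots> = exp (2 * pi * \<i> * s) ^ expo a i * (\<Prod>j\<in>UNIV. z $ j ^ expo a j)"
    by (simp add: prod.distrib)
  also have "exp (2 * pi * \<i> * s) ^ expo a i = exp (2 * pi * \<i> * (s * of_real (a \<bullet> u i)))"
    by (simp add: real_expo[OF a, symmetric] exp_of_nat_mult[symmetric] mult_ac)
  finally show "complex_act N \<sigma> s (u i) (chart_point z) a =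
      chart_point (\<chi> j. if j = i then exp (2 * pi * \<i> * s) * z $ j else z $ j) a"
    using a by (simp add: complex_act_def chart_point_apply)
qed (simp_all add: chart_point_mem complex_act_mem)

text \<open>At nonzero values of the varied coordinate the slice is locally an orbit parametrized by
  a logarithm. The value 0 is not reached by the flow; there continuity makes the singularity
  removable.\<close>

lemma orbit_holomorphic_slice:
  assumes f: "orbit_holomorphic N \<sigma> (affine_toric N \<sigma>) f"
  shows "(\<lambda>t. f (chart_point (\<chi> j. if j = i then t else z $ j))) holomorphic_on UNIV"
proof -
  define p where "p = (\<lambda>t. f (chart_point (\<chi> j. if j = i then t else z $ j)))"
  have "continuous_on (affine_toric N \<sigma>) f"
    using f unfolding orbit_holomorphic_def by (rule conjunct1)
  then have "continuous_on UNIV p"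
    unfolding p_def
  proof (rule continuous_on_compose2)
    have "continuous_on UNIV (\<lambda>t. if j = i then t else z $ j)" for j by (cases "j = i") auto
    then show "continuous_on UNIV (\<lambda>t. chart_point (\<chi> j. if j = i then t else z $ j))"
      by (intro continuous_on_compose2[OF continuous_on_chart_point[of UNIV]] continuous_on_vec_lambda) auto
  qed (auto simp: chart_point_mem)
  then have cont: "(p \<longlongrightarrow> p t) (at t within UNIV)" for t by (simp add: continuous_on_def)
  have "p holomorphic_on UNIV - {0}"
    unfolding holomorphic_on_def
  proof
    fix t :: complex assume "t \<in> UNIV - {0}"
    then have t: "t \<noteq> 0" by simp
    define y where "y = chart_point (\<chi> j. if j = i then t else z $ j)"
    have "p field_differentiable at t"
    \<comment> \<open>The flow takes the coordinate from \<open>t\<close> to \<open>s\<close> in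
      time \<open>Ln (s / t) / (2 * pi * \<i>)\<close>. The principal branch is holomorphic around
      \<open>s = t\<close>.\<close>
    proof (rule field_differentiable_compose_local[where U = "(\<lambda>s. s / t) -` (- \<real>\<^sub>\<le>\<^sub>0)"
          and g = "\<lambda>s. f (complex_act N \<sigma> s (u i) y)" and k = "\<lambda>s. Ln (s / t) / (2 * pi * \<i>)"])
      show "open ((\<lambda>s. s / t) -` (- \<real>\<^sub>\<le>\<^sub>0))"
        using t by (intro open_vimage continuous_intros open_Compl closed_nonpos_Reals_complex) auto
      show "t \<in> (\<lambda>s. s / t) -` (- \<real>\<^sub>\<le>\<^sub>0)" using t by simp
      show "(\<lambda>s. f (complex_act N \<sigma> s (u i) y)) field_differentiable at (Ln (t / t) / (2 * pi * \<i>))"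
        using f complex_act_mem[OF chart_point_mem] chart_point_mem
        unfolding orbit_holomorphic_def y_def by blast
      have "(\<lambda>s. Ln (s / t) / (2 * pi * \<i>)) holomorphic_on ((\<lambda>s. s / t) -` (- \<real>\<^sub>\<le>\<^sub>0))"
        using t by (intro holomorphic_intros) auto
      then show "(\<lambda>s. Ln (s / t) / (2 * pi * \<i>)) field_differentiable at t"
        using \<open>open _\<close> \<open>t \<in> _ -` _\<close> by (rule holomorphic_on_imp_differentiable_at)
      fix s assume "s \<in> (\<lambda>s. s / t) -` (- \<real>\<^sub>\<le>\<^sub>0)"
      then have "s / t \<noteq> 0" by auto
      then have "exp (2 * pi * \<i> * (Ln (s / t) / (2 * pi * \<i>))) * t = s"
        using t by simp
      then have "(\<chi> j. if j = i then exp (2 * pi * \<i> * (Ln (s / t) / (2 * pi * \<i>))) *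
            (\<chi> j. if j = i then t else z $ j) $ j else (\<chi> j. if j = i then t else z $ j) $ j) =
          (\<chi> j. if j = i then s else z $ j)"
        by (auto simp: vec_eq_iff)
      then show "p s = f (complex_act N \<sigma> (Ln (s / t) / (2 * pi * \<i>)) (u i) y)"
        unfolding y_def complex_act_chart_point p_def by simp
    qed
    then show "p field_differentiable at t within UNIV - {0}"
      by (rule field_differentiable_at_within)
  qed
  then have "p holomorphic_on UNIV"
    by (rule no_isolated_singularity'[where K = "{0}", OF cont]) auto
  then show ?thesis by (simp add: p_def)
qed

text \<open>The torus is dense: zero coordinates are replaced by 1 / (k + 1).\<close>

lemma eq_if_eq_on_torus:
  fixes F G :: "complex ^ 'n \<Rightarrow> complex"
  assumes "continuous_on UNIV F" "continuous_on UNIV G" "\<And>z. (\<And>j. z $ j \<noteq> 0) \<Longrightarrow> F z = G z"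
  shows "F z = G z"
proof -
  define p where "p = (\<lambda>k::nat. \<chi> j. if z $ j = 0 then of_real (inverse (real (Suc k))) else z $ j)"
  have "(\<lambda>k. if z $ j = 0 then of_real (inverse (real (Suc k))) else z $ j) \<longlonglongrightarrow> z $ j" for j
  proof (cases "z $ j = 0")
    case True
    have "(\<lambda>k. of_real (inverse (real (Suc k))) :: complex) \<longlonglongrightarrow> of_real 0"
      by (intro tendsto_of_real LIMSEQ_inverse_real_of_nat)
    then show ?thesis using True by simp
  qed simp
  then have "p \<longlonglongrightarrow> (\<chi> j. z $ j)" unfolding p_def by (rule tendsto_vec_lambda)
  then have p: "p \<longlonglongrightarrow> z" by simp
  have "(\<lambda>k. F (p k)) \<longlonglongrightarrow> F z" "(\<lambda>k. G (p k)) \<longlonglongrightarrow> G z"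
    using assms(1,2) p by (auto intro: continuous_on_tendsto_compose)
  moreover have "F (p k) = G (p k)" for k
    by (rule assms(3)) (auto simp: p_def simp del: of_nat_Suc)
  ultimately show ?thesis using LIMSEQ_unique by simp
qed

text \<open>A witness for \<open>toric_holomorphic\<close> may use only \<open>CARD('n)\<close>
  monomials, while numerator and denominator involve different ones. On a smooth chart all of them
  are polynomials in the coordinates \<open>d i\<close>, which then serve for the quotient.\<close>

lemma toric_holomorphic_divide:
  assumes g: "toric_holomorphic N \<sigma> V g" "\<And>x. x \<in> V \<Longrightarrow> g x \<noteq> 0"
    and A: "A \<subseteq> toric_monoid N \<sigma>"
  shows "toric_holomorphic N \<sigma> V (\<lambda>x. (\<Sum>a\<in>A. c a * x a) / g x)"
  unfolding toric_holomorphic_def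
proof
  fix x assume "x \<in> V"
  with g(1) show "\<exists>V' (b :: 'n \<Rightarrow> real ^ 'n) W F. openin (top_of_set (affine_toric N \<sigma>)) V' \<and> x \<in> V' \<and> V' \<subseteq> V \<and>
      (\<forall>i. b i \<in> toric_monoid N \<sigma>) \<and> open W \<and> holomorphic_fun F W \<and>
      (\<forall>y\<in>V'. (\<chi> i. y (b i)) \<in> W \<and> (\<Sum>a\<in>A. c a * y a) / g y = F (\<chi> i. y (b i)))"
  proof (rule toric_holomorphicE)
    fix V' W F and b :: "'n \<Rightarrow> real ^ 'n"
    assume V': "openin (top_of_set (affine_toric N \<sigma>)) V'" "x \<in> V'" "V' \<subseteq> V"
      and b: "\<And>i. b i \<in> toric_monoid N \<sigma>" and W: "open W" and F: "holomorphic_fun F W"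
      and bW: "\<And>y. y \<in> V' \<Longrightarrow> (\<chi> i. y (b i)) \<in> W" and gF: "\<And>y. y \<in> V' \<Longrightarrow> g y = F (\<chi> i. y (b i))"
    \<comment> \<open>The polynomial map from the coordinates \<open>d\<close> to the monomials
      \<open>b\<close> in which \<open>g\<close> is given. Below, \<open>W'\<close> also excludes
      the zeros of the denominator.\<close>
    define M where "M = (\<lambda>z :: complex ^ 'n. \<chi> i. \<Prod>j\<in>UNIV. z $ j ^ expo (b i) j)"
    define W' where "W' = M -` (W \<inter> F -` (- {0}))"
    define F' where "F' = (\<lambda>z. (\<Sum>a\<in>A. c a * (\<Prod>j\<in>UNIV. z $ j ^ expo a j)) / F (M z))"
    have M: "M (\<chi> i. y (d i)) = (\<chi> i. y (b i))" if "y \<in> V'" for y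
    proof -
      have "y \<in> affine_toric N \<sigma>" using V'(1) that openin_imp_subset by blast
      then have "y (b i) = (\<Prod>j\<in>UNIV. y (d j) ^ expo (b i) j)" for i using b by (rule affine_toric_apply)
      then show ?thesis by (simp add: M_def)
    qed
    define mono' where "mono' = (\<lambda>(k :: 'n \<Rightarrow> nat) (z :: complex ^ 'n) (v :: complex ^ 'n).
      \<Sum>j\<in>UNIV. (of_nat (k j) * v $ j * z $ j ^ (k j - 1)) * (\<Prod>l\<in>UNIV - {j}. z $ l ^ k l))"
    have mono: "((\<lambda>z. \<Prod>j\<in>UNIV. z $ j ^ k j) has_derivative mono' k z) (at z)" for k z
    proof -
      have "((\<lambda>z :: complex ^ 'n. z $ j ^ k j) has_derivative (\<lambda>v. of_nat (k j) * v $ j * z $ j ^ (k j - 1))) (at z)" for j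
        by (rule has_derivative_power[OF bounded_linear_imp_has_derivative[OF bounded_linear_vec_nth]])
      then show ?thesis unfolding mono'_def by (intro has_derivative_prod)
    qed
    have mono'_scale: "mono' k z (c *s v) = c * mono' k z v" for k z c v
      by (simp add: mono'_def sum_distrib_left mult_ac)
    have contM: "continuous_on S M" for S
      unfolding M_def by (intro continuous_intros)
    have "open (W \<inter> F -` (- {0}))"
      by (rule continuous_open_preimage[OF holomorphic_fun_continuous_on[OF F] W]) auto
    then have "open W'" unfolding W'_def by (rule open_vimage[OF _ contM])
    moreover have "holomorphic_fun F' W'"
      unfolding holomorphic_fun_def
    proof
      fix z assume z: "z \<in> W'"
      obtain G where G: "(F has_derivative G) (at (M z))" "\<And>c v. G (c *s v) = c * G v"
        using bspec[OF F[unfolded holomorphic_fun_def], of "M z"] z by (auto simp: W'_def)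
      have "(M has_derivative (\<lambda>v. \<chi> i. mono' (expo (b i)) z v)) (at z)"
        unfolding M_def by (rule has_derivative_vec[OF mono])
      then have FM: "((\<lambda>z. F (M z)) has_derivative (\<lambda>v. G (\<chi> i. mono' (expo (b i)) z v))) (at z)"
        using G(1) by (rule has_derivative_compose)
      have "F (M z) \<noteq> 0" using z by (auto simp: W'_def)
      then have "(F' has_derivative (\<lambda>v. - (\<Sum>a\<in>A. c a * (\<Prod>j\<in>UNIV. z $ j ^ expo a j)) *
            (inverse (F (M z)) * G (\<chi> i. mono' (expo (b i)) z v) * inverse (F (M z))) + (\<Sum>a\<in>A. c a * mono' (expo a) z v) / F (M z))) (at z)"
        unfolding F'_def
        by (intro has_derivative_divide has_derivative_sum has_derivative_mult_right mono FM)
      moreover have "(\<chi> i. mono' (expo (b i)) z (k *s v)) = k *s (\<chi> i. mono' (expo (b i)) z v)" for k v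
        by (simp add: mono'_scale vec_eq_iff)
      ultimately show "\<exists>D. (F' has_derivative D) (at z) \<and> (\<forall>c v. D (c *s v) = c * D v)"
        by (intro exI conjI) (assumption, simp add: mono'_scale G(2) algebra_simps divide_inverse sum_distrib_left)
    qed
    moreover have "(\<chi> i. y (d i)) \<in> W' \<and> (\<Sum>a\<in>A. c a * y a) / g y = F' (\<chi> i. y (d i))" if y: "y \<in> V'" for y
    proof -
      have "y \<in> affine_toric N \<sigma>" using V'(1) y openin_imp_subset by blast
      then have "(\<Sum>a\<in>A. c a * y a) = (\<Sum>a\<in>A. c a * (\<Prod>j\<in>UNIV. y (d j) ^ expo a j))"
        using A by (intro sum.cong) (auto simp: affine_toric_apply[of y])
      moreover have "F (\<chi> i. y (b i)) \<noteq> 0" using g(2)[of y] gF[OF y] V'(3) y by auto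
      ultimately show ?thesis using M[OF y] bW[OF y] gF[OF y] by (simp add: W'_def F'_def)
    qed
    ultimately show ?thesis
      using V' dual_basis_mem by (intro exI[of _ V'] exI[of _ d] exI[of _ W'] exI[of _ F'] conjI) auto
  qed
qed

end

section \<open>Transition functions of a linearized orbi-line bundle\<close>

lemma equivariant_isoD:
  assumes "equivariant_iso N \<tau> sc E sc' E' \<psi>"
  shows "x \<in> affine_toric N \<tau> \<Longrightarrow> linear_iso_on sc (fibre E x) sc' (fibre E' x) (\<psi> x)"
    and "(V, e) \<in> frames E \<Longrightarrow> (V', e') \<in> frames E' \<Longrightarrow>
      \<exists>g. toric_holomorphic N \<tau> (V \<inter> V') g \<and> (\<forall>x\<in>V \<inter> V'. \<psi> x (e x) = sc' (g x) (e' x))"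
    and "x \<in> affine_toric N \<tau> \<Longrightarrow> v \<in> fibre E x \<Longrightarrow>
      \<psi> (torus_act N \<tau> \<xi> x) (act E \<xi> x v) = act E' \<xi> x (\<psi> x v)"
proof -
  note * = assms[unfolded equivariant_iso_def]
  show "linear_iso_on sc (fibre E x) sc' (fibre E' x) (\<psi> x)" if "x \<in> affine_toric N \<tau>"
    using bspec[OF conjunct1[OF *] that] .
  show "\<exists>g. toric_holomorphic N \<tau> (V \<inter> V') g \<and> (\<forall>x\<in>V \<inter> V'. \<psi> x (e x) = sc' (g x) (e' x))"
    if "(V, e) \<in> frames E" "(V', e') \<in> frames E'"
    using bspec[OF bspec[OF conjunct1[OF conjunct2[OF *]] that(1), unfolded case_prod_conv] that(2)]
    unfolding case_prod_conv .
  show "\<psi> (torus_act N \<tau> \<xi> x) (act E \<xi> x v) = act E' \<xi> x (\<psi> x v)"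
    if "x \<in> affine_toric N \<tau>" "v \<in> fibre E x"
    using bspec[OF bspec[OF spec[OF conjunct2[OF conjunct2[OF *]]] that(1)] that(2)] .
qed

locale linearized_orbi_bundle =
  fixes \<Sigma> :: "(real ^ 'n::finite) set set"
    and w :: "(real ^ 'n) set \<Rightarrow> nat"
    and sc :: "complex \<Rightarrow> 'v \<Rightarrow> 'v::ab_group_add"
    and L :: "(real ^ 'n) set \<Rightarrow> ('n, 'v) torus_bundle"
    and \<phi> :: "(real ^ 'n) set \<Rightarrow> (real ^ 'n) set \<Rightarrow> 'n point \<Rightarrow> 'v \<Rightarrow> 'v"
    and m :: "(real ^ 'n) set \<Rightarrow> real ^ 'n"
  assumes fan: "weighted_fan \<Sigma> w"
    and vs: "vector_space sc"
    and orbi_bundle: "orbi_line_bundle \<Sigma> w sc L \<phi>"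
    and m_dual: "\<forall>\<sigma>\<in>max_cones \<Sigma>. m \<sigma> \<in> dual_lattice (cone_lattice \<Sigma> w \<sigma>)"
    and m_compat: "\<forall>\<sigma>\<in>max_cones \<Sigma>. \<forall>\<sigma>'\<in>max_cones \<Sigma>. m \<sigma> - m \<sigma>' \<in> orthogonal_comp (\<sigma> \<inter> \<sigma>')"
    and characters: "corresponds_to_characters \<Sigma> w sc L m"
begin

sublocale fibre_space: vector_space sc
  by (rule vs)

abbreviation N :: "(real ^ 'n) set \<Rightarrow> (real ^ 'n) set" where
  "N \<equiv> cone_lattice \<Sigma> w"

abbreviation X :: "(real ^ 'n) set \<Rightarrow> 'n point set" where
  "X \<tau> \<equiv> affine_toric (N \<tau>) \<tau>"

abbreviation proj :: "(real ^ 'n) set \<Rightarrow> 'n point \<Rightarrow> 'n point" where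
  "proj \<tau> \<equiv> toric_map (N \<tau>) \<tau>"

abbreviation unit_point :: "(real ^ 'n) set \<Rightarrow> 'n point" where
  "unit_point \<tau> \<equiv> torus_point (N \<tau>) \<tau> 0 0"

lemma equivariant_bundle: "\<tau> \<in> \<Sigma> \<Longrightarrow> equivariant_line_bundle (N \<tau>) \<tau> sc (L \<tau>)"
  by (rule bspec[OF orbi_bundle[unfolded orbi_line_bundle_def, THEN conjunct1]])

lemma line_bundle: "\<tau> \<in> \<Sigma> \<Longrightarrow> line_bundle (N \<tau>) \<tau> sc (L \<tau>)"
  by (rule equivariant_bundle[unfolded equivariant_line_bundle_def, THEN conjunct1])

lemma fibre_subspace: "\<tau> \<in> \<Sigma> \<Longrightarrow> x \<in> X \<tau> \<Longrightarrow> fibre_space.subspace (fibre (L \<tau>) x)"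
  by (rule conjunct1[OF bspec[OF line_bundle[unfolded line_bundle_def, THEN conjunct1]]])

lemma fibre_scale: "\<tau> \<in> \<Sigma> \<Longrightarrow> x \<in> X \<tau> \<Longrightarrow> v \<in> fibre (L \<tau>) x \<Longrightarrow> sc c v \<in> fibre (L \<tau>) x"
  by (rule fibre_space.subspace_scale[OF fibre_subspace])

lemma ex_frame: "\<tau> \<in> \<Sigma> \<Longrightarrow> x \<in> X \<tau> \<Longrightarrow> \<exists>V e. (V, e) \<in> frames (L \<tau>) \<and> x \<in> V"
proof -
  assume "\<tau> \<in> \<Sigma>" "x \<in> X \<tau>"
  moreover have "(\<Union>(V, e)\<in>frames (L \<tau>). V) = X \<tau>"
    by (rule line_bundle[OF \<open>\<tau> \<in> \<Sigma>\<close>, unfolded line_bundle_def, THEN conjunct2, THEN conjunct1])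
  ultimately have "x \<in> (\<Union>(V, e)\<in>frames (L \<tau>). V)" by simp
  then show ?thesis by force
qed

lemma frame_props:
  assumes "\<tau> \<in> \<Sigma>" "(V, e) \<in> frames (L \<tau>)"
  shows "openin (top_of_set (X \<tau>)) V" "V \<subseteq> X \<tau>" "\<And>x. x \<in> V \<Longrightarrow> e x \<in> fibre (L \<tau>) x" "\<And>x. x \<in> V \<Longrightarrow> e x \<noteq> 0"
proof -
  have "\<forall>(V, e)\<in>frames (L \<tau>). openin (top_of_set (X \<tau>)) V \<and> (\<forall>x\<in>V. e x \<in> fibre (L \<tau>) x \<and> e x \<noteq> 0)"
    by (rule line_bundle[OF assms(1), unfolded line_bundle_def, THEN conjunct2, THEN conjunct2, THEN conjunct1])
  from bspec[OF this assms(2)]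
  show "openin (top_of_set (X \<tau>)) V" "\<And>x. x \<in> V \<Longrightarrow> e x \<in> fibre (L \<tau>) x" "\<And>x. x \<in> V \<Longrightarrow> e x \<noteq> 0"
    by auto
  then show "V \<subseteq> X \<tau>" using openin_imp_subset by blast
qed

lemma act_iso:
  "\<tau> \<in> \<Sigma> \<Longrightarrow> x \<in> X \<tau> \<Longrightarrow>
    linear_iso_on sc (fibre (L \<tau>) x) sc (fibre (L \<tau>) (torus_act (N \<tau>) \<tau> \<xi> x)) (act (L \<tau>) \<xi> x)"
  by (rule equivariant_bundle[unfolded equivariant_line_bundle_def, THEN conjunct2, THEN conjunct1,
        THEN spec, THEN bspec])

lemma linear_iso_onD:
  assumes "linear_iso_on s A s' B f"
  shows "bij_betw f A B" "\<And>v. v \<in> A \<Longrightarrow> f v \<in> B" "\<And>c v. v \<in> A \<Longrightarrow> f (s c v) = s' c (f v)"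
  using assms by (auto simp: linear_iso_on_def bij_betw_def)

subsection \<open>Trivializations over maximal cones\<close>

definition \<theta> :: "(real ^ 'n) set \<Rightarrow> 'n point \<Rightarrow> 'v \<Rightarrow> complex" where
  "\<theta> \<sigma> = (SOME \<theta>. equivariant_iso (N \<sigma>) \<sigma> sc (L \<sigma>) (*) (character_bundle (N \<sigma>) \<sigma> (m \<sigma>)) \<theta>)"

lemma \<theta>_iso: "\<sigma> \<in> max_cones \<Sigma> \<Longrightarrow>
    equivariant_iso (N \<sigma>) \<sigma> sc (L \<sigma>) (*) (character_bundle (N \<sigma>) \<sigma> (m \<sigma>)) (\<theta> \<sigma>)"
  unfolding \<theta>_def by (rule someI_ex[OF bspec[OF characters[unfolded corresponds_to_characters_def]]])

lemma \<theta>_linear: "\<sigma> \<in> max_cones \<Sigma> \<Longrightarrow> x \<in> X \<sigma> \<Longrightarrow> linear_iso_on sc (fibre (L \<sigma>) x) (*) UNIV (\<theta> \<sigma> x)"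
  using equivariant_isoD(1)[OF \<theta>_iso] by (simp add: character_bundle_def)

lemma \<theta>_scale: "\<sigma> \<in> max_cones \<Sigma> \<Longrightarrow> x \<in> X \<sigma> \<Longrightarrow> v \<in> fibre (L \<sigma>) x \<Longrightarrow> \<theta> \<sigma> x (sc c v) = c * \<theta> \<sigma> x v"
  by (rule linear_iso_onD(3)[OF \<theta>_linear])

lemma \<theta>_inj: "\<sigma> \<in> max_cones \<Sigma> \<Longrightarrow> x \<in> X \<sigma> \<Longrightarrow> v \<in> fibre (L \<sigma>) x \<Longrightarrow> v' \<in> fibre (L \<sigma>) x \<Longrightarrow>
    \<theta> \<sigma> x v = \<theta> \<sigma> x v' \<Longrightarrow> v = v'"
  by (rule inj_onD[OF bij_betw_imp_inj_on[OF linear_iso_onD(1)[OF \<theta>_linear]]])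

lemma \<theta>_act: "\<sigma> \<in> max_cones \<Sigma> \<Longrightarrow> x \<in> X \<sigma> \<Longrightarrow> v \<in> fibre (L \<sigma>) x \<Longrightarrow>
    \<theta> \<sigma> (torus_act (N \<sigma>) \<sigma> \<xi> x) (act (L \<sigma>) \<xi> x v) = char_val (m \<sigma>) \<xi> * \<theta> \<sigma> x v"
  using equivariant_isoD(3)[OF \<theta>_iso] by (simp add: character_bundle_def)

text \<open>The trivializing section of weight \<open>m \<sigma>\<close>, as the preimage of the
  constant 1. It is defined pointwise; its holomorphy is expressed by comparison with the
  frames.\<close>

definition triv :: "(real ^ 'n) set \<Rightarrow> 'n point \<Rightarrow> 'v" where
  "triv \<sigma> x = inv_into (fibre (L \<sigma>) x) (\<theta> \<sigma> x) 1"

lemma triv: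
  assumes "\<sigma> \<in> max_cones \<Sigma>" "x \<in> X \<sigma>"
  shows triv_mem: "triv \<sigma> x \<in> fibre (L \<sigma>) x" and \<theta>_triv: "\<theta> \<sigma> x (triv \<sigma> x) = 1"
proof -
  have "1 \<in> \<theta> \<sigma> x ` fibre (L \<sigma>) x"
    using linear_iso_onD(1)[OF \<theta>_linear[OF assms]] by (auto simp: bij_betw_def)
  then show "triv \<sigma> x \<in> fibre (L \<sigma>) x" "\<theta> \<sigma> x (triv \<sigma> x) = 1"
    unfolding triv_def by (rule inv_into_into, rule f_inv_into_f[of 1])
qed

lemma scale_triv_mem: "\<sigma> \<in> max_cones \<Sigma> \<Longrightarrow> x \<in> X \<sigma> \<Longrightarrow> sc c (triv \<sigma> x) \<in> fibre (L \<sigma>) x"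
  by (rule fibre_scale[OF max_cone_imp_cone _ triv_mem])

lemma \<theta>_scale_triv: "\<sigma> \<in> max_cones \<Sigma> \<Longrightarrow> x \<in> X \<sigma> \<Longrightarrow> \<theta> \<sigma> x (sc c (triv \<sigma> x)) = c"
  using \<theta>_scale[OF _ _ triv_mem] \<theta>_triv by simp

lemma scale_\<theta>_triv:
  assumes "\<sigma> \<in> max_cones \<Sigma>" "x \<in> X \<sigma>" "v \<in> fibre (L \<sigma>) x"
  shows "sc (\<theta> \<sigma> x v) (triv \<sigma> x) = v"
  by (rule \<theta>_inj[OF assms(1,2) scale_triv_mem[OF assms(1,2)] assms(3) \<theta>_scale_triv[OF assms(1,2)]])

lemma triv_nonzero: "\<sigma> \<in> max_cones \<Sigma> \<Longrightarrow> x \<in> X \<sigma> \<Longrightarrow> triv \<sigma> x \<noteq> 0"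
proof
  assume *: "\<sigma> \<in> max_cones \<Sigma>" "x \<in> X \<sigma>" and "triv \<sigma> x = 0"
  then have "\<theta> \<sigma> x (sc 0 (triv \<sigma> x)) = \<theta> \<sigma> x (triv \<sigma> x)" by simp
  then show False using \<theta>_scale_triv[OF *, of 0] \<theta>_triv[OF *] by simp
qed

lemma act_scale_triv:
  assumes "\<sigma> \<in> max_cones \<Sigma>" "x \<in> X \<sigma>"
  shows "act (L \<sigma>) \<xi> x (sc c (triv \<sigma> x)) = sc (c * char_val (m \<sigma>) \<xi>) (triv \<sigma> (torus_act (N \<sigma>) \<sigma> \<xi> x))"
proof -
  have "act (L \<sigma>) \<xi> x (sc c (triv \<sigma> x)) \<in> fibre (L \<sigma>) (torus_act (N \<sigma>) \<sigma> \<xi> x)"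
    by (rule linear_iso_onD(2)[OF act_iso[OF max_cone_imp_cone[OF assms(1)] assms(2)] scale_triv_mem[OF assms]])
  from scale_\<theta>_triv[OF assms(1) torus_act_mem[OF assms(2)] this] show ?thesis
    by (simp add: \<theta>_act[OF assms scale_triv_mem[OF assms]] \<theta>_scale_triv[OF assms] mult.commute)
qed

text \<open>The character bundle has the constant 1 as its frame, so the holomorphic function
  provided by the isomorphism for the pair of frames is the coefficient of \<open>e\<close>.\<close>

lemma frame_eq_scale_triv:
  assumes "\<sigma> \<in> max_cones \<Sigma>" "(V, e) \<in> frames (L \<sigma>)"
  shows "\<exists>g. toric_holomorphic (N \<sigma>) \<sigma> V g \<and> (\<forall>x\<in>V. e x = sc (g x) (triv \<sigma> x) \<and> g x \<noteq> 0)"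
proof -
  note fr = frame_props[OF max_cone_imp_cone[OF assms(1)] assms(2)]
  have "(X \<sigma>, \<lambda>x. 1) \<in> frames (character_bundle (N \<sigma>) \<sigma> (m \<sigma>))"
    by (simp add: character_bundle_def)
  from equivariant_isoD(2)[OF \<theta>_iso[OF assms(1)] assms(2) this] obtain g where
    g: "toric_holomorphic (N \<sigma>) \<sigma> (V \<inter> X \<sigma>) g" "\<And>x. x \<in> V \<inter> X \<sigma> \<Longrightarrow> \<theta> \<sigma> x (e x) = g x"
    by auto
  have V: "V \<inter> X \<sigma> = V" using fr(2) by blast
  have "e x = sc (g x) (triv \<sigma> x) \<and> g x \<noteq> 0" if "x \<in> V" for x
  proof -
    have x: "x \<in> X \<sigma>" using that fr(2) by blast
    have "e x = sc (g x) (triv \<sigma> x)"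
      using scale_\<theta>_triv[OF assms(1) x fr(3)[OF that]] g(2)[of x] that x by simp
    moreover from this have "g x \<noteq> 0" using fr(4)[OF that] by auto
    ultimately show ?thesis by blast
  qed
  then show ?thesis using g(1) unfolding V by blast
qed

subsection \<open>Restriction to smaller cones\<close>

lemma restriction_iso:
  assumes "\<tau> \<in> \<Sigma>" "\<sigma> \<in> \<Sigma>" "\<tau> \<subseteq> \<sigma>"
  shows "equivariant_iso (N \<tau>) \<tau> sc (pullback_bundle (N \<tau>) \<tau> (N \<sigma>) \<sigma> (L \<sigma>)) sc (L \<tau>) (\<phi> \<tau> \<sigma>)"
  by (rule orbi_bundle[unfolded orbi_line_bundle_def, THEN conjunct2, THEN conjunct1, rule_format,
        OF assms(2,1,3)])

lemma proj_mem: "\<tau> \<subseteq> \<sigma> \<Longrightarrow> x \<in> X \<tau> \<Longrightarrow> proj \<sigma> x \<in> X \<sigma>"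
  by (rule toric_map_mem[OF cone_lattice_mono])

lemma proj_torus_act: "\<tau> \<subseteq> \<sigma> \<Longrightarrow> proj \<sigma> (torus_act (N \<tau>) \<tau> \<xi> x) = torus_act (N \<sigma>) \<sigma> \<xi> (proj \<sigma> x)"
  by (simp add: toric_map_torus_act cone_lattice_mono)

lemma proj_torus_point: "\<tau> \<subseteq> \<sigma> \<Longrightarrow> proj \<sigma> (torus_point (N \<tau>) \<tau> \<xi> \<eta>) = torus_point (N \<sigma>) \<sigma> \<xi> \<eta>"
  by (simp add: toric_map_torus_point cone_lattice_mono)

lemma restriction_linear:
  assumes "\<tau> \<in> \<Sigma>" "\<sigma> \<in> \<Sigma>" "\<tau> \<subseteq> \<sigma>" "x \<in> X \<tau>"
  shows "linear_iso_on sc (fibre (L \<sigma>) (proj \<sigma> x)) sc (fibre (L \<tau>) x) (\<phi> \<tau> \<sigma> x)"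
  using equivariant_isoD(1)[OF restriction_iso[OF assms(1-3)] assms(4)] by (simp add: pullback_bundle_def)

text \<open>The trivializing section of \<sigma> transported to the chart of the smaller cone
  \<tau>.\<close>

definition triv_on :: "(real ^ 'n) set \<Rightarrow> (real ^ 'n) set \<Rightarrow> 'n point \<Rightarrow> 'v" where
  "triv_on \<tau> \<sigma> x = \<phi> \<tau> \<sigma> x (triv \<sigma> (proj \<sigma> x))"

context
  fixes \<tau> \<sigma>
  assumes \<tau>: "\<tau> \<in> \<Sigma>" and \<sigma>: "\<sigma> \<in> max_cones \<Sigma>" and \<tau>\<sigma>: "\<tau> \<subseteq> \<sigma>"
begin

lemma restriction_scale_triv:
  assumes "x \<in> X \<tau>"
  shows "\<phi> \<tau> \<sigma> x (sc c (triv \<sigma> (proj \<sigma> x))) = sc c (triv_on \<tau> \<sigma> x)"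
  unfolding triv_on_def
  by (rule linear_iso_onD(3)[OF restriction_linear[OF \<tau> max_cone_imp_cone[OF \<sigma>] \<tau>\<sigma> assms]
        triv_mem[OF \<sigma> proj_mem[OF \<tau>\<sigma> assms]]])

lemma triv_on_mem:
  assumes "x \<in> X \<tau>"
  shows "triv_on \<tau> \<sigma> x \<in> fibre (L \<tau>) x"
  unfolding triv_on_def
  by (rule linear_iso_onD(2)[OF restriction_linear[OF \<tau> max_cone_imp_cone[OF \<sigma>] \<tau>\<sigma> assms]
        triv_mem[OF \<sigma> proj_mem[OF \<tau>\<sigma> assms]]])

lemma fibre_eq_scale_triv_on:
  assumes x: "x \<in> X \<tau>" and v: "v \<in> fibre (L \<tau>) x"
  shows "\<exists>c. v = sc c (triv_on \<tau> \<sigma> x)"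
proof -
  have "v \<in> \<phi> \<tau> \<sigma> x ` fibre (L \<sigma>) (proj \<sigma> x)"
    using linear_iso_onD(1)[OF restriction_linear[OF \<tau> max_cone_imp_cone[OF \<sigma>] \<tau>\<sigma> x]] v
    by (simp add: bij_betw_def)
  then obtain v' where "v' \<in> fibre (L \<sigma>) (proj \<sigma> x)" "v = \<phi> \<tau> \<sigma> x v'" by blast
  then show ?thesis
    using scale_\<theta>_triv[OF \<sigma> proj_mem[OF \<tau>\<sigma> x]] restriction_scale_triv[OF x] by metis
qed

lemma triv_on_nonzero:
  assumes x: "x \<in> X \<tau>"
  shows "triv_on \<tau> \<sigma> x \<noteq> 0"
proof
  assume 0: "triv_on \<tau> \<sigma> x = 0"
  have eq: "\<phi> \<tau> \<sigma> x (sc 0 (triv \<sigma> (proj \<sigma> x))) = \<phi> \<tau> \<sigma> x (sc 1 (triv \<sigma> (proj \<sigma> x)))"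
    unfolding restriction_scale_triv[OF x] 0 by simp
  have "sc 0 (triv \<sigma> (proj \<sigma> x)) = sc 1 (triv \<sigma> (proj \<sigma> x))"
    using linear_iso_onD(1)[OF restriction_linear[OF \<tau> max_cone_imp_cone[OF \<sigma>] \<tau>\<sigma> x]]
      eq scale_triv_mem[OF \<sigma> proj_mem[OF \<tau>\<sigma> x]]
    unfolding bij_betw_def by (meson inj_onD)
  then show False using triv_nonzero[OF \<sigma> proj_mem[OF \<tau>\<sigma> x]] by simp
qed

lemma act_triv_on:
  assumes x: "x \<in> X \<tau>"
  shows "act (L \<tau>) \<xi> x (triv_on \<tau> \<sigma> x) = sc (char_val (m \<sigma>) \<xi>) (triv_on \<tau> \<sigma> (torus_act (N \<tau>) \<tau> \<xi> x))"
proof -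
  have "triv \<sigma> (proj \<sigma> x) \<in> fibre (pullback_bundle (N \<tau>) \<tau> (N \<sigma>) \<sigma> (L \<sigma>)) x"
    using triv_mem[OF \<sigma> proj_mem[OF \<tau>\<sigma> x]] by (simp add: pullback_bundle_def)
  from equivariant_isoD(3)[OF restriction_iso[OF \<tau> max_cone_imp_cone[OF \<sigma>] \<tau>\<sigma>] x this, of \<xi>]
  have "act (L \<tau>) \<xi> x (triv_on \<tau> \<sigma> x) =
      \<phi> \<tau> \<sigma> (torus_act (N \<tau>) \<tau> \<xi> x) (act (L \<sigma>) \<xi> (proj \<sigma> x) (triv \<sigma> (proj \<sigma> x)))"
    by (simp add: triv_on_def pullback_bundle_def)
  also have "act (L \<sigma>) \<xi> (proj \<sigma> x) (triv \<sigma> (proj \<sigma> x)) =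
      sc (char_val (m \<sigma>) \<xi>) (triv \<sigma> (proj \<sigma> (torus_act (N \<tau>) \<tau> \<xi> x)))"
    using act_scale_triv[OF \<sigma> proj_mem[OF \<tau>\<sigma> x], of \<xi> 1] by (simp add: proj_torus_act[OF \<tau>\<sigma>])
  finally show ?thesis using restriction_scale_triv[OF torus_act_mem[OF x]] by simp
qed

text \<open>Two comparisons of frames are combined: \<open>g1\<close> relates a frame over the chart
  of \<sigma> to the trivializing section, and \<open>g2\<close> relates its pullback to the frame
  \<open>e\<close> over the chart of \<tau>. The ratio need not be visibly of the form required by
  \<open>toric_holomorphic\<close>, but it is holomorphic along orbits.\<close>

lemma triv_on_local:
  assumes x: "x \<in> X \<tau>" and Ve: "(V, e) \<in> frames (L \<tau>)" "x \<in> V"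
  shows "\<exists>V' q. openin (top_of_set (X \<tau>)) V' \<and> x \<in> V' \<and> orbit_holomorphic (N \<tau>) \<tau> V' q \<and>
    (\<forall>y\<in>V'. triv_on \<tau> \<sigma> y = sc (q y) (e y) \<and> q y \<noteq> 0)"
proof -
  obtain V1 e1 where V1: "(V1, e1) \<in> frames (L \<sigma>)" "proj \<sigma> x \<in> V1"
    using ex_frame[OF max_cone_imp_cone[OF \<sigma>] proj_mem[OF \<tau>\<sigma> x]] by blast
  obtain g1 where g1: "toric_holomorphic (N \<sigma>) \<sigma> V1 g1"
    "\<forall>y\<in>V1. e1 y = sc (g1 y) (triv \<sigma> y) \<and> g1 y \<noteq> 0"
    using frame_eq_scale_triv[OF \<sigma> V1(1)] by blast
  define V2 where "V2 = {y \<in> X \<tau>. proj \<sigma> y \<in> V1}"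
  have "(V2, \<lambda>y. e1 (proj \<sigma> y)) \<in> frames (pullback_bundle (N \<tau>) \<tau> (N \<sigma>) \<sigma> (L \<sigma>))"
    using V1(1) by (force simp: pullback_bundle_def V2_def)
  from equivariant_isoD(2)[OF restriction_iso[OF \<tau> max_cone_imp_cone[OF \<sigma>] \<tau>\<sigma>] this Ve(1)]
  obtain g2 where g2: "toric_holomorphic (N \<tau>) \<tau> (V2 \<inter> V) g2"
    "\<forall>y\<in>V2 \<inter> V. \<phi> \<tau> \<sigma> y (e1 (proj \<sigma> y)) = sc (g2 y) (e y)"
    by blast
  define q where "q = (\<lambda>y. g2 y / g1 (proj \<sigma> y))"
  obtain T where T: "open T" "V1 = X \<sigma> \<inter> T"
    using frame_props(1)[OF max_cone_imp_cone[OF \<sigma>] V1(1)] by (auto simp: openin_open)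
  have "V2 = X \<tau> \<inter> proj \<sigma> -` T"
    unfolding V2_def T(2) using proj_mem[OF \<tau>\<sigma>] by blast
  then have "openin (top_of_set (X \<tau>)) V2"
    using continuous_openin_preimage_gen[OF continuous_on_toric_map T(1)] by simp
  then have "openin (top_of_set (X \<tau>)) (V2 \<inter> V)"
    using frame_props(1)[OF \<tau> Ve(1)] by (rule openin_Int)
  moreover have "x \<in> V2 \<inter> V" using x V1(2) Ve(2) by (simp add: V2_def)
  moreover have "orbit_holomorphic (N \<tau>) \<tau> (V2 \<inter> V) q"
    unfolding q_def
  proof (rule orbit_holomorphic_divide)
    show "orbit_holomorphic (N \<tau>) \<tau> (V2 \<inter> V) g2"
      using toric_holomorphic_imp_orbit_holomorphic[OF g2(1)] .
    have "orbit_holomorphic (N \<tau>) \<tau> {y. proj \<sigma> y \<in> V1} (\<lambda>y. g1 (proj \<sigma> y))"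
      by (rule orbit_holomorphic_toric_map[OF toric_holomorphic_imp_orbit_holomorphic[OF g1(1)]
            cone_lattice_mono[OF \<tau>\<sigma>] \<tau>\<sigma>])
    then show "orbit_holomorphic (N \<tau>) \<tau> (V2 \<inter> V) (\<lambda>y. g1 (proj \<sigma> y))"
      by (rule orbit_holomorphic_subset) (auto simp: V2_def)
    show "g1 (proj \<sigma> y) \<noteq> 0" if "y \<in> V2 \<inter> V" for y
      using that g1(2) by (simp add: V2_def)
  qed
  moreover have "triv_on \<tau> \<sigma> y = sc (q y) (e y) \<and> q y \<noteq> 0" if y: "y \<in> V2 \<inter> V" for y
  proof -
    have yX: "y \<in> X \<tau>" and g1y: "g1 (proj \<sigma> y) \<noteq> 0" "e1 (proj \<sigma> y) = sc (g1 (proj \<sigma> y)) (triv \<sigma> (proj \<sigma> y))"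
      using y g1(2) by (auto simp: V2_def)
    have "sc (g1 (proj \<sigma> y)) (triv_on \<tau> \<sigma> y) = sc (g2 y) (e y)"
      using g2(2) y g1y(2) restriction_scale_triv[OF yX] by metis
    then have "sc (1 / g1 (proj \<sigma> y)) (sc (g1 (proj \<sigma> y)) (triv_on \<tau> \<sigma> y)) = sc (q y) (e y)"
      by (simp add: q_def)
    then have "triv_on \<tau> \<sigma> y = sc (q y) (e y)" using g1y(1) by simp
    moreover from this have "q y \<noteq> 0" using triv_on_nonzero[OF yX] by auto
    ultimately show ?thesis by blast
  qed
  ultimately show ?thesis by (intro exI[of _ "V2 \<inter> V"] exI[of _ q]) simp
qed

end

section \<open>Comparison of two trivializations on a common chart\<close>

lemma scale_eq_scaleD: "sc a v = sc b v \<Longrightarrow> v \<noteq> 0 \<Longrightarrow> a = b"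
  by simp

text \<open>Full rank of the lattice: it contains a positive multiple of each axis vector.\<close>

lemma cone_lattice_separates:
  "\<exists>v :: 'n \<Rightarrow> real ^ 'n. (\<forall>i. v i \<in> N \<tau>) \<and> (\<forall>a. (\<forall>i. a \<bullet> v i = 0) \<longrightarrow> a = 0)"
proof -
  obtain D :: nat where D: "0 < D" "\<forall>\<tau>. \<forall>v\<in>std_lattice. real D *\<^sub>R v \<in> N \<tau>"
    using cone_lattice_multiple[OF fan] by blast
  have "axis i 1 \<in> std_lattice" for i :: 'n by (auto simp: std_lattice_def axis_def)
  moreover have "a = 0" if "\<forall>i. a \<bullet> (real D *\<^sub>R axis i 1) = 0" for a :: "real ^ 'n"
    using that D(1) by (simp add: inner_axis vec_eq_iff)
  ultimately show ?thesis using D(2) by (intro exI[of _ "\<lambda>i. real D *\<^sub>R axis i 1"]) blast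
qed

text \<open>Integrality holds because the lattice of the intersection lies in both lattices,
  nonnegativity because the difference annihilates the intersection. By symmetry the negative is an
  exponent too, so the monomial is invertible.\<close>

lemma m_diff_mem:
  assumes \<sigma>: "\<sigma> \<in> max_cones \<Sigma>" and \<sigma>': "\<sigma>' \<in> max_cones \<Sigma>"
  shows "m \<sigma> - m \<sigma>' \<in> toric_monoid (N (\<sigma> \<inter> \<sigma>')) (\<sigma> \<inter> \<sigma>')"
proof -
  have "(m \<sigma> - m \<sigma>') \<bullet> v = 0" if "v \<in> \<sigma> \<inter> \<sigma>'" for v
    using m_compat \<sigma> \<sigma>' that by (auto simp: orthogonal_comp_def orthogonal_def inner_commute)
  moreover have "(m \<sigma> - m \<sigma>') \<bullet> v \<in> \<int>" if v: "v \<in> N (\<sigma> \<inter> \<sigma>')" for v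
  proof -
    have "v \<in> N \<sigma>" "v \<in> N \<sigma>'"
      using v cone_lattice_mono[of "\<sigma> \<inter> \<sigma>'" \<sigma>] cone_lattice_mono[of "\<sigma> \<inter> \<sigma>'" \<sigma>'] by blast+
    then show ?thesis using m_dual \<sigma> \<sigma>' by (auto simp: dual_lattice_def inner_diff_left)
  qed
  ultimately show ?thesis by (auto simp: toric_monoid_def dual_lattice_def dual_cone_def)
qed

text \<open>The ratio \<open>H\<close> of the two trivializations and the monomial of exponent
  \<open>m \<sigma> - m \<sigma>'\<close> transform by the same character, so their quotient is
  invariant under the real torus and therefore constant.\<close>

lemma transition_const:
  assumes \<sigma>: "\<sigma> \<in> max_cones \<Sigma>" and \<sigma>': "\<sigma>' \<in> max_cones \<Sigma>"
  defines "\<tau> \<equiv> \<sigma> \<inter> \<sigma>'"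
  shows "\<exists>c. c \<noteq> 0 \<and> (\<forall>x\<in>X \<tau>. triv_on \<tau> \<sigma> x = sc (c * x (m \<sigma> - m \<sigma>')) (triv_on \<tau> \<sigma>' x))"
proof -
  have \<tau>: "\<tau> \<in> \<Sigma>" unfolding \<tau>_def using fan_Int[OF fan] \<sigma> \<sigma>' max_cone_imp_cone by blast
  have sub: "\<tau> \<subseteq> \<sigma>" "\<tau> \<subseteq> \<sigma>'" by (auto simp: \<tau>_def)
  define H where "H = (\<lambda>x. SOME c. triv_on \<tau> \<sigma> x = sc c (triv_on \<tau> \<sigma>' x))"
  have H: "triv_on \<tau> \<sigma> x = sc (H x) (triv_on \<tau> \<sigma>' x)" if "x \<in> X \<tau>" for x
    unfolding H_def
    by (rule someI_ex[OF fibre_eq_scale_triv_on[OF \<tau> \<sigma>' sub(2) that triv_on_mem[OF \<tau> \<sigma> sub(1) that]]])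
  \<comment> \<open>Both trivializations are expressed in one frame \<open>e\<close> of the bundle
    over the common chart; locally \<open>H\<close> is the ratio of their coefficients.\<close>
  have Hhol: "orbit_holomorphic (N \<tau>) \<tau> (X \<tau>) H"
  proof (rule orbit_holomorphic_local)
    fix x assume x: "x \<in> X \<tau>"
    obtain V e where Ve: "(V, e) \<in> frames (L \<tau>)" "x \<in> V" using ex_frame[OF \<tau> x] by blast
    obtain V1 q1 where 1: "openin (top_of_set (X \<tau>)) V1" "x \<in> V1" "orbit_holomorphic (N \<tau>) \<tau> V1 q1"
      "\<forall>y\<in>V1. triv_on \<tau> \<sigma> y = sc (q1 y) (e y) \<and> q1 y \<noteq> 0"
      using triv_on_local[OF \<tau> \<sigma> sub(1) x Ve] by auto
    obtain V2 q2 where 2: "openin (top_of_set (X \<tau>)) V2" "x \<in> V2" "orbit_holomorphic (N \<tau>) \<tau> V2 q2"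
      "\<forall>y\<in>V2. triv_on \<tau> \<sigma>' y = sc (q2 y) (e y) \<and> q2 y \<noteq> 0"
      using triv_on_local[OF \<tau> \<sigma>' sub(2) x Ve] by auto
    have "orbit_holomorphic (N \<tau>) \<tau> (V1 \<inter> V2) (\<lambda>y. q1 y / q2 y)"
      by (rule orbit_holomorphic_divide[OF orbit_holomorphic_subset[OF 1(3)] orbit_holomorphic_subset[OF 2(3)]])
        (use 2(4) in auto)
    moreover have "H y = q1 y / q2 y" if y: "y \<in> V1 \<inter> V2" for y
    proof -
      have yX: "y \<in> X \<tau>" using y 1(1) openin_imp_subset by blast
      have q: "triv_on \<tau> \<sigma> y = sc (q1 y) (e y)" "triv_on \<tau> \<sigma>' y = sc (q2 y) (e y)" "q2 y \<noteq> 0"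
        using y 1(4) 2(4) by auto
      have "sc (q1 y) (e y) = sc (H y * q2 y) (e y)"
        using H[OF yX] unfolding q(1,2) by (simp only: fibre_space.scale_scale)
      moreover have "e y \<noteq> 0" using triv_on_nonzero[OF \<tau> \<sigma> sub(1) yX] q(1) by auto
      ultimately have "q1 y = H y * q2 y" by (rule scale_eq_scaleD)
      then show ?thesis using q(3) by simp
    qed
    moreover have "openin (top_of_set (X \<tau>)) (V1 \<inter> V2)" using 1(1) 2(1) by (rule openin_Int)
    ultimately show "\<exists>V' g. openin (top_of_set (X \<tau>)) V' \<and> x \<in> V' \<and> orbit_holomorphic (N \<tau>) \<tau> V' g \<and>
        (\<forall>y\<in>V'. H y = g y)"
      using 1(2) 2(2) by (intro exI[of _ "V1 \<inter> V2"] exI[of _ "\<lambda>y. q1 y / q2 y"]) simp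
  qed simp
  have Hact: "H (torus_act (N \<tau>) \<tau> \<xi> x) = char_val (m \<sigma>' - m \<sigma>) \<xi> * H x" if x: "x \<in> X \<tau>" for \<xi> x
  proof -
    define y where "y = torus_act (N \<tau>) \<tau> \<xi> x"
    have y: "y \<in> X \<tau>" unfolding y_def by (rule torus_act_mem[OF x])
    have "act (L \<tau>) \<xi> x (sc (H x) (triv_on \<tau> \<sigma>' x)) = sc (H x) (act (L \<tau>) \<xi> x (triv_on \<tau> \<sigma>' x))"
      by (rule linear_iso_onD(3)[OF act_iso[OF \<tau> x] triv_on_mem[OF \<tau> \<sigma>' sub(2) x]])
    then have "sc (char_val (m \<sigma>) \<xi>) (triv_on \<tau> \<sigma> y) = sc (H x * char_val (m \<sigma>') \<xi>) (triv_on \<tau> \<sigma>' y)"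
      using act_triv_on[OF \<tau> \<sigma> sub(1) x, of \<xi>] act_triv_on[OF \<tau> \<sigma>' sub(2) x, of \<xi>] H[OF x]
      by (simp add: y_def)
    then have "sc (char_val (m \<sigma>) \<xi> * H y) (triv_on \<tau> \<sigma>' y) = sc (H x * char_val (m \<sigma>') \<xi>) (triv_on \<tau> \<sigma>' y)"
      using H[OF y] by simp
    then have "char_val (m \<sigma>) \<xi> * H y = H x * char_val (m \<sigma>') \<xi>"
      using triv_on_nonzero[OF \<tau> \<sigma>' sub(2) y] by (rule scale_eq_scaleD)
    moreover have "char_val (m \<sigma>') \<xi> = char_val (m \<sigma>' - m \<sigma>) \<xi> * char_val (m \<sigma>) \<xi>"
      by (simp flip: char_val_add_left)
    ultimately show ?thesis by (simp add: y_def)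
  qed
  have mM: "m \<sigma> - m \<sigma>' \<in> toric_monoid (N \<tau>) \<tau>" "m \<sigma>' - m \<sigma> \<in> toric_monoid (N \<tau>) \<tau>"
    using m_diff_mem[OF \<sigma> \<sigma>'] m_diff_mem[OF \<sigma>' \<sigma>] by (auto simp: \<tau>_def Int_commute)
  have xm: "x (m \<sigma> - m \<sigma>') \<noteq> 0" if "x \<in> X \<tau>" for x
    using affine_toric_add[OF that mM] affine_toric_zero[OF that] by auto
  define h where "h = (\<lambda>x. H x / x (m \<sigma> - m \<sigma>'))"
  have "orbit_holomorphic (N \<tau>) \<tau> (X \<tau>) h"
    unfolding h_def proof (rule orbit_holomorphic_divide)
    show "orbit_holomorphic (N \<tau>) \<tau> (X \<tau>) H" by (rule Hhol)
    show "orbit_holomorphic (N \<tau>) \<tau> (X \<tau>) (\<lambda>x. x (m \<sigma> - m \<sigma>'))"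
      by (rule orbit_holomorphic_monomial[OF mM(1)])
  qed (rule xm)
  moreover have "h (torus_act (N \<tau>) \<tau> \<xi> x) = h x" if x: "x \<in> X \<tau>" for x \<xi>
  proof -
    have "torus_act (N \<tau>) \<tau> \<xi> x (m \<sigma> - m \<sigma>') = char_val (m \<sigma>' - m \<sigma>) \<xi> * x (m \<sigma> - m \<sigma>')"
      using mM(1) by (simp add: torus_act_def char_val_def inner_diff_left right_diff_distrib)
    then show ?thesis by (simp add: h_def Hact[OF x])
  qed
  moreover obtain \<kappa> where "\<kappa> \<in> \<tau>" "\<forall>a\<in>dual_cone \<tau>. a \<bullet> \<kappa> = 0 \<longrightarrow> (\<forall>y\<in>\<tau>. a \<bullet> y = 0)"
    using fan_cone_ex_rel_interior[OF fan \<tau>] by blast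
  moreover obtain v :: "'n \<Rightarrow> real ^ 'n" where "\<forall>i. v i \<in> N \<tau>" "\<forall>a. (\<forall>i. a \<bullet> v i = 0) \<longrightarrow> a = 0"
    using cone_lattice_separates by blast
  ultimately have h: "h x = h (unit_point \<tau>)" if "x \<in> X \<tau>" for x
    using orbit_holomorphic_invariant_const[of "N \<tau>" \<tau> h \<kappa> v x] that by blast
  have "H x \<noteq> 0" if "x \<in> X \<tau>" for x
    using triv_on_nonzero[OF \<tau> \<sigma> sub(1) that] H[OF that] by auto
  then have "h (unit_point \<tau>) \<noteq> 0"
    using xm torus_point_mem[of "N \<tau>" \<tau> 0 0] by (simp add: h_def)
  moreover have "triv_on \<tau> \<sigma> x = sc (h (unit_point \<tau>) * x (m \<sigma> - m \<sigma>')) (triv_on \<tau> \<sigma>' x)" if "x \<in> X \<tau>" for x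
  proof -
    have "h (unit_point \<tau>) * x (m \<sigma> - m \<sigma>') = H x"
      unfolding h[OF that, symmetric] using xm[OF that] by (simp add: h_def)
    then show ?thesis using H[OF that] by simp
  qed
  ultimately show ?thesis by blast
qed

text \<open>The trivialization of \<sigma> relative to that of a fixed maximal cone, at the unit
  point of the torus. After division by these scalars the trivializations differ by pure
  monomials.\<close>

definition unit_scalar :: "(real ^ 'n) set \<Rightarrow> complex" where
  "unit_scalar \<sigma> = (SOME c. triv_on {0} \<sigma> (unit_point {0}) =
     sc c (triv_on {0} (SOME \<sigma>. \<sigma> \<in> max_cones \<Sigma>) (unit_point {0})))"

lemma ex_max_cone: "\<exists>\<sigma>. \<sigma> \<in> max_cones \<Sigma>"
  using Union_max_cones[OF fan] by blast

lemma unit_scalar_props: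
  assumes \<sigma>: "\<sigma> \<in> max_cones \<Sigma>"
  defines "\<sigma>0 \<equiv> SOME \<sigma>. \<sigma> \<in> max_cones \<Sigma>"
  shows "triv_on {0} \<sigma> (unit_point {0}) = sc (unit_scalar \<sigma>) (triv_on {0} \<sigma>0 (unit_point {0}))"
    and "unit_scalar \<sigma> \<noteq> 0" and "triv_on {0} \<sigma>0 (unit_point {0}) \<noteq> 0"
proof -
  have \<sigma>0: "\<sigma>0 \<in> max_cones \<Sigma>" unfolding \<sigma>0_def by (rule someI_ex[OF ex_max_cone])
  have O: "{0} \<in> \<Sigma>" by (rule fan_zero_cone[OF fan])
  have sub: "{0} \<subseteq> \<sigma>'" if "\<sigma>' \<in> max_cones \<Sigma>" for \<sigma>'
    using fan_cone_zero[OF fan max_cone_imp_cone[OF that]] by simp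
  have x: "unit_point {0} \<in> X {0}" by (rule torus_point_mem)
  show eq: "triv_on {0} \<sigma> (unit_point {0}) = sc (unit_scalar \<sigma>) (triv_on {0} \<sigma>0 (unit_point {0}))"
    unfolding unit_scalar_def \<sigma>0_def[symmetric]
    by (rule someI_ex[OF fibre_eq_scale_triv_on[OF O \<sigma>0 sub[OF \<sigma>0] x triv_on_mem[OF O \<sigma> sub[OF \<sigma>] x]]])
  show "triv_on {0} \<sigma>0 (unit_point {0}) \<noteq> 0" by (rule triv_on_nonzero[OF O \<sigma>0 sub[OF \<sigma>0] x])
  show "unit_scalar \<sigma> \<noteq> 0" using triv_on_nonzero[OF O \<sigma> sub[OF \<sigma>] x] eq by auto
qed

lemmas unit_scalar_nonzero = unit_scalar_props(2)

text \<open>Functoriality with respect to the cone \<open>{0}\<close> shows that the transition constants form a coboundary.\<close>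

lemma transition:
  assumes \<sigma>: "\<sigma> \<in> max_cones \<Sigma>" and \<sigma>': "\<sigma>' \<in> max_cones \<Sigma>" and x: "x \<in> X (\<sigma> \<inter> \<sigma>')"
  shows "triv_on (\<sigma> \<inter> \<sigma>') \<sigma> x =
    sc (unit_scalar \<sigma> / unit_scalar \<sigma>' * x (m \<sigma> - m \<sigma>')) (triv_on (\<sigma> \<inter> \<sigma>') \<sigma>' x)"
proof -
  define \<tau> where "\<tau> = \<sigma> \<inter> \<sigma>'"
  have \<tau>: "\<tau> \<in> \<Sigma>" unfolding \<tau>_def using fan_Int[OF fan] \<sigma> \<sigma>' max_cone_imp_cone by blast
  have sub: "\<tau> \<subseteq> \<sigma>" "\<tau> \<subseteq> \<sigma>'" by (auto simp: \<tau>_def)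
  obtain c where c: "c \<noteq> 0" "\<forall>x\<in>X \<tau>. triv_on \<tau> \<sigma> x = sc (c * x (m \<sigma> - m \<sigma>')) (triv_on \<tau> \<sigma>' x)"
    using transition_const[OF \<sigma> \<sigma>'] unfolding \<tau>_def by blast
  have O: "{0} \<in> \<Sigma>" by (rule fan_zero_cone[OF fan])
  have O\<tau>: "{0} \<subseteq> \<tau>" using fan_cone_zero[OF fan \<tau>] by simp
  have x0: "unit_point {0} \<in> X {0}" and x1: "unit_point \<tau> \<in> X \<tau>" by (rule torus_point_mem)+
  have proj0: "proj \<tau> (unit_point {0}) = unit_point \<tau>" by (rule proj_torus_point[OF O\<tau>])
  \<comment> \<open>The cocycle condition for {0}, \<tau> and \<rho>, evaluated at the unit point,
    which is mapped to the unit points of the larger charts.\<close>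
  have comp: "\<phi> {0} \<tau> (unit_point {0}) (triv_on \<tau> \<rho> (unit_point \<tau>)) = triv_on {0} \<rho> (unit_point {0})"
    if \<rho>: "\<rho> \<in> max_cones \<Sigma>" and \<tau>\<rho>: "\<tau> \<subseteq> \<rho>" for \<rho>
  proof -
    have O\<rho>: "{0} \<subseteq> \<rho>" using O\<tau> \<tau>\<rho> by blast
    have "\<forall>x\<in>X {0}. \<forall>v\<in>fibre (L \<rho>) (proj \<rho> x). \<phi> {0} \<tau> x (\<phi> \<tau> \<rho> (proj \<tau> x) v) = \<phi> {0} \<rho> x v"
      using bspec[OF bspec[OF bspec[OF orbi_bundle[unfolded orbi_line_bundle_def, THEN conjunct2, THEN conjunct2]
              max_cone_imp_cone[OF \<rho>]] \<tau>] O] O\<tau> \<tau>\<rho> by simp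
    from bspec[OF bspec[OF this x0] triv_mem[OF \<rho> proj_mem[OF O\<rho> x0]]]
    show ?thesis
      by (simp only: triv_on_def proj0 proj_torus_point[OF O\<rho>] proj_torus_point[OF \<tau>\<rho>])
  qed
  \<comment> \<open>At the unit point the monomial drops out and the constant \<open>c\<close> alone
    remains.\<close>
  have m1: "unit_point \<tau> (m \<sigma> - m \<sigma>') = 1"
    using m_diff_mem[OF \<sigma> \<sigma>'] by (simp add: torus_point_apply \<tau>_def)
  have "triv_on {0} \<sigma> (unit_point {0}) = \<phi> {0} \<tau> (unit_point {0}) (sc c (triv_on \<tau> \<sigma>' (unit_point \<tau>)))"
    using comp[OF \<sigma> sub(1)] bspec[OF c(2) x1] m1 by simp
  also have "\<dots> = sc c (triv_on {0} \<sigma>' (unit_point {0}))"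
    using linear_iso_onD(3)[OF restriction_linear[OF O \<tau> O\<tau> x0], of "triv_on \<tau> \<sigma>' (unit_point \<tau>)" c]
      triv_on_mem[OF \<tau> \<sigma>' sub(2) x1] comp[OF \<sigma>' sub(2)] unfolding proj0 by simp
  finally have "sc (unit_scalar \<sigma>) (triv_on {0} (SOME \<sigma>. \<sigma> \<in> max_cones \<Sigma>) (unit_point {0})) =
      sc (c * unit_scalar \<sigma>') (triv_on {0} (SOME \<sigma>. \<sigma> \<in> max_cones \<Sigma>) (unit_point {0}))"
    using unit_scalar_props(1)[OF \<sigma>] unit_scalar_props(1)[OF \<sigma>'] by simp
  then have "unit_scalar \<sigma> = c * unit_scalar \<sigma>'"
    using unit_scalar_props(3)[OF \<sigma>] by (rule scale_eq_scaleD)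
  then have "c = unit_scalar \<sigma> / unit_scalar \<sigma>'" using unit_scalar_nonzero[OF \<sigma>'] by simp
  then show ?thesis using c(2) x unfolding \<tau>_def by blast
qed

end

section \<open>Expansion of global sections in characters\<close>

context smooth_chart
begin

lemma expo_dual_basis_sum:
  fixes k :: "'n \<Rightarrow> nat"
  defines "q \<equiv> (\<Sum>i\<in>UNIV. real (k i) *\<^sub>R d i)"
  shows "q \<in> toric_monoid N \<sigma>" "expo q = k"
proof -
  have q: "q \<bullet> u i = real (k i)" for i
    using dual_families_inner_sum[OF dual_families_sym[OF ud], of i "\<lambda>i. real (k i)"]
    by (simp add: q_def inner_commute)
  then show "q \<in> toric_monoid N \<sigma>" by (simp add: toric_monoid_iff)
  show "expo q = k" by (simp add: expo_def q fun_eq_iff)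
qed

lemma norm_torus_exp_dual_basis_le: "\<eta> \<in> \<sigma> \<Longrightarrow> norm (torus_exp \<xi> \<eta> (d i)) \<le> 1"
  by (simp add: norm_torus_exp \<sigma>_eq)

lemma compact_polydisc: "compact {z :: complex ^ 'n. \<forall>i. norm (z $ i) \<le> 1}"
  unfolding compact_eq_bounded_closed
proof
  have "norm z \<le> real CARD('n)" if "\<forall>i. norm (z $ i) \<le> 1" for z :: "complex ^ 'n"
  proof -
    have "norm z \<le> (\<Sum>i\<in>UNIV. norm (z $ i))"
      unfolding norm_vec_def by (rule L2_set_le_sum) simp
    also have "\<dots> \<le> (\<Sum>i\<in>(UNIV::'n set). 1)" using that by (intro sum_mono) simp
    finally show ?thesis by simp
  qed
  then show "bounded {z :: complex ^ 'n. \<forall>i. norm (z $ i) \<le> 1}" unfolding bounded_iff by blast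
  show "closed {z :: complex ^ 'n. \<forall>i. norm (z $ i) \<le> 1}"
    by (intro closed_Collect_all closed_Collect_le continuous_intros)
qed

lemma bounded_on_cone:
  assumes "continuous_on (affine_toric N \<sigma>) f"
  shows "\<exists>B. \<forall>\<xi>. \<forall>\<eta>\<in>\<sigma>. norm (f (torus_point N \<sigma> \<xi> \<eta>)) \<le> B"
proof -
  have "continuous_on {z. \<forall>i. norm (z $ i) \<le> 1} (\<lambda>z. f (chart_point z))"
    by (rule continuous_on_compose2[OF assms continuous_on_chart_point]) (auto simp: chart_point_mem)
  then have "bounded ((\<lambda>z. f (chart_point z)) ` {z. \<forall>i. norm (z $ i) \<le> 1})"
    using compact_polydisc by (intro compact_imp_bounded compact_continuous_image)
  then obtain B where "\<And>z. \<forall>i. norm (z $ i) \<le> 1 \<Longrightarrow> norm (f (chart_point z)) \<le> B"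
    unfolding bounded_iff by blast
  then show ?thesis
    unfolding torus_point_eq_chart_point by (intro exI[of _ B]) (simp add: norm_torus_exp_dual_basis_le)
qed

text \<open>Varying one coordinate \<open>t\<close> while the others are frozen changes the bound
  for \<open>norm \<eta>\<close> by at most \<open>M * ln (norm t)\<close>, so the exponential bound
  becomes a power of \<open>norm t\<close>, and Liouville's theorem applies to the slice.\<close>

lemma poly_slices_of_growth:
  assumes f: "orbit_holomorphic N \<sigma> (affine_toric N \<sigma>) f" and R: "0 \<le> R"
    and growth: "\<And>\<xi> \<eta>. norm (f (torus_point N \<sigma> \<xi> \<eta>)) \<le> C * exp (R * norm \<eta>)"
  shows "\<exists>D. poly_slices D (\<lambda>z. f (chart_point (\<chi> j. z j)))"
proof -
  have C: "0 \<le> C"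
  proof -
    have "0 \<le> C * exp (R * norm (0 :: real ^ 'n))" by (rule order_trans[OF norm_ge_zero growth])
    then show ?thesis by simp
  qed
  define M where "M = (\<Sum>j\<in>UNIV. norm (u j))"
  have M: "0 \<le> M" "norm (u i) \<le> M" for i
    unfolding M_def by (auto intro: sum_nonneg member_le_sum)
  define D where "D = nat \<lceil>R * M\<rceil>"
  have D: "R * M \<le> real D" by (simp add: D_def real_nat_ceiling_ge)
  have "\<exists>a. \<forall>t. f (chart_point (\<chi> j. if j = i then t else z j)) = (\<Sum>k\<le>D. a k * t ^ k)"
    if z: "\<forall>j. z j \<noteq> 0" for z i
  proof -
    define p where "p = (\<lambda>t. f (chart_point (\<chi> j. if j = i then t else z j)))"
    define K where "K = (\<Sum>j\<in>UNIV. \<bar>ln (norm (z j))\<bar> * norm (u j))"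
    have "p holomorphic_on UNIV"
      unfolding p_def using orbit_holomorphic_slice[OF f, of i "\<chi> j. z j"] by (simp only: vec_lambda_beta)
    moreover have "norm (p t) \<le> C * exp (R * K) * norm t ^ D" if t: "1 \<le> norm t" for t
    proof -
      define y where "y = (\<lambda>j. if j = i then t else z j)"
      have "y j \<noteq> 0" for j using z t by (auto simp: y_def)
      then obtain \<xi> \<eta> where e: "\<forall>j. torus_exp \<xi> \<eta> (d j) = y j"
        and \<eta>: "norm \<eta> \<le> (\<Sum>j\<in>UNIV. \<bar>ln (norm (y j))\<bar> * norm (u j))"
        using ex_torus_exp_coordinates[of y] by blast
      have "p t = f (torus_point N \<sigma> \<xi> \<eta>)"
        unfolding p_def torus_point_eq_chart_point using e by (simp add: y_def)
      then have 1: "norm (p t) \<le> C * exp (R * norm \<eta>)" using growth by simp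
      have "(\<Sum>j\<in>UNIV. \<bar>ln (norm (y j))\<bar> * norm (u j)) \<le>
          (\<Sum>j\<in>UNIV. \<bar>ln (norm (z j))\<bar> * norm (u j) + (if j = i then ln (norm t) * norm (u i) else 0))"
        using t by (intro sum_mono) (auto simp: y_def)
      also have "\<dots> = K + ln (norm t) * norm (u i)" by (simp add: sum.distrib K_def)
      also have "\<dots> \<le> K + ln (norm t) * M" using M t by (intro add_left_mono mult_left_mono) auto
      finally have "norm \<eta> \<le> K + ln (norm t) * M" using \<eta> by linarith
      then have "R * norm \<eta> \<le> R * (K + ln (norm t) * M)" using R by (rule mult_left_mono)
      also have "\<dots> = R * K + R * M * ln (norm t)" by (simp add: algebra_simps)
      also have "\<dots> \<le> R * K + real D * ln (norm t)" using D t by (intro add_left_mono mult_right_mono) auto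
      finally have "exp (R * norm \<eta>) \<le> exp (R * K) * exp (real D * ln (norm t))"
        by (simp flip: exp_add)
      also have "exp (real D * ln (norm t)) = norm t ^ D"
      proof -
        have "exp (ln (norm t)) = norm t" using t by (intro exp_ln) linarith
        then show ?thesis by (simp add: exp_of_nat_mult)
      qed
      finally have "C * exp (R * norm \<eta>) \<le> C * (exp (R * K) * norm t ^ D)"
        using C by (rule mult_left_mono)
      then show ?thesis using 1 by (simp add: mult.assoc)
    qed
    ultimately have "p t = (\<Sum>k\<le>D. (deriv ^^ k) p 0 / fact k * t ^ k)" for t
      by (rule Liouville_polynomial)
    then show ?thesis unfolding p_def by (intro exI allI)
  qed
  then have "poly_slices D (\<lambda>z. f (chart_point (\<chi> j. z j)))"
    unfolding poly_slices_def fun_upd_def by meson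
  then show ?thesis ..
qed

text \<open>The slices determine a polynomial on the torus, and continuity extends the identity to
  the whole chart. Exponent vectors are then translated into elements of the monoid.\<close>

lemma monomial_expansion_of_growth:
  assumes f: "orbit_holomorphic N \<sigma> (affine_toric N \<sigma>) f" and R: "0 \<le> R"
    and growth: "\<And>\<xi> \<eta>. norm (f (torus_point N \<sigma> \<xi> \<eta>)) \<le> C * exp (R * norm \<eta>)"
  shows "\<exists>E c. finite E \<and> E \<subseteq> toric_monoid N \<sigma> \<and> (\<forall>x\<in>affine_toric N \<sigma>. f x = (\<Sum>b\<in>E. c b * x b))"
proof -
  obtain D where "poly_slices D (\<lambda>z. f (chart_point (\<chi> j. z j)))"
    using poly_slices_of_growth[OF assms] by blast
  from poly_slices_imp_poly_funs[OF this] obtain g where g: "g \<in> poly_funs"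
    "\<And>z. (\<forall>j. z j \<noteq> 0) \<Longrightarrow> f (chart_point (\<chi> j. z j)) = g z" by blast
  obtain K c where K: "finite K" "\<And>z. g z = (\<Sum>k\<in>K. c k * (\<Prod>i\<in>UNIV. z i ^ k i))"
    using poly_funs_finite_sum[OF g(1)] by blast
  have "continuous_on (affine_toric N \<sigma>) f" using f unfolding orbit_holomorphic_def by (rule conjunct1)
  then have "continuous_on UNIV (\<lambda>z. f (chart_point z))"
    by (rule continuous_on_compose2[OF _ continuous_on_chart_point]) (auto simp: chart_point_mem)
  moreover have "continuous_on UNIV (\<lambda>z :: complex ^ 'n. \<Sum>k\<in>K. c k * (\<Prod>i\<in>UNIV. z $ i ^ k i))"
    by (intro continuous_intros)
  moreover have "f (chart_point z) = (\<Sum>k\<in>K. c k * (\<Prod>i\<in>UNIV. z $ i ^ k i))" if "\<And>j. z $ j \<noteq> 0" for z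
    using g(2)[of "($) z"] K(2)[of "($) z"] that by simp
  ultimately have exp: "f (chart_point z) = (\<Sum>k\<in>K. c k * (\<Prod>i\<in>UNIV. z $ i ^ k i))" for z
    by (rule eq_if_eq_on_torus)
  define q where "q = (\<lambda>k :: 'n \<Rightarrow> nat. \<Sum>i\<in>UNIV. real (k i) *\<^sub>R d i)"
  have q: "q k \<in> toric_monoid N \<sigma>" "expo (q k) = k" for k
    unfolding q_def by (rule expo_dual_basis_sum)+
  have "inj_on q K" using q(2) by (metis inj_onI)
  have "f x = (\<Sum>b\<in>q ` K. c (expo b) * x b)" if x: "x \<in> affine_toric N \<sigma>" for x
  proof -
    have "f x = (\<Sum>k\<in>K. c k * (\<Prod>i\<in>UNIV. x (d i) ^ k i))"
      using exp[of "\<chi> i. x (d i)"] chart_point_coordinates[OF x] by simp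
    also have "\<dots> = (\<Sum>k\<in>K. c (expo (q k)) * x (q k))"
      using affine_toric_apply[OF x q(1)] by (simp add: q(2))
    also have "\<dots> = (\<Sum>b\<in>q ` K. c (expo b) * x b)"
      using \<open>inj_on q K\<close> by (simp add: sum.reindex)
    finally show ?thesis .
  qed
  then show ?thesis using K(1) q(1) by (intro exI[of _ "q ` K"] exI[of _ "\<lambda>b. c (expo b)"]) auto
qed

end

context linearized_orbi_bundle
begin

section \<open>Coefficient functions of a global section\<close>

lemma finite_max_cones: "finite (max_cones \<Sigma>)"
  using fan by (simp add: weighted_fan_def complete_simplicial_fan_def cones_of_dim_def)

lemma ex_smooth_chart:
  assumes "\<sigma> \<in> max_cones \<Sigma>"
  obtains u d where "smooth_chart (N \<sigma>) \<sigma> u d" "range u \<subseteq> std_lattice"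
  using max_cone_charts[OF fan assms] unfolding smooth_chart_def by metis

definition coef :: "((real ^ 'n) set \<Rightarrow> 'n point \<Rightarrow> 'v) \<Rightarrow> (real ^ 'n) set \<Rightarrow> 'n point \<Rightarrow> complex" where
  "coef s \<sigma> x = \<theta> \<sigma> x (s \<sigma> x)"

context
  fixes s
  assumes s: "s \<in> global_sections \<Sigma> w sc L \<phi>"
begin

lemma section_local: "\<sigma> \<in> max_cones \<Sigma> \<Longrightarrow> s \<sigma> \<in> local_sections (N \<sigma>) \<sigma> sc (L \<sigma>)"
  using s unfolding global_sections_def by blast

lemma section_mem: "\<sigma> \<in> max_cones \<Sigma> \<Longrightarrow> x \<in> X \<sigma> \<Longrightarrow> s \<sigma> x \<in> fibre (L \<sigma>) x"
  using section_local unfolding local_sections_def by blast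

lemma section_eq: "\<sigma> \<in> max_cones \<Sigma> \<Longrightarrow> x \<in> X \<sigma> \<Longrightarrow> s \<sigma> x = sc (coef s \<sigma> x) (triv \<sigma> x)"
  unfolding coef_def by (rule scale_\<theta>_triv[OF _ _ section_mem, symmetric])

lemma coef_orbit_holomorphic:
  assumes \<sigma>: "\<sigma> \<in> max_cones \<Sigma>"
  shows "orbit_holomorphic (N \<sigma>) \<sigma> (X \<sigma>) (coef s \<sigma>)"
proof (rule orbit_holomorphic_local)
  fix x assume x: "x \<in> X \<sigma>"
  obtain V e where Ve: "(V, e) \<in> frames (L \<sigma>)" "x \<in> V"
    using ex_frame[OF max_cone_imp_cone[OF \<sigma>] x] by blast
  note fr = frame_props[OF max_cone_imp_cone[OF \<sigma>] Ve(1)]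
  obtain g where g: "toric_holomorphic (N \<sigma>) \<sigma> V g" "\<forall>x\<in>V. e x = sc (g x) (triv \<sigma> x) \<and> g x \<noteq> 0"
    using frame_eq_scale_triv[OF \<sigma> Ve(1)] by blast
  have "\<forall>(V, e)\<in>frames (L \<sigma>). \<exists>g. toric_holomorphic (N \<sigma>) \<sigma> V g \<and> (\<forall>x\<in>V. s \<sigma> x = sc (g x) (e x))"
    using section_local[OF \<sigma>] unfolding local_sections_def by blast
  from bspec[OF this Ve(1)] obtain f where
    f: "toric_holomorphic (N \<sigma>) \<sigma> V f" "\<forall>x\<in>V. s \<sigma> x = sc (f x) (e x)" by auto
  have "orbit_holomorphic (N \<sigma>) \<sigma> V (\<lambda>y. f y * g y)"
    by (intro orbit_holomorphic_mult toric_holomorphic_imp_orbit_holomorphic f(1) g(1))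
  moreover have "coef s \<sigma> y = f y * g y" if y: "y \<in> V" for y
  proof -
    have yX: "y \<in> X \<sigma>" using y fr(2) by blast
    have "s \<sigma> y = sc (f y * g y) (triv \<sigma> y)"
      using bspec[OF f(2) y] bspec[OF g(2) y] by simp
    then show ?thesis unfolding coef_def using \<theta>_scale_triv[OF \<sigma> yX] by simp
  qed
  ultimately show "\<exists>V' g. openin (top_of_set (X \<sigma>)) V' \<and> x \<in> V' \<and> orbit_holomorphic (N \<sigma>) \<sigma> V' g \<and>
      (\<forall>y\<in>V'. coef s \<sigma> y = g y)"
    using fr(1) Ve(2) by (intro exI[of _ V] exI[of _ "\<lambda>y. f y * g y"]) simp
qed simp

lemma coef_invariant:
  assumes \<sigma>: "\<sigma> \<in> max_cones \<Sigma>" and x: "x \<in> X \<sigma>" and \<gamma>: "\<gamma> \<in> std_lattice"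
  shows "coef s \<sigma> (torus_act (N \<sigma>) \<sigma> \<gamma> x) = char_val (m \<sigma>) \<gamma> * coef s \<sigma> x"
proof -
  have "act (L \<sigma>) \<gamma> x (s \<sigma> x) = s \<sigma> (torus_act (N \<sigma>) \<sigma> \<gamma> x)"
    using section_local[OF \<sigma>] x \<gamma> unfolding local_sections_def by blast
  then show ?thesis unfolding coef_def using \<theta>_act[OF \<sigma> x section_mem[OF \<sigma> x], of \<gamma>] by simp
qed

lemma coef_glue:
  assumes \<sigma>: "\<sigma> \<in> max_cones \<Sigma>" and \<sigma>': "\<sigma>' \<in> max_cones \<Sigma>" and x: "x \<in> X (\<sigma> \<inter> \<sigma>')"
  shows "unit_scalar \<sigma> * coef s \<sigma> (proj \<sigma> x) * x (m \<sigma> - m \<sigma>') = unit_scalar \<sigma>' * coef s \<sigma>' (proj \<sigma>' x)"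
proof -
  define \<tau> where "\<tau> = \<sigma> \<inter> \<sigma>'"
  have \<tau>: "\<tau> \<in> \<Sigma>" unfolding \<tau>_def using fan_Int[OF fan] \<sigma> \<sigma>' max_cone_imp_cone by blast
  have sub: "\<tau> \<subseteq> \<sigma>" "\<tau> \<subseteq> \<sigma>'" by (auto simp: \<tau>_def)
  have x\<tau>: "x \<in> X \<tau>" using x by (simp add: \<tau>_def)
  have "\<phi> \<tau> \<sigma> x (s \<sigma> (proj \<sigma> x)) = \<phi> \<tau> \<sigma>' x (s \<sigma>' (proj \<sigma>' x))"
    using s \<sigma> \<sigma>' x unfolding global_sections_def \<tau>_def by blast
  then have "sc (coef s \<sigma> (proj \<sigma> x)) (triv_on \<tau> \<sigma> x) = sc (coef s \<sigma>' (proj \<sigma>' x)) (triv_on \<tau> \<sigma>' x)"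
    using section_eq[OF \<sigma> proj_mem[OF sub(1) x\<tau>]] section_eq[OF \<sigma>' proj_mem[OF sub(2) x\<tau>]]
      restriction_scale_triv[OF \<tau> \<sigma> sub(1) x\<tau>] restriction_scale_triv[OF \<tau> \<sigma>' sub(2) x\<tau>] by simp
  then have "sc (coef s \<sigma> (proj \<sigma> x) * (unit_scalar \<sigma> / unit_scalar \<sigma>' * x (m \<sigma> - m \<sigma>'))) (triv_on \<tau> \<sigma>' x) =
      sc (coef s \<sigma>' (proj \<sigma>' x)) (triv_on \<tau> \<sigma>' x)"
    using transition[OF \<sigma> \<sigma>' x] unfolding \<tau>_def by simp
  then have "coef s \<sigma> (proj \<sigma> x) * (unit_scalar \<sigma> / unit_scalar \<sigma>' * x (m \<sigma> - m \<sigma>')) = coef s \<sigma>' (proj \<sigma>' x)"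
    using triv_on_nonzero[OF \<tau> \<sigma>' sub(2) x\<tau>] by (rule scale_eq_scaleD)
  then show ?thesis using unit_scalar_nonzero[OF \<sigma>'] by (auto simp: field_simps)
qed

text \<open>The section as a function on the Lie algebra of the complex torus, in normalized
  trivializations. The separate factors are periodic in \<xi> only under smaller lattices in
  general, since \<open>m \<sigma>\<close> need not be integral on
  \<open>std_lattice\<close>.\<close>

definition lifted :: "(real ^ 'n) set \<Rightarrow> real ^ 'n \<Rightarrow> real ^ 'n \<Rightarrow> complex" where
  "lifted \<sigma> \<xi> \<eta> = unit_scalar \<sigma> * coef s \<sigma> (torus_point (N \<sigma>) \<sigma> \<xi> \<eta>) * torus_exp \<xi> \<eta> (m \<sigma>)"

lemma lifted_indep:
  assumes \<sigma>: "\<sigma> \<in> max_cones \<Sigma>" and \<sigma>': "\<sigma>' \<in> max_cones \<Sigma>"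
  shows "lifted \<sigma> \<xi> \<eta> = lifted \<sigma>' \<xi> \<eta>"
proof -
  have "unit_scalar \<sigma> * coef s \<sigma> (torus_point (N \<sigma>) \<sigma> \<xi> \<eta>) * torus_exp \<xi> \<eta> (m \<sigma> - m \<sigma>') =
      unit_scalar \<sigma>' * coef s \<sigma>' (torus_point (N \<sigma>') \<sigma>' \<xi> \<eta>)"
    using coef_glue[OF \<sigma> \<sigma>' torus_point_mem, of \<xi> \<eta>] m_diff_mem[OF \<sigma> \<sigma>']
    by (simp add: proj_torus_point torus_point_apply)
  moreover have "torus_exp \<xi> \<eta> (m \<sigma>) = torus_exp \<xi> \<eta> (m \<sigma> - m \<sigma>') * torus_exp \<xi> \<eta> (m \<sigma>')"
    by (simp flip: torus_exp_add)
  ultimately show ?thesis by (simp add: lifted_def mult.assoc[symmetric])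
qed

text \<open>Invariance of the section under the covering group makes the coefficient change by the
  inverse of the factor contributed by \<open>m \<sigma>\<close>. The case \<eta> = 0 suffices for
  detecting which characters occur.\<close>

lemma lifted_periodic:
  assumes \<sigma>: "\<sigma> \<in> max_cones \<Sigma>" and \<gamma>: "\<gamma> \<in> std_lattice"
  shows "lifted \<sigma> (\<xi> + \<gamma>) 0 = lifted \<sigma> \<xi> 0"
proof -
  have "torus_point (N \<sigma>) \<sigma> (\<xi> + \<gamma>) 0 = torus_act (N \<sigma>) \<sigma> (- \<gamma>) (torus_point (N \<sigma>) \<sigma> \<xi> 0)"
    by (auto simp: torus_point_def torus_act_def torus_exp_real char_val_add_right restrict_def)
  moreover have "- \<gamma> \<in> std_lattice" using \<gamma> by (simp add: std_lattice_def)
  ultimately show ?thesis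
    using coef_invariant[OF \<sigma> torus_point_mem, of "- \<gamma>" \<xi> 0]
    by (simp add: lifted_def torus_exp_real char_val_add_right char_val_minus)
qed

text \<open>Independence of the cone allows each \<eta> to be treated in a maximal cone \<rho>
  containing it. There the coefficient is bounded and only the monomial \<open>m \<rho>\<close> can
  grow, by Cauchy-Schwarz at most like
  \<open>exp (2 * pi * norm (m \<rho>) * norm \<eta>)\<close>.\<close>

lemma lifted_growth: "\<exists>C R. 0 \<le> R \<and> (\<forall>\<sigma>\<in>max_cones \<Sigma>. \<forall>\<xi> \<eta>. norm (lifted \<sigma> \<xi> \<eta>) \<le> C * exp (R * norm \<eta>))"
proof -
  have "\<exists>B. \<forall>\<xi>. \<forall>\<eta>\<in>\<sigma>. norm (coef s \<sigma> (torus_point (N \<sigma>) \<sigma> \<xi> \<eta>)) \<le> B" if \<sigma>: "\<sigma> \<in> max_cones \<Sigma>" for \<sigma>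
  proof -
    obtain u d where "smooth_chart (N \<sigma>) \<sigma> u d" using ex_smooth_chart[OF \<sigma>] .
    moreover have "continuous_on (X \<sigma>) (coef s \<sigma>)"
      using coef_orbit_holomorphic[OF \<sigma>] unfolding orbit_holomorphic_def by (rule conjunct1)
    ultimately show ?thesis by (rule smooth_chart.bounded_on_cone)
  qed
  then obtain B where B: "\<And>\<sigma> \<xi> \<eta>. \<sigma> \<in> max_cones \<Sigma> \<Longrightarrow> \<eta> \<in> \<sigma> \<Longrightarrow>
      norm (coef s \<sigma> (torus_point (N \<sigma>) \<sigma> \<xi> \<eta>)) \<le> B \<sigma>" by metis
  \<comment> \<open>Sums over the finitely many maximal cones stand in for maxima; they dominate
    every summand since all summands are nonnegative.\<close>
  define C where "C = (\<Sum>\<sigma>\<in>max_cones \<Sigma>. norm (unit_scalar \<sigma>) * \<bar>B \<sigma>\<bar>)"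
  define R where "R = (\<Sum>\<sigma>\<in>max_cones \<Sigma>. 2 * pi * norm (m \<sigma>))"
  have R: "0 \<le> R" unfolding R_def by (intro sum_nonneg) simp
  have "norm (lifted \<sigma> \<xi> \<eta>) \<le> C * exp (R * norm \<eta>)" if \<sigma>: "\<sigma> \<in> max_cones \<Sigma>" for \<sigma> \<xi> \<eta>
  proof -
    obtain \<rho> where \<rho>: "\<rho> \<in> max_cones \<Sigma>" "\<eta> \<in> \<rho>" using Union_max_cones[OF fan] by blast
    have "norm (unit_scalar \<rho>) * norm (coef s \<rho> (torus_point (N \<rho>) \<rho> \<xi> \<eta>)) \<le> norm (unit_scalar \<rho>) * \<bar>B \<rho>\<bar>"
      using B[OF \<rho>, of \<xi>] by (intro mult_left_mono) auto
    also have "\<dots> \<le> C" unfolding C_def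
      by (rule member_le_sum[OF \<rho>(1) _ finite_max_cones]) simp
    finally have 1: "norm (unit_scalar \<rho>) * norm (coef s \<rho> (torus_point (N \<rho>) \<rho> \<xi> \<eta>)) \<le> C" .
    have "2 * pi * norm (m \<rho>) \<le> R" unfolding R_def
      by (rule member_le_sum[OF \<rho>(1) _ finite_max_cones]) simp
    then have 2: "2 * pi * norm (m \<rho>) * norm \<eta> \<le> R * norm \<eta>" by (rule mult_right_mono) simp
    have "- (m \<rho> \<bullet> \<eta>) \<le> norm (m \<rho>) * norm \<eta>" using Cauchy_Schwarz_ineq2[of "m \<rho>" \<eta>] by linarith
    then have "2 * pi * - (m \<rho> \<bullet> \<eta>) \<le> 2 * pi * (norm (m \<rho>) * norm \<eta>)" by (rule mult_left_mono) simp
    also have "\<dots> = 2 * pi * norm (m \<rho>) * norm \<eta>" by (rule mult.assoc[symmetric])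
    also note 2
    finally have "- (2 * pi * (m \<rho> \<bullet> \<eta>)) \<le> R * norm \<eta>" by (simp only: mult_minus_right)
    then have 3: "norm (torus_exp \<xi> \<eta> (m \<rho>)) \<le> exp (R * norm \<eta>)"
      unfolding norm_torus_exp by simp
    have "norm (unit_scalar \<rho>) * norm (coef s \<rho> (torus_point (N \<rho>) \<rho> \<xi> \<eta>)) * norm (torus_exp \<xi> \<eta> (m \<rho>)) \<le>
        C * exp (R * norm \<eta>)"
      by (rule mult_mono[OF 1 3]) (auto intro: order_trans[OF _ 1])
    then show ?thesis
      unfolding lifted_indep[OF \<sigma> \<rho>(1)] by (simp add: lifted_def norm_mult)
  qed
  then show ?thesis using R by blast
qed

text \<open>Removing the monomial \<open>m \<sigma>\<close> from the lifted function costs another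
  exponential factor in \<open>norm \<eta>\<close>, which is absorbed by a larger rate
  \<open>R'\<close>. Exponents are shifted by \<open>m \<sigma>\<close> so that the index
  \<open>a\<close> is the weight of the resulting term.\<close>

lemma coef_expansion:
  assumes \<sigma>: "\<sigma> \<in> max_cones \<Sigma>"
  shows "\<exists>E c. finite E \<and> (\<forall>a\<in>E. a - m \<sigma> \<in> toric_monoid (N \<sigma>) \<sigma>) \<and>
    (\<forall>x\<in>X \<sigma>. unit_scalar \<sigma> * coef s \<sigma> x = (\<Sum>a\<in>E. c a * x (a - m \<sigma>)))"
proof -
  obtain C R where R: "0 \<le> R"
    and C: "\<forall>\<sigma>\<in>max_cones \<Sigma>. \<forall>\<xi> \<eta>. norm (lifted \<sigma> \<xi> \<eta>) \<le> C * exp (R * norm \<eta>)"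
    using lifted_growth by (elim exE conjE)
  have CR: "norm (lifted \<sigma> \<xi> \<eta>) \<le> C * exp (R * norm \<eta>)" for \<xi> \<eta>
    using bspec[OF C \<sigma>] by simp
  define R' where "R' = R + 2 * pi * norm (m \<sigma>)"
  define C' where "C' = C / norm (unit_scalar \<sigma>)"
  have k: "norm (unit_scalar \<sigma>) > 0" using unit_scalar_nonzero[OF \<sigma>] by simp
  have growth: "norm (coef s \<sigma> (torus_point (N \<sigma>) \<sigma> \<xi> \<eta>)) \<le> C' * exp (R' * norm \<eta>)" for \<xi> \<eta>
  proof -
    have "norm (unit_scalar \<sigma>) * norm (coef s \<sigma> (torus_point (N \<sigma>) \<sigma> \<xi> \<eta>)) =
        norm (lifted \<sigma> \<xi> \<eta>) * exp (2 * pi * (m \<sigma> \<bullet> \<eta>))"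
      by (simp add: lifted_def norm_mult norm_torus_exp exp_minus)
    also have "\<dots> \<le> (C * exp (R * norm \<eta>)) * exp (2 * pi * (norm (m \<sigma>) * norm \<eta>))"
    proof (rule mult_mono[OF CR])
      have "m \<sigma> \<bullet> \<eta> \<le> norm (m \<sigma>) * norm \<eta>" by (rule norm_cauchy_schwarz)
      then show "exp (2 * pi * (m \<sigma> \<bullet> \<eta>)) \<le> exp (2 * pi * (norm (m \<sigma>) * norm \<eta>))" by simp
      show "0 \<le> C * exp (R * norm \<eta>)" by (rule order_trans[OF norm_ge_zero CR])
    qed simp
    also have "\<dots> = C * exp (R' * norm \<eta>)"
      by (simp add: R'_def distrib_right exp_add mult.assoc)
    finally show ?thesis using k by (simp add: C'_def field_simps)
  qed
  have R': "0 \<le> R'" using R by (simp add: R'_def)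
  obtain u d where "smooth_chart (N \<sigma>) \<sigma> u d" using ex_smooth_chart[OF \<sigma>] .
  from smooth_chart.monomial_expansion_of_growth[OF this coef_orbit_holomorphic[OF \<sigma>] R' growth]
  obtain E c where E: "finite E" "E \<subseteq> toric_monoid (N \<sigma>) \<sigma>"
    "\<forall>x\<in>X \<sigma>. coef s \<sigma> x = (\<Sum>b\<in>E. c b * x b)" by blast
  define E' where "E' = (\<lambda>b. b + m \<sigma>) ` E"
  have "unit_scalar \<sigma> * coef s \<sigma> x = (\<Sum>a\<in>E'. unit_scalar \<sigma> * c (a - m \<sigma>) * x (a - m \<sigma>))" if "x \<in> X \<sigma>" for x
  proof -
    have "(\<Sum>a\<in>E'. unit_scalar \<sigma> * c (a - m \<sigma>) * x (a - m \<sigma>)) = (\<Sum>b\<in>E. unit_scalar \<sigma> * c b * x b)"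
      unfolding E'_def by (subst sum.reindex) (auto simp: inj_on_def)
    then show ?thesis using bspec[OF E(3) that] by (simp add: sum_distrib_left mult.assoc)
  qed
  moreover have "finite E'" "\<forall>a\<in>E'. a - m \<sigma> \<in> toric_monoid (N \<sigma>) \<sigma>" using E(1,2) by (auto simp: E'_def)
  ultimately show ?thesis by (intro exI[of _ E'] exI[of _ "\<lambda>a. unit_scalar \<sigma> * c (a - m \<sigma>)"]) simp
qed

text \<open>Each cone gives a finite expansion of the same lifted function, so the coefficients
  agree by independence of characters. A weight with nonzero coefficient therefore satisfies the
  cone condition for every maximal cone, and periodicity under \<open>std_lattice\<close> makes it
  integral.\<close>

lemma section_expansion:
  "\<exists>C. \<forall>\<sigma>\<in>max_cones \<Sigma>. \<forall>x\<in>X \<sigma>. unit_scalar \<sigma> * coef s \<sigma> x =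
    (\<Sum>a\<in>dual_lattice std_lattice \<inter> newton_polytope \<Sigma> m. C a * x (a - m \<sigma>))"
proof -
  define A where "A = dual_lattice std_lattice \<inter> newton_polytope \<Sigma> m"
  have finA: "finite A" unfolding A_def by (rule finite_lattice_points_newton_polytope[OF fan])
  define P where "P = (\<lambda>\<sigma> E c. finite E \<and> (\<forall>a\<in>E. a - m \<sigma> \<in> toric_monoid (N \<sigma>) \<sigma>) \<and>
    (\<forall>x\<in>X \<sigma>. unit_scalar \<sigma> * coef s \<sigma> x = (\<Sum>a\<in>E. c a * x (a - m \<sigma>))))"
  have "\<forall>\<sigma>\<in>max_cones \<Sigma>. \<exists>E c. P \<sigma> E c" unfolding P_def by (intro ballI coef_expansion)
  from bchoice[OF this] obtain E where "\<forall>\<sigma>\<in>max_cones \<Sigma>. \<exists>c. P \<sigma> (E \<sigma>) c" ..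
  from bchoice[OF this] obtain c where c: "\<forall>\<sigma>\<in>max_cones \<Sigma>. P \<sigma> (E \<sigma>) (c \<sigma>)" ..
  \<comment> \<open>Extension by zero makes expansions over different index sets comparable.\<close>
  define C where "C = (\<lambda>\<sigma> a. if a \<in> E \<sigma> then c \<sigma> a else 0)"
  have E: "finite (E \<sigma>)" "\<And>a. a \<in> E \<sigma> \<Longrightarrow> a - m \<sigma> \<in> toric_monoid (N \<sigma>) \<sigma>"
    "\<And>x. x \<in> X \<sigma> \<Longrightarrow> unit_scalar \<sigma> * coef s \<sigma> x = (\<Sum>a\<in>E \<sigma>. C \<sigma> a * x (a - m \<sigma>))"
    if "\<sigma> \<in> max_cones \<Sigma>" for \<sigma>
    using bspec[OF c that] by (simp_all add: P_def C_def cong: sum.cong)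
  have sumE: "(\<Sum>a\<in>S. C \<sigma> a * f a) = (\<Sum>a\<in>E \<sigma>. C \<sigma> a * f a)"
    if S: "finite S" and \<sigma>: "\<sigma> \<in> max_cones \<Sigma>" and supp: "\<And>a. C \<sigma> a \<noteq> 0 \<Longrightarrow> a \<in> S" for S \<sigma> f
  proof (rule sum.mono_neutral_cong[OF E(1)[OF \<sigma>] S])
    show "C \<sigma> a * f a = 0" if "a \<in> E \<sigma> - S" for a
    proof -
      have "C \<sigma> a = 0" using supp[of a] that by (cases "C \<sigma> a = 0") simp_all
      then show ?thesis by simp
    qed
    show "C \<sigma> a * f a = 0" if "a \<in> S - E \<sigma>" for a
      using that by (simp add: C_def)
  qed simp
  have lifted: "lifted \<sigma> \<xi> 0 = (\<Sum>a\<in>E \<sigma>. C \<sigma> a * char_val a \<xi>)" if \<sigma>: "\<sigma> \<in> max_cones \<Sigma>" for \<sigma> \<xi>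
  proof -
    have "torus_point (N \<sigma>) \<sigma> \<xi> 0 (a - m \<sigma>) * torus_exp \<xi> 0 (m \<sigma>) = char_val a \<xi>" if "a \<in> E \<sigma>" for a
      using E(2)[OF \<sigma> that] by (simp add: torus_point_apply torus_exp_real flip: char_val_add_left)
    then show ?thesis
      unfolding lifted_def E(3)[OF \<sigma> torus_point_mem] by (simp add: sum_distrib_right mult.assoc)
  qed
  have C_indep: "C \<sigma> a = C \<sigma>' a" if \<sigma>: "\<sigma> \<in> max_cones \<Sigma>" and \<sigma>': "\<sigma>' \<in> max_cones \<Sigma>" for \<sigma> \<sigma>' a
  proof (cases "a \<in> E \<sigma> \<union> E \<sigma>'")
    case True
    have fin: "finite (E \<sigma> \<union> E \<sigma>')" using E(1) \<sigma> \<sigma>' by simp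
    have "C \<sigma> a - C \<sigma>' a = 0"
    proof (rule char_val_independent[OF fin _ True])
      fix \<xi>
      have "(\<Sum>a\<in>E \<sigma> \<union> E \<sigma>'. (C \<sigma> a - C \<sigma>' a) * char_val a \<xi>) =
          (\<Sum>a\<in>E \<sigma> \<union> E \<sigma>'. C \<sigma> a * char_val a \<xi>) - (\<Sum>a\<in>E \<sigma> \<union> E \<sigma>'. C \<sigma>' a * char_val a \<xi>)"
        by (simp add: left_diff_distrib sum_subtractf)
      also have "\<dots> = lifted \<sigma> \<xi> 0 - lifted \<sigma>' \<xi> 0"
        unfolding lifted[OF \<sigma>] lifted[OF \<sigma>']
        by (subst (1 2) sumE[OF fin]) (auto simp: \<sigma> \<sigma>' C_def split: if_splits)
      finally show "(\<Sum>a\<in>E \<sigma> \<union> E \<sigma>'. (C \<sigma> a - C \<sigma>' a) * char_val a \<xi>) = 0"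
        using lifted_indep[OF \<sigma> \<sigma>'] by simp
    qed
    then show ?thesis by simp
  qed (simp add: C_def)
  have C_supp: "a \<in> A" if \<sigma>: "\<sigma> \<in> max_cones \<Sigma>" and a: "C \<sigma> a \<noteq> 0" for \<sigma> a
  proof -
    have "char_val a \<gamma> = 1" if \<gamma>: "\<gamma> \<in> std_lattice" for \<gamma>
    proof -
      have aE: "a \<in> E \<sigma>" using a by (auto simp: C_def split: if_splits)
      have "C \<sigma> a * (char_val a \<gamma> - 1) = 0"
      proof (rule char_val_independent[where c = "\<lambda>a. C \<sigma> a * (char_val a \<gamma> - 1)", OF E(1)[OF \<sigma>] _ aE])
        fix \<xi>
        have "(\<Sum>a\<in>E \<sigma>. C \<sigma> a * (char_val a \<gamma> - 1) * char_val a \<xi>) =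
            (\<Sum>a\<in>E \<sigma>. C \<sigma> a * char_val a (\<xi> + \<gamma>)) - (\<Sum>a\<in>E \<sigma>. C \<sigma> a * char_val a \<xi>)"
          by (simp add: char_val_add_right algebra_simps sum_subtractf)
        also have "\<dots> = 0" using lifted_periodic[OF \<sigma> \<gamma>, of \<xi>] unfolding lifted[OF \<sigma>] by simp
        finally show "(\<Sum>a\<in>E \<sigma>. C \<sigma> a * (char_val a \<gamma> - 1) * char_val a \<xi>) = 0" .
      qed
      then show ?thesis using a by simp
    qed
    then have "a \<in> dual_lattice std_lattice" by (simp add: dual_lattice_def char_val_eq_1_iff)
    \<comment> \<open>A coefficient that is nonzero for one cone is nonzero for all of them, so
      \<open>a\<close> occurs among the exponents of every \<rho>.\<close>
    moreover have "a \<in> (\<lambda>x. m \<rho> + x) ` dual_cone \<rho>" if \<rho>: "\<rho> \<in> max_cones \<Sigma>" for \<rho>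
    proof -
      have "a \<in> E \<rho>" using C_indep[OF \<sigma> \<rho>, of a] a by (auto simp: C_def split: if_splits)
      then have "a - m \<rho> \<in> dual_cone \<rho>" using E(2)[OF \<rho>] by (simp add: toric_monoid_def)
      then show ?thesis by (intro image_eqI[of _ _ "a - m \<rho>"]) auto
    qed
    ultimately show ?thesis by (simp add: A_def newton_polytope_def)
  qed
  obtain \<sigma>0 where \<sigma>0: "\<sigma>0 \<in> max_cones \<Sigma>" using ex_max_cone by blast
  have "unit_scalar \<sigma> * coef s \<sigma> x = (\<Sum>a\<in>A. C \<sigma>0 a * x (a - m \<sigma>))" if "\<sigma> \<in> max_cones \<Sigma>" "x \<in> X \<sigma>" for \<sigma> x
    unfolding E(3)[OF that] C_indep[OF \<sigma>0 that(1)]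
    using sumE[OF finA that(1) C_supp[OF that(1)], of "\<lambda>a. x (a - m \<sigma>)"] by simp
  then show ?thesis unfolding A_def by blast
qed

end

end

section \<open>Sections as combinations of characters\<close>

lemma torus_act_torus_act_minus:
  assumes "x \<in> affine_toric N \<tau>"
  shows "torus_act N \<tau> \<xi> (torus_act N \<tau> (- \<xi>) x) = x"
  using assms complex_act_scaleR[of N \<tau> "-1" "-1" \<xi>]
  by (intro affine_toric_eqI[OF torus_act_mem[OF torus_act_mem]])
    (auto simp: torus_act_def char_val_minus)

context linearized_orbi_bundle
begin

section \<open>Sections with prescribed coefficients\<close>

definition weights :: "(real ^ 'n) set" where
  "weights = dual_lattice std_lattice \<inter> newton_polytope \<Sigma> m"

lemma finite_weights: "finite weights"
  unfolding weights_def by (rule finite_lattice_points_newton_polytope[OF fan])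

lemma cone_lattice_subset_std:
  assumes \<sigma>: "\<sigma> \<in> max_cones \<Sigma>"
  shows "N \<sigma> \<subseteq> std_lattice"
proof
  fix v assume v: "v \<in> N \<sigma>"
  obtain u d where c: "smooth_chart (N \<sigma>) \<sigma> u d" and u: "range u \<subseteq> std_lattice"
    using ex_smooth_chart[OF \<sigma>] .
  have "v = (\<Sum>i\<in>UNIV. (d i \<bullet> v) *\<^sub>R u i)"
    by (rule dual_families_expand[OF smooth_chart.ud[OF c]])
  moreover have "d i \<bullet> v \<in> \<int>" for i using v smooth_chart.N_eq[OF c] by blast
  then have "(\<Sum>i\<in>UNIV. (d i \<bullet> v) *\<^sub>R u i) \<in> std_lattice"
    using u by (intro std_lattice_sum std_lattice_scale) auto
  ultimately show "v \<in> std_lattice" by simp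
qed

lemma weight_diff_mem:
  assumes a: "a \<in> weights" and \<sigma>: "\<sigma> \<in> max_cones \<Sigma>"
  shows "a - m \<sigma> \<in> toric_monoid (N \<sigma>) \<sigma>"
proof -
  have "a \<in> (\<lambda>x. m \<sigma> + x) ` dual_cone \<sigma>" using a \<sigma> by (auto simp: weights_def newton_polytope_def)
  then have "a - m \<sigma> \<in> dual_cone \<sigma>" by auto
  moreover have "(a - m \<sigma>) \<bullet> v \<in> \<int>" if v: "v \<in> N \<sigma>" for v
  proof -
    have "a \<bullet> v \<in> \<int>" using a v cone_lattice_subset_std[OF \<sigma>] by (auto simp: weights_def dual_lattice_def)
    moreover have "m \<sigma> \<bullet> v \<in> \<int>" using m_dual \<sigma> v by (auto simp: dual_lattice_def)
    ultimately show ?thesis by (simp add: inner_diff_left)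
  qed
  ultimately show ?thesis by (simp add: toric_monoid_def dual_lattice_def)
qed

text \<open>Division by \<open>unit_scalar \<sigma>\<close> cancels the transition constants, so one
  coefficient function \<open>C\<close> serves all charts.\<close>

definition sect_fun :: "(real ^ 'n \<Rightarrow> complex) \<Rightarrow> (real ^ 'n) set \<Rightarrow> 'n point \<Rightarrow> complex" where
  "sect_fun C \<sigma> x = (\<Sum>a\<in>weights. C a * x (a - m \<sigma>)) / unit_scalar \<sigma>"

definition sect :: "(real ^ 'n \<Rightarrow> complex) \<Rightarrow> (real ^ 'n) set \<Rightarrow> 'n point \<Rightarrow> 'v" where
  "sect C = (\<lambda>\<sigma> x. if \<sigma> \<in> max_cones \<Sigma> \<and> x \<in> X \<sigma> then sc (sect_fun C \<sigma> x) (triv \<sigma> x) else 0)"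

lemma sect_apply: "\<sigma> \<in> max_cones \<Sigma> \<Longrightarrow> x \<in> X \<sigma> \<Longrightarrow> sect C \<sigma> x = sc (sect_fun C \<sigma> x) (triv \<sigma> x)"
  by (simp add: sect_def)

lemma sect_fun_torus_act:
  assumes \<sigma>: "\<sigma> \<in> max_cones \<Sigma>"
  shows "char_val (m \<sigma>) \<xi> * sect_fun C \<sigma> (torus_act (N \<sigma>) \<sigma> (- \<xi>) x) = sect_fun (\<lambda>a. char_val a \<xi> * C a) \<sigma> x"
proof -
  have "char_val (m \<sigma>) \<xi> * (C a * torus_act (N \<sigma>) \<sigma> (- \<xi>) x (a - m \<sigma>)) = char_val a \<xi> * C a * x (a - m \<sigma>)"
    if "a \<in> weights" for a
  proof -
    have "char_val a \<xi> = char_val (a - m \<sigma>) \<xi> * char_val (m \<sigma>) \<xi>" by (simp flip: char_val_add_left)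
    then show ?thesis using weight_diff_mem[OF that \<sigma>] by (simp add: torus_act_def)
  qed
  then have "(\<Sum>a\<in>weights. char_val (m \<sigma>) \<xi> * (C a * torus_act (N \<sigma>) \<sigma> (- \<xi>) x (a - m \<sigma>))) =
      (\<Sum>a\<in>weights. char_val a \<xi> * C a * x (a - m \<sigma>))"
    by (rule sum.cong[OF refl])
  then show ?thesis by (simp add: sect_fun_def sum_distrib_left)
qed

lemma sect_act:
  assumes \<sigma>: "\<sigma> \<in> max_cones \<Sigma>" and x: "x \<in> X \<sigma>"
  shows "act (L \<sigma>) \<xi> (torus_act (N \<sigma>) \<sigma> (- \<xi>) x) (sect C \<sigma> (torus_act (N \<sigma>) \<sigma> (- \<xi>) x)) =
    sect (\<lambda>a. char_val a \<xi> * C a) \<sigma> x"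
proof -
  have y: "torus_act (N \<sigma>) \<sigma> (- \<xi>) x \<in> X \<sigma>" by (rule torus_act_mem[OF x])
  show ?thesis
    unfolding sect_apply[OF \<sigma> y] sect_apply[OF \<sigma> x] act_scale_triv[OF \<sigma> y] torus_act_torus_act_minus[OF x]
    using sect_fun_torus_act[OF \<sigma>, of \<xi> C x] by (simp add: mult.commute)
qed

lemma section_act_sect: "section_act \<Sigma> w L \<xi> (sect C) = sect (\<lambda>a. char_val a \<xi> * C a)"
proof (intro ext)
  fix \<sigma> x
  show "section_act \<Sigma> w L \<xi> (sect C) \<sigma> x = sect (\<lambda>a. char_val a \<xi> * C a) \<sigma> x"
  proof (cases "\<sigma> \<in> max_cones \<Sigma> \<and> x \<in> X \<sigma>")
    case True
    then show ?thesis using sect_act[of \<sigma> x \<xi> C] by (simp add: section_act_def Let_def)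
  next
    case False
    then show ?thesis unfolding section_act_def sect_def by (simp only: if_False)
  qed
qed

text \<open>Relative to a frame the coefficient is a combination of monomials divided by the nowhere
  vanishing function comparing the frame with \<open>triv\<close>. Invariance holds because the
  weights are integral on \<open>std_lattice\<close>.\<close>

lemma sect_local:
  assumes \<sigma>: "\<sigma> \<in> max_cones \<Sigma>"
  shows "sect C \<sigma> \<in> local_sections (N \<sigma>) \<sigma> sc (L \<sigma>)"
  unfolding local_sections_def
proof (intro CollectI conjI ballI allI impI)
  show "sect C \<sigma> x \<in> fibre (L \<sigma>) x" if "x \<in> X \<sigma>" for x
    unfolding sect_apply[OF \<sigma> that] by (rule scale_triv_mem[OF \<sigma> that])
  show "sect C \<sigma> x = 0" if "x \<notin> X \<sigma>" for x
    using that by (simp add: sect_def)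
  fix Ve assume "Ve \<in> frames (L \<sigma>)"
  then obtain V e where Ve: "Ve = (V, e)" "(V, e) \<in> frames (L \<sigma>)" by (cases Ve) simp
  have V: "V \<subseteq> X \<sigma>" by (rule frame_props(2)[OF max_cone_imp_cone[OF \<sigma>] Ve(2)])
  obtain g where g: "toric_holomorphic (N \<sigma>) \<sigma> V g" "\<forall>x\<in>V. e x = sc (g x) (triv \<sigma> x) \<and> g x \<noteq> 0"
    using frame_eq_scale_triv[OF \<sigma> Ve(2)] by blast
  obtain u d where c: "smooth_chart (N \<sigma>) \<sigma> u d" using ex_smooth_chart[OF \<sigma>] .
  have "toric_holomorphic (N \<sigma>) \<sigma> V (\<lambda>x. (\<Sum>b\<in>(\<lambda>a. a - m \<sigma>) ` weights. C (b + m \<sigma>) / unit_scalar \<sigma> * x b) / g x)"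
    by (rule smooth_chart.toric_holomorphic_divide[OF c g(1)]) (use g(2) weight_diff_mem[OF _ \<sigma>] in auto)
  moreover have "(\<Sum>b\<in>(\<lambda>a. a - m \<sigma>) ` weights. C (b + m \<sigma>) / unit_scalar \<sigma> * x b) = sect_fun C \<sigma> x" for x
    by (subst sum.reindex) (auto simp: inj_on_def sect_fun_def sum_divide_distrib)
  moreover have "sect C \<sigma> x = sc (sect_fun C \<sigma> x / g x) (e x)" if "x \<in> V" for x
    using bspec[OF g(2) that] sect_apply[OF \<sigma>, of x C] V that by (simp add: subset_iff)
  ultimately have "\<exists>g. toric_holomorphic (N \<sigma>) \<sigma> V g \<and> (\<forall>x\<in>V. sect C \<sigma> x = sc (g x) (e x))"
    by (intro exI[of _ "\<lambda>x. sect_fun C \<sigma> x / g x"]) simp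
  then show "case Ve of (V, e) \<Rightarrow> \<exists>g. toric_holomorphic (N \<sigma>) \<sigma> V g \<and> (\<forall>x\<in>V. sect C \<sigma> x = sc (g x) (e x))"
    by (simp add: Ve(1))
next
  fix \<gamma> :: "real ^ 'n" and x assume \<gamma>: "\<gamma> \<in> std_lattice" and x: "x \<in> X \<sigma>"
  define y where "y = torus_act (N \<sigma>) \<sigma> \<gamma> x"
  have y: "y \<in> X \<sigma>" unfolding y_def by (rule torus_act_mem[OF x])
  have "torus_act (N \<sigma>) \<sigma> (- \<gamma>) y = x"
    using torus_act_torus_act_minus[OF x, of "- \<gamma>"] by (simp add: y_def)
  then have "act (L \<sigma>) \<gamma> x (sect C \<sigma> x) = sect (\<lambda>a. char_val a \<gamma> * C a) \<sigma> y"
    using sect_act[OF \<sigma> y, of \<gamma> C] by simp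
  also have "sect_fun (\<lambda>a. char_val a \<gamma> * C a) \<sigma> y = sect_fun C \<sigma> y"
    using \<gamma> by (auto simp: sect_fun_def weights_def dual_lattice_def char_val_eq_1_iff[THEN iffD2])
  then have "sect (\<lambda>a. char_val a \<gamma> * C a) \<sigma> y = sect C \<sigma> y"
    by (simp add: sect_apply[OF \<sigma> y])
  finally show "act (L \<sigma>) \<gamma> x (sect C \<sigma> x) = sect C \<sigma> (torus_act (N \<sigma>) \<sigma> \<gamma> x)" by (simp add: y_def)
qed

lemma sect_global: "sect C \<in> global_sections \<Sigma> w sc L \<phi>"
  unfolding global_sections_def
proof (intro CollectI conjI ballI allI impI)
  show "sect C \<sigma> \<in> local_sections (N \<sigma>) \<sigma> sc (L \<sigma>)" if "\<sigma> \<in> max_cones \<Sigma>" for \<sigma>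
    using that by (rule sect_local)
  show "sect C \<sigma> = 0" if "\<sigma> \<notin> max_cones \<Sigma>" for \<sigma>
    using that by (auto simp: sect_def)
  fix \<sigma> \<sigma>' x assume \<sigma>: "\<sigma> \<in> max_cones \<Sigma>" and \<sigma>': "\<sigma>' \<in> max_cones \<Sigma>" and x: "x \<in> X (\<sigma> \<inter> \<sigma>')"
  define \<tau> where "\<tau> = \<sigma> \<inter> \<sigma>'"
  have \<tau>: "\<tau> \<in> \<Sigma>" unfolding \<tau>_def using fan_Int[OF fan] \<sigma> \<sigma>' max_cone_imp_cone by blast
  have sub: "\<tau> \<subseteq> \<sigma>" "\<tau> \<subseteq> \<sigma>'" by (auto simp: \<tau>_def)
  have x\<tau>: "x \<in> X \<tau>" using x by (simp add: \<tau>_def)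
  \<comment> \<open>The exponents \<open>a - m \<sigma>\<close> and
    \<open>m \<sigma> - m \<sigma>'\<close> add up to \<open>a - m \<sigma>'\<close>, so each weight
    glues separately.\<close>
  have "C a * proj \<sigma> x (a - m \<sigma>) * x (m \<sigma> - m \<sigma>') = C a * proj \<sigma>' x (a - m \<sigma>')" if a: "a \<in> weights" for a
  proof -
    have "a - m \<sigma> \<in> toric_monoid (N \<tau>) \<tau>"
      using weight_diff_mem[OF a \<sigma>] toric_monoid_antimono[OF cone_lattice_mono[OF sub(1)] sub(1)] by blast
    moreover have "m \<sigma> - m \<sigma>' \<in> toric_monoid (N \<tau>) \<tau>" using m_diff_mem[OF \<sigma> \<sigma>'] by (simp add: \<tau>_def)
    ultimately have "x ((a - m \<sigma>) + (m \<sigma> - m \<sigma>')) = x (a - m \<sigma>) * x (m \<sigma> - m \<sigma>')"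
      by (rule affine_toric_add[OF x\<tau>])
    then show ?thesis
      using weight_diff_mem[OF a \<sigma>] weight_diff_mem[OF a \<sigma>'] by (simp add: toric_map_def)
  qed
  then have "(\<Sum>a\<in>weights. C a * proj \<sigma> x (a - m \<sigma>)) * x (m \<sigma> - m \<sigma>') = (\<Sum>a\<in>weights. C a * proj \<sigma>' x (a - m \<sigma>'))"
    unfolding sum_distrib_right by (rule sum.cong[OF refl])
  then have "sect_fun C \<sigma> (proj \<sigma> x) * (unit_scalar \<sigma> / unit_scalar \<sigma>' * x (m \<sigma> - m \<sigma>')) = sect_fun C \<sigma>' (proj \<sigma>' x)"
    using unit_scalar_nonzero[OF \<sigma>] by (simp add: sect_fun_def)
  then have "sc (sect_fun C \<sigma> (proj \<sigma> x)) (triv_on \<tau> \<sigma> x) = sc (sect_fun C \<sigma>' (proj \<sigma>' x)) (triv_on \<tau> \<sigma>' x)"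
    using transition[OF \<sigma> \<sigma>' x] unfolding \<tau>_def by simp
  then show "\<phi> (\<sigma> \<inter> \<sigma>') \<sigma> x (sect C \<sigma> (proj \<sigma> x)) = \<phi> (\<sigma> \<inter> \<sigma>') \<sigma>' x (sect C \<sigma>' (proj \<sigma>' x))"
    unfolding \<tau>_def[symmetric] sect_apply[OF \<sigma> proj_mem[OF sub(1) x\<tau>]] sect_apply[OF \<sigma>' proj_mem[OF sub(2) x\<tau>]]
      restriction_scale_triv[OF \<tau> \<sigma> sub(1) x\<tau>] restriction_scale_triv[OF \<tau> \<sigma>' sub(2) x\<tau>] .
qed

lemma global_section_eq_sect:
  assumes s: "s \<in> global_sections \<Sigma> w sc L \<phi>"
  shows "\<exists>C. s = sect C"
proof -
  obtain C where C: "\<forall>\<sigma>\<in>max_cones \<Sigma>. \<forall>x\<in>X \<sigma>. unit_scalar \<sigma> * coef s \<sigma> x = (\<Sum>a\<in>weights. C a * x (a - m \<sigma>))"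
    using section_expansion[OF s] unfolding weights_def by blast
  have "s \<sigma> x = sect C \<sigma> x" for \<sigma> x
  proof (cases "\<sigma> \<in> max_cones \<Sigma>")
    case \<sigma>: True
    show ?thesis
    proof (cases "x \<in> X \<sigma>")
      case x: True
      have "coef s \<sigma> x = sect_fun C \<sigma> x"
        using bspec[OF bspec[OF C \<sigma>] x] unit_scalar_nonzero[OF \<sigma>] by (simp add: sect_fun_def field_simps)
      then show ?thesis using section_eq[OF s \<sigma> x] sect_apply[OF \<sigma> x] by simp
    next
      case False
      then show ?thesis using section_local[OF s \<sigma>] by (simp add: local_sections_def sect_def)
    qed
  next
    case False
    then have "s \<sigma> = 0" using s unfolding global_sections_def by blast
    then show ?thesis using False by (simp add: sect_def)
  qed
  then show ?thesis by blast
qed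

lemma global_sections_eq: "global_sections \<Sigma> w sc L \<phi> = range sect"
  using sect_global global_section_eq_sect by blast

text \<open>One chart suffices: on its real torus the section becomes a combination of distinct
  characters, which are independent.\<close>

lemma sect_eqD:
  assumes eq: "sect C = sect C'" and a: "a \<in> weights"
  shows "C a = C' a"
proof -
  obtain \<sigma> where \<sigma>: "\<sigma> \<in> max_cones \<Sigma>" using ex_max_cone by blast
  have "C a - C' a = 0"
  proof (rule char_val_independent[OF finite_weights _ a])
    fix \<xi>
    define x where "x = torus_point (N \<sigma>) \<sigma> \<xi> 0"
    have x: "x \<in> X \<sigma>" unfolding x_def by (rule torus_point_mem)
    have sum: "char_val (m \<sigma>) \<xi> * (sect_fun D \<sigma> x * unit_scalar \<sigma>) = (\<Sum>a\<in>weights. D a * char_val a \<xi>)" for D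
    proof -
      have "char_val (m \<sigma>) \<xi> * x (b - m \<sigma>) = char_val b \<xi>" if "b \<in> weights" for b
        using weight_diff_mem[OF that \<sigma>] by (simp add: x_def torus_point_apply torus_exp_real flip: char_val_add_left)
      then have "char_val (m \<sigma>) \<xi> * (D b * x (b - m \<sigma>)) = D b * char_val b \<xi>" if "b \<in> weights" for b
        using that by (simp add: mult.left_commute)
      then have "(\<Sum>b\<in>weights. char_val (m \<sigma>) \<xi> * (D b * x (b - m \<sigma>))) = (\<Sum>b\<in>weights. D b * char_val b \<xi>)"
        by (rule sum.cong[OF refl])
      then show ?thesis using unit_scalar_nonzero[OF \<sigma>] by (simp add: sect_fun_def sum_distrib_left)
    qed
    have "sc (sect_fun C \<sigma> x) (triv \<sigma> x) = sc (sect_fun C' \<sigma> x) (triv \<sigma> x)"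
      using fun_cong[OF fun_cong[OF eq], of \<sigma> x] by (simp add: sect_apply[OF \<sigma> x])
    then have "sect_fun C \<sigma> x = sect_fun C' \<sigma> x" using triv_nonzero[OF \<sigma> x] by (rule scale_eq_scaleD)
    then show "(\<Sum>a\<in>weights. (C a - C' a) * char_val a \<xi>) = 0"
      using sum[of C] sum[of C'] by (simp add: left_diff_distrib sum_subtractf)
  qed
  then show ?thesis by simp
qed

lemma sect_cong: "(\<And>a. a \<in> weights \<Longrightarrow> C a = C' a) \<Longrightarrow> sect C = sect C'"
proof -
  assume "\<And>a. a \<in> weights \<Longrightarrow> C a = C' a"
  then have eq: "sect_fun C = sect_fun C'" by (simp add: sect_fun_def fun_eq_iff cong: sum.cong)
  show ?thesis unfolding sect_def eq by (rule refl)
qed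

lemma sect_add: "sect C + sect C' = sect (\<lambda>a. C a + C' a)"
  by (simp add: fun_eq_iff sect_def sect_fun_def distrib_right sum.distrib add_divide_distrib
      fibre_space.scale_left_distrib)

lemma section_scale_sect: "section_scale sc c (sect C) = sect (\<lambda>a. c * C a)"
  by (simp add: fun_eq_iff section_scale_def sect_def sect_fun_def mult.assoc flip: sum_distrib_left times_divide_eq_right)

lemma sect_zero: "sect (\<lambda>_. 0) = 0"
  by (simp add: fun_eq_iff sect_def sect_fun_def)

section \<open>A basis of the space of sections, and its weight spaces\<close>

sublocale sections: vector_space "section_scale sc :: complex \<Rightarrow> ((real ^ 'n) set \<Rightarrow> 'n point \<Rightarrow> 'v) \<Rightarrow> _"
  by unfold_locales
    (simp_all add: section_scale_def fun_eq_iff fibre_space.scale_left_distrib fibre_space.scale_right_distrib)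

definition char_sect :: "real ^ 'n \<Rightarrow> (real ^ 'n) set \<Rightarrow> 'n point \<Rightarrow> 'v" where
  "char_sect b = sect (\<lambda>a. if a = b then 1 else 0)"

lemma inj_on_char_sect: "inj_on char_sect weights"
proof (rule inj_onI)
  fix b b' assume "b \<in> weights" "char_sect b = char_sect b'"
  then show "b = b'" using sect_eqD[of "\<lambda>a. if a = b then 1 else 0" "\<lambda>a. if a = b' then 1 else 0" b]
    by (simp add: char_sect_def split: if_splits)
qed

lemma sum_char_sect: "(\<Sum>b\<in>weights. section_scale sc (C b) (char_sect b)) = sect C"
proof -
  have "(\<Sum>b\<in>T. section_scale sc (C b) (char_sect b)) = sect (\<lambda>a. if a \<in> T then C a else 0)" if "finite T" for T
    using that
  proof (induction T)
    case empty
    then show ?case by (simp add: sect_zero)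
  next
    case (insert b T)
    then have "(\<Sum>b\<in>insert b T. section_scale sc (C b) (char_sect b)) =
        sect (\<lambda>a. C b * (if a = b then 1 else 0) + (if a \<in> T then C a else 0))"
      by (simp add: char_sect_def section_scale_sect sect_add)
    also have "\<dots> = sect (\<lambda>a. if a \<in> insert b T then C a else 0)"
      using insert.hyps by (intro sect_cong) auto
    finally show ?case .
  qed
  from this[OF finite_weights] show ?thesis
    using sect_cong[of "\<lambda>a. if a \<in> weights then C a else 0" C] by simp
qed

lemma subspace_range_sect: "sections.subspace (range sect)"
proof (rule sections.subspaceI)
  show "0 \<in> range sect" using sect_zero by (metis rangeI)
  show "x + y \<in> range sect" if "x \<in> range sect" "y \<in> range sect" for x y
    using that by (auto simp: sect_add)
  show "section_scale sc c x \<in> range sect" if "x \<in> range sect" for c x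
    using that by (auto simp: section_scale_sect)
qed

lemma span_char_sect: "sections.span (char_sect ` weights) = global_sections \<Sigma> w sc L \<phi>"
  unfolding global_sections_eq
proof (intro subset_antisym sections.span_minimal subspace_range_sect subsetI)
  show "s \<in> range sect" if "s \<in> char_sect ` weights" for s
    using that by (auto simp: char_sect_def)
  fix s assume "s \<in> range sect"
  then obtain C where "s = sect C" by blast
  then have "s = (\<Sum>b\<in>weights. section_scale sc (C b) (char_sect b))" by (simp add: sum_char_sect)
  then show "s \<in> sections.span (char_sect ` weights)"
    by (simp add: sections.span_sum sections.span_scale sections.span_base)
qed

lemma independent_char_sect: "sections.independent (char_sect ` weights)"
proof (rule sections.independent_if_scalars_zero)
  fix f s assume f: "(\<Sum>s\<in>char_sect ` weights. section_scale sc (f s) s) = 0" and "s \<in> char_sect ` weights"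
  then obtain b where b: "b \<in> weights" "s = char_sect b" by blast
  have "sect (\<lambda>b. f (char_sect b)) = sect (\<lambda>_. 0)"
    using f by (simp add: sum.reindex[OF inj_on_char_sect] sum_char_sect sect_zero)
  from sect_eqD[OF this b(1)] show "f s = 0" by (simp add: b(2))
qed (simp add: finite_weights)

text \<open>The torus multiplies the coefficient at \<open>a\<close> by
  \<open>char_val a \<xi>\<close>. In a weight vector of weight \<open>b\<close> a nonzero
  coefficient at \<open>a\<close> thus forces equality of two characters, hence of \<open>a\<close>
  and \<open>b\<close>.\<close>

lemma weight_space_eq:
  "weight_space \<Sigma> w sc L \<phi> b = sections.span (if b \<in> weights then {char_sect b} else {})"
proof (intro subset_antisym subsetI)
  fix s assume s: "s \<in> weight_space \<Sigma> w sc L \<phi> b"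
  then obtain C where C: "s = sect C" using global_section_eq_sect unfolding weight_space_def by blast
  have "C a = 0" if a: "a \<in> weights" "a \<noteq> b" for a
  proof (rule ccontr)
    assume "C a \<noteq> 0"
    have "char_val a \<xi> = char_val b \<xi>" for \<xi>
    proof -
      have "section_act \<Sigma> w L \<xi> (sect C) = section_scale sc (char_val b \<xi>) (sect C)"
        using s unfolding weight_space_def C by blast
      then have "sect (\<lambda>a. char_val a \<xi> * C a) = sect (\<lambda>a. char_val b \<xi> * C a)"
        by (simp add: section_act_sect section_scale_sect)
      from sect_eqD[OF this a(1)] show ?thesis using \<open>C a \<noteq> 0\<close> by simp
    qed
    then show False using char_val_eqD a(2) by blast
  qed
  then have "s = sect (\<lambda>a. C b * (if a = b then 1 else 0))"
    unfolding C by (intro sect_cong) auto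
  then have sb: "s = section_scale sc (C b) (char_sect b)"
    by (simp add: char_sect_def section_scale_sect)
  show "s \<in> sections.span (if b \<in> weights then {char_sect b} else {})"
  proof (cases "b \<in> weights")
    case True
    then show ?thesis using sb by (simp add: sections.span_scale sections.span_base)
  next
    case False
    then have "char_sect b = sect (\<lambda>_. 0)" unfolding char_sect_def by (intro sect_cong) auto
    then show ?thesis using sb False by (simp add: sect_zero)
  qed
next
  fix s assume s: "s \<in> sections.span (if b \<in> weights then {char_sect b} else {})"
  have "\<exists>c. s = section_scale sc c (char_sect b)"
  proof (cases "b \<in> weights")
    case True
    then show ?thesis using s by (auto simp: sections.span_singleton)
  next
    case False
    then have "s = section_scale sc 0 (char_sect b)" using s by simp
    then show ?thesis by blast
  qed
  then obtain c where c: "s = sect (\<lambda>a. c * (if a = b then 1 else 0))"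
    by (auto simp: char_sect_def section_scale_sect)
  have "section_act \<Sigma> w L \<xi> s = section_scale sc (char_val b \<xi>) s" for \<xi>
    unfolding c section_act_sect section_scale_sect by (intro sect_cong) simp
  then show "s \<in> weight_space \<Sigma> w sc L \<phi> b"
    using sect_global unfolding weight_space_def c by blast
qed

lemma dim_weight_space:
  "sections.dim (weight_space \<Sigma> w sc L \<phi> b) = (if b \<in> weights then 1 else 0)"
proof (cases "b \<in> weights")
  case True
  then have "sections.independent {char_sect b}"
    by (intro sections.independent_mono[OF independent_char_sect]) simp
  from sections.dim_span_eq_card_independent[OF this] show ?thesis
    using True by (simp add: weight_space_eq del: sections.dim_span)
next
  case False
  then show ?thesis
    using sections.dim_span_eq_card_independent[OF sections.independent_empty]
    by (simp add: weight_space_eq del: sections.span_empty sections.dim_span)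
qed

lemma span_weight_spaces:
  "sections.span (\<Union>a\<in>weights. weight_space \<Sigma> w sc L \<phi> a) = global_sections \<Sigma> w sc L \<phi>"
proof
  have "(\<Union>a\<in>weights. weight_space \<Sigma> w sc L \<phi> a) \<subseteq> global_sections \<Sigma> w sc L \<phi>"
    by (auto simp: weight_space_def)
  then show "sections.span (\<Union>a\<in>weights. weight_space \<Sigma> w sc L \<phi> a) \<subseteq> global_sections \<Sigma> w sc L \<phi>"
    unfolding global_sections_eq by (intro sections.span_minimal subspace_range_sect)
  have "char_sect ` weights \<subseteq> (\<Union>a\<in>weights. weight_space \<Sigma> w sc L \<phi> a)"
    by (auto simp: weight_space_eq intro: sections.span_base)
  then show "global_sections \<Sigma> w sc L \<phi> \<subseteq> sections.span (\<Union>a\<in>weights. weight_space \<Sigma> w sc L \<phi> a)"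
    unfolding span_char_sect[symmetric] by (rule sections.span_mono)
qed

end

text \<open>The finite spanning set is part of the claim because \<open>dim\<close> alone does not
  distinguish the zero space from an infinite-dimensional one. Multiplicities are dimensions of
  weight spaces, and the final equation says that these spaces exhaust all sections.\<close>

theorem theorem2:
  fixes \<Sigma> :: "(real ^ 'n::finite) set set"
    and w :: "(real ^ 'n) set \<Rightarrow> nat"
    and sc :: "complex \<Rightarrow> 'v \<Rightarrow> 'v::ab_group_add"
    and L :: "(real ^ 'n) set \<Rightarrow> ('n, 'v) torus_bundle"
    and \<phi> :: "(real ^ 'n) set \<Rightarrow> (real ^ 'n) set \<Rightarrow> 'n point \<Rightarrow> 'v \<Rightarrow> 'v"
    and m :: "(real ^ 'n) set \<Rightarrow> real ^ 'n"
  assumes "weighted_fan \<Sigma> w"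
    and "vector_space sc"
    and "orbi_line_bundle \<Sigma> w sc L \<phi>"
    and "\<forall>\<sigma>\<in>max_cones \<Sigma>. m \<sigma> \<in> dual_lattice (cone_lattice \<Sigma> w \<sigma>)"
    and "\<forall>\<sigma>\<in>max_cones \<Sigma>. \<forall>\<sigma>'\<in>max_cones \<Sigma>. m \<sigma> - m \<sigma>' \<in> orthogonal_comp (\<sigma> \<inter> \<sigma>')"
    and "corresponds_to_characters \<Sigma> w sc L m"
  shows "finite (dual_lattice std_lattice \<inter> newton_polytope \<Sigma> m) \<and>
    (\<exists>B. finite B \<and> module.span (section_scale sc) B = global_sections \<Sigma> w sc L \<phi>) \<and>
    vector_space.dim (section_scale sc) (global_sections \<Sigma> w sc L \<phi>) =
      card (dual_lattice std_lattice \<inter> newton_polytope \<Sigma> m) \<and>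
    (\<forall>a\<in>dual_lattice std_lattice.
       vector_space.dim (section_scale sc) (weight_space \<Sigma> w sc L \<phi> a) =
         (if a \<in> newton_polytope \<Sigma> m then 1 else 0)) \<and>
    module.span (section_scale sc)
      (\<Union>a \<in> dual_lattice std_lattice \<inter> newton_polytope \<Sigma> m. weight_space \<Sigma> w sc L \<phi> a) =
      global_sections \<Sigma> w sc L \<phi>"
proof -
  interpret linearized_orbi_bundle \<Sigma> w sc L \<phi> m
    using assms by (rule linearized_orbi_bundle.intro)
  have "finite (char_sect ` weights)" by (simp add: finite_weights)
  moreover have "sections.dim (global_sections \<Sigma> w sc L \<phi>) = card weights"
    unfolding span_char_sect[symmetric] sections.dim_span_eq_card_independent[OF independent_char_sect]
    by (rule card_image[OF inj_on_char_sect])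
  moreover have "sections.dim (weight_space \<Sigma> w sc L \<phi> a) = (if a \<in> newton_polytope \<Sigma> m then 1 else 0)"
    if "a \<in> dual_lattice std_lattice" for a
    using that by (simp add: dim_weight_space weights_def)
  ultimately show ?thesis
    using finite_weights span_char_sect span_weight_spaces unfolding weights_def by blast
qed

end
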